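(* Let $K$ be a closed 3-cycle and $M=M(K)$ the associated compact oriented 3-manifold with boundary, and suppose $M$ has $h$ boundary components (equivalently, $K$ has $h$ zero-cells). There is a surjective regular map $$\coprod_{\sigma\in H^2(K;\mathbb Z/2\mathbb Z)}P_2^\sigma(K)\to V(K)$$ with fibers disjoint copies of $(\mathbb C^* )^h$, given by sending a Ptolemy assignment $c$ to the cross-ratios $z_i=\dfrac{c^i_{03}c^i_{12}}{c^i_{02}c^i_{13}}$ of the simplices $\Delta_i$.
   Context: A closed 3-cycle is a cell complex $K$ obtained from finitely many 3-simplices $\Delta_i$ with fixed vertex orderings (vertices $0,1,2,3$) by gluing all faces in pairs via order-preserving simplicial maps, such that the space $M(K)$ obtained by truncating the vertices of the simplices before gluing is an oriented 3-manifold with boundary. $\epsilon_i=\pm1$ indicates whether the vertex-order orientation of $\Delta_i$ agrees with that of $M(K)$. Ptolemy varieties for $n=2$: write $\mathbb Z/2=\{\pm1\}$. For a cellular cocycle $\sigma\in Z^2(K;\mathbb Z/2)$, $P_2^\sigma(K)$ is the set of assignments of a non-zero complex number $c^i_{jk}$ ($0\le j<k\le3$) to each edge $jk$ of each $\Delta_i$, agreeing on identified edges, such that $\sigma^i_2\sigma^i_3c^i_{03}c^i_{12}+\sigma^i_0\sigma^i_3c^i_{01}c^i_{23}=c^i_{02}c^i_{13}$ for each $i$, where $\sigma^i_j$ is the value of $\sigma$ on the face of $\Delta_i$ opposite vertex $j$. Up to canonical isomorphism $P_2^\sigma(K)$ depends only on the cohomology class of $\sigma$; for each class in $H^2(K;\mathbb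 Z/2)$ a representing cocycle is chosen. Gluing equation variety $V(K)$: the set of assignments $\Delta_i\mapsto z_i\in\mathbb C\setminus\{0,1\}$ satisfying the following equations. Assign to the edges of $\Delta_i$ the cross-ratio parameters $z_i$ (edges $01$, $23$), $z_i'=\frac1{1-z_i}$ (edges $12$, $03$), $z_i''=1-\frac1{z_i}$ (edges $02$, $13$); write $z(e)$ for the parameter of an edge $e$ of a simplex and $\epsilon(e)=\epsilon_i$ if $e$ is an edge of $\Delta_i$. For each edge $E$ of $K$: $\prod_{e\mapsto E}z(e)^{\epsilon(e)}=1$, the product over all edges of simplices identified to $E$. For each generator $\gamma$ of the fundamental group of each boundary component of $M$, represented by a normal curve in the induced triangulation of $\partial M$ by truncation triangles: $\prod_{\gamma\text{ passes }e}z(e)^{\pm\epsilon(e)}=1$, where $\gamma$ passes $e$ when it cuts off the corner corresponding to $e$ in a truncation triangle, and the sign is determined by whether it goes around $e$ counterclockwise or clockwise (the usual convention for the holonomy of the boundary similarity structure).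
   Formalization: The cross-ratio is taken with the sign of its Ptolemy term, z_i = σ_2σ_3 c_03c_12/(c_02c_13); the printed unsigned formula, which agrees when σ_2σ_3 = 1, can leave V(K) for a nontrivial representing cocycle. *)

theory Defs
  imports Complex_Main "HOL-Library.FuncSet" "HOL-Library.Disjoint_Sets"
begin

section \<open>Closed 3-cycles\<close>

text \<open>
  The vertices of each simplex are \<open>0, 1, 2, 3\<close>, and face \<open>f\<close> is the face opposite vertex \<open>f\<close>.
  A gluing of two faces by an order-preserving simplicial map is determined by the pair of
  faces, so the cell complex is given by an involution \<open>glue\<close> on the set of all faces.
\<close>

record 's gluing_data =
  simplices :: "'s set"
  glue :: "'s \<times> nat \<Rightarrow> 's \<times> nat"
  eps :: "'s \<Rightarrow> int"

definition faces :: "'s gluing_data \<Rightarrow> ('s \<times> nat) set" where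
  "faces K = simplices K \<times> {..<4}"

definition edges :: "'s gluing_data \<Rightarrow> ('s \<times> nat \<times> nat) set" where
  "edges K = {(i, j, k). i \<in> simplices K \<and> j < k \<and> k < 4}"

text \<open>
  Order-preserving gluing maps never identify an edge with its own reverse, so truncating the
  vertices of the simplices always yields a compact 3-manifold with boundary \<open>M(K)\<close>.
  An orientation of \<open>M(K)\<close> is an orientation of every simplex such that each face pairing
  reverses the induced orientations.  Relative to the vertex ordering, face \<open>f\<close> of simplex \<open>i\<close>
  has induced orientation \<open>eps K i * (-1) ^ f\<close>.
\<close>

definition closed_3_cycle :: "'s gluing_data \<Rightarrow> bool" where
  "closed_3_cycle K \<longleftrightarrow>
     finite (simplices K) \<and>
     (\<forall>x\<in>faces K. glue K x \<in> faces K \<and> glue K x \<noteq> x \<and> glue K (glue K x) = x) \<and>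
     (\<forall>i\<in>simplices K. eps K i \<in> {1, -1}) \<and>
     (\<forall>i f i' f'. (i, f) \<in> faces K \<and> glue K (i, f) = (i', f') \<longrightarrow>
        eps K i * (-1) ^ f = - (eps K i' * (-1) ^ f'))"

text \<open>
  \<open>glue_vertex f f'\<close> is the order-preserving bijection from \<open>{0,1,2,3} - {f}\<close> to
  \<open>{0,1,2,3} - {f'}\<close>; its value at \<open>f\<close> is irrelevant.
\<close>

definition glue_vertex :: "nat \<Rightarrow> nat \<Rightarrow> nat \<Rightarrow> nat" where
  "glue_vertex f f' v = (let m = (if v < f then v else v - 1) in if m < f' then m else m + 1)"

definition edge_glue :: "'s gluing_data \<Rightarrow> (('s \<times> nat \<times> nat) \<times> ('s \<times> nat \<times> nat)) set" where
  "edge_glue K = {((i, j, k), (i', glue_vertex f f' j, glue_vertex f f' k)) | i j k i' f f'.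
     (i, j, k) \<in> edges K \<and> (i, f) \<in> faces K \<and> f \<noteq> j \<and> f \<noteq> k \<and> glue K (i, f) = (i', f')}"

definition one_cells :: "'s gluing_data \<Rightarrow> ('s \<times> nat \<times> nat) set set" where
  "one_cells K = edges K // (edge_glue K)\<^sup>*"

definition vertex_glue :: "'s gluing_data \<Rightarrow> (('s \<times> nat) \<times> ('s \<times> nat)) set" where
  "vertex_glue K = {((i, v), (i', glue_vertex f f' v)) | i v i' f f'.
     (i, v) \<in> simplices K \<times> {..<4} \<and> (i, f) \<in> faces K \<and> f \<noteq> v \<and> glue K (i, f) = (i', f')}"

definition zero_cells :: "'s gluing_data \<Rightarrow> ('s \<times> nat) set set" where
  "zero_cells K = (simplices K \<times> {..<4}) // (vertex_glue K)\<^sup>*"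


section \<open>The boundary of the truncated complex\<close>

text \<open>
  The truncation triangle \<open>(i, v)\<close> cuts off vertex \<open>v\<close> of simplex \<open>i\<close>.  Its sides lie in the
  faces \<open>f \<noteq> v\<close>, and its corners lie on the edges \<open>vw\<close>.  The flag \<open>(i, v, f)\<close> stands for leaving
  the triangle \<open>(i, v)\<close> through its side in face \<open>f\<close>.  If \<open>cross K (i, v, f) = (i', v', f')\<close>, then one
  enters \<open>(i', v')\<close> through its side in face \<open>f'\<close>; thus \<open>cross K x\<close> is the same crossing traversed
  backwards.
\<close>

definition flags :: "'s gluing_data \<Rightarrow> ('s \<times> nat \<times> nat) set" where
  "flags K = {(i, v, f). i \<in> simplices K \<and> v < 4 \<and> f < 4 \<and> v \<noteq> f}"

fun triangle :: "'s \<times> nat \<times> nat \<Rightarrow> 's \<times> nat" where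
  "triangle (i, v, f) = (i, v)"

fun cross :: "'s gluing_data \<Rightarrow> 's \<times> nat \<times> nat \<Rightarrow> 's \<times> nat \<times> nat" where
  "cross K (i, v, f) = (case glue K (i, f) of (i', f') \<Rightarrow> (i', glue_vertex f f' v, f'))"

definition boundary_components :: "'s gluing_data \<Rightarrow> ('s \<times> nat) set set" where
  "boundary_components K =
     (simplices K \<times> {..<4}) // {(triangle x, triangle (cross K x)) | x. x \<in> flags K}\<^sup>*"

lemma boundary_components_eq_zero_cells: "boundary_components K = zero_cells K"
proof -
  have "{(triangle x, triangle (cross K x)) | x. x \<in> flags K} = vertex_glue K" (is "?A = _")
  proof
    show "?A \<subseteq> vertex_glue K"
    proof
      fix p assume "p \<in> ?A"
      then obtain i v f where *: "(i, v, f) \<in> flags K"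
        "p = (triangle (i, v, f), triangle (cross K (i, v, f)))" by auto
      obtain i' f' where "glue K (i, f) = (i', f')" by fastforce
      with * show "p \<in> vertex_glue K"
        unfolding vertex_glue_def flags_def faces_def by fastforce
    qed
    show "vertex_glue K \<subseteq> ?A"
    proof
      fix p assume "p \<in> vertex_glue K"
      then obtain i v i' f f' where *: "i \<in> simplices K" "v < 4" "f < 4" "f \<noteq> v"
        "glue K (i, f) = (i', f')" "p = ((i, v), (i', glue_vertex f f' v))"
        unfolding vertex_glue_def faces_def by auto
      then have "(i, v, f) \<in> flags K" "p = (triangle (i, v, f), triangle (cross K (i, v, f)))"
        by (auto simp: flags_def)
      then show "p \<in> ?A" by blast
    qed
  qed
  then show ?thesis
    by (simp add: boundary_components_def zero_cells_def)
qed

text \<open>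
  The fundamental groupoid of \<open>\<partial>M\<close> is the edge-path groupoid of the cell structure dual to the
  induced triangulation: paths are chains of crossings, and homotopy is generated by deleting a
  crossing followed by its reverse and by deleting a loop that turns around one corner
  (a vertex of the triangulation of \<open>\<partial>M\<close>).
\<close>

fun path :: "'s gluing_data \<Rightarrow> 's \<times> nat \<Rightarrow> ('s \<times> nat \<times> nat) list \<Rightarrow> 's \<times> nat \<Rightarrow> bool" where
  "path K s [] t \<longleftrightarrow> s = t"
| "path K s (x # xs) t \<longleftrightarrow> x \<in> flags K \<and> triangle x = s \<and> path K (triangle (cross K x)) xs t"

definition reverse_path :: "'s gluing_data \<Rightarrow> ('s \<times> nat \<times> nat) list \<Rightarrow> ('s \<times> nat \<times> nat) list" where
  "reverse_path K xs = rev (map (cross K) xs)"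

text \<open>The element of \<open>{0,1,2,3}\<close> different from three given distinct ones.\<close>

definition fourth :: "nat \<Rightarrow> nat \<Rightarrow> nat \<Rightarrow> nat" where
  "fourth a b c = 6 - (a + b + c)"

text \<open>
  \<open>(i, v, w, f)\<close> stands for leaving the triangle \<open>(i, v)\<close> through its side in face \<open>f\<close> while turning
  around its corner on the edge \<open>vw\<close>; \<open>pivot\<close> makes one step in this rotation.
\<close>

fun pivot :: "'s gluing_data \<Rightarrow> 's \<times> nat \<times> nat \<times> nat \<Rightarrow> 's \<times> nat \<times> nat \<times> nat" where
  "pivot K (i, v, w, f) = (case glue K (i, f) of (i', f') \<Rightarrow>
     (let v' = glue_vertex f f' v; w' = glue_vertex f f' w in (i', v', w', fourth v' w' f')))"

definition corner_loop :: "'s gluing_data \<Rightarrow> ('s \<times> nat \<times> nat) list \<Rightarrow> bool" where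
  "corner_loop K xs \<longleftrightarrow> (\<exists>i v w f n. i \<in> simplices K \<and> {v, w, f} \<subseteq> {..<4} \<and> distinct [v, w, f] \<and>
     n > 0 \<and> (pivot K ^^ n) (i, v, w, f) = (i, v, w, f) \<and>
     xs = map (\<lambda>k. case (pivot K ^^ k) (i, v, w, f) of (i', v', w', f') \<Rightarrow> (i', v', f')) [0..<n])"

inductive homotopic_paths :: "'s gluing_data \<Rightarrow> 's \<times> nat \<Rightarrow> 's \<times> nat \<Rightarrow>
    ('s \<times> nat \<times> nat) list \<Rightarrow> ('s \<times> nat \<times> nat) list \<Rightarrow> bool"
  for K s t where
  refl: "path K s xs t \<Longrightarrow> homotopic_paths K s t xs xs"
| sym: "homotopic_paths K s t xs ys \<Longrightarrow> homotopic_paths K s t ys xs"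
| trans: "homotopic_paths K s t xs ys \<Longrightarrow> homotopic_paths K s t ys zs \<Longrightarrow> homotopic_paths K s t xs zs"
| backtrack: "path K s (xs @ [x, cross K x] @ ys) t \<Longrightarrow> path K s (xs @ ys) t \<Longrightarrow>
    homotopic_paths K s t (xs @ [x, cross K x] @ ys) (xs @ ys)"
| corner: "path K s (xs @ ls @ ys) t \<Longrightarrow> path K s (xs @ ys) t \<Longrightarrow> corner_loop K ls \<Longrightarrow>
    homotopic_paths K s t (xs @ ls @ ys) (xs @ ys)"

text \<open>All loops at \<open>b\<close> whose class lies in the subgroup generated by the loops in \<open>L\<close>.\<close>

inductive_set generated_loops :: "'s gluing_data \<Rightarrow> 's \<times> nat \<Rightarrow>
    ('s \<times> nat \<times> nat) list set \<Rightarrow> ('s \<times> nat \<times> nat) list set"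
  for K b L where
  Nil: "[] \<in> generated_loops K b L"
| forward: "p \<in> generated_loops K b L \<Longrightarrow> l \<in> L \<Longrightarrow> p @ l \<in> generated_loops K b L"
| backward: "p \<in> generated_loops K b L \<Longrightarrow> l \<in> L \<Longrightarrow> p @ reverse_path K l \<in> generated_loops K b L"
| homotopic: "p \<in> generated_loops K b L \<Longrightarrow> homotopic_paths K b b p q \<Longrightarrow> q \<in> generated_loops K b L"

text \<open>
  A closed normal curve, as a cyclic sequence of crossings; normality means that it never leaves
  a triangle through the side through which it entered.
\<close>

definition closed_normal_curve :: "'s gluing_data \<Rightarrow> ('s \<times> nat \<times> nat) list \<Rightarrow> bool" where
  "closed_normal_curve K \<gamma> \<longleftrightarrow> \<gamma> \<noteq> [] \<and> path K (triangle (hd \<gamma>)) \<gamma> (triangle (hd \<gamma>)) \<and>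
     (\<forall>k<length \<gamma>. cross K (\<gamma> ! k) \<noteq> \<gamma> ! (Suc k mod length \<gamma>))"

text \<open>
  \<open>\<Gamma>\<close> is a set of closed normal curves representing a generating set of the fundamental group of
  each boundary component.  A closed curve \<open>\<gamma>\<close> represents an element of the group based at the
  triangle \<open>b\<close> by means of a path \<open>\<alpha> \<gamma>\<close> from \<open>b\<close> to its starting point.
\<close>

definition pi1_generating_curves :: "'s gluing_data \<Rightarrow> ('s \<times> nat \<times> nat) list set \<Rightarrow> bool" where
  "pi1_generating_curves K \<Gamma> \<longleftrightarrow>
     (\<forall>\<gamma>\<in>\<Gamma>. closed_normal_curve K \<gamma>) \<and>
     (\<forall>B\<in>boundary_components K. \<exists>b\<in>B. \<exists>\<alpha>.
        (\<forall>\<gamma>\<in>\<Gamma>. triangle (hd \<gamma>) \<in> B \<longrightarrow> path K b (\<alpha> \<gamma>) (triangle (hd \<gamma>))) \<and>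
        {p. path K b p b} \<subseteq>
          generated_loops K b
            {\<alpha> \<gamma> @ \<gamma> @ reverse_path K (\<alpha> \<gamma>) | \<gamma>. \<gamma> \<in> \<Gamma> \<and> triangle (hd \<gamma>) \<in> B})"


section \<open>The gluing equation variety\<close>

definition shape :: "('s \<Rightarrow> complex) \<Rightarrow> 's \<Rightarrow> nat \<Rightarrow> nat \<Rightarrow> complex" where
  "shape z i j k =
     (if {j, k} = {0, 1} \<or> {j, k} = {2, 3} then z i
      else if {j, k} = {1, 2} \<or> {j, k} = {0, 3} then 1 / (1 - z i)
      else 1 - 1 / z i)"

text \<open>The sign of the permutation \<open>(v, w, a, b)\<close> of \<open>(0, 1, 2, 3)\<close>, as the sign of its Vandermonde product.\<close>

definition perm_sign :: "nat \<Rightarrow> nat \<Rightarrow> nat \<Rightarrow> nat \<Rightarrow> int" where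
  "perm_sign v w a b =
     (let x = int v; y = int w; s = int a; t = int b in
      sgn ((y - x) * (s - x) * (t - x) * (s - y) * (t - y) * (t - s)))"

text \<open>
  Passing through triangle \<open>(i, v)\<close> from its side in face \<open>a\<close> to its side in face \<open>b\<close> cuts off the
  corner on the edge \<open>vw\<close> with \<open>w = fourth v a b\<close>.  The side in face \<open>a\<close> joins the corners on \<open>vw\<close>
  and \<open>vb\<close>, the side in face \<open>b\<close> those on \<open>vw\<close> and \<open>va\<close>.  With respect to the orientation of \<open>M\<close>
  and seen from the truncated vertex, the turn is therefore counterclockwise iff
  \<open>eps K i * perm_sign v w a b = 1\<close>.  Looking from the other side inverts every cusp
  equation and so gives the same variety.
\<close>

definition turn_sign :: "'s gluing_data \<Rightarrow> 's \<Rightarrow> nat \<Rightarrow> nat \<Rightarrow> nat \<Rightarrow> int" where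
  "turn_sign K i v a b = eps K i * perm_sign v (fourth v a b) a b"

text \<open>The factor contributed by entering through \<open>cross K x\<close> and leaving through \<open>y\<close>.\<close>

definition corner_factor ::
    "'s gluing_data \<Rightarrow> ('s \<Rightarrow> complex) \<Rightarrow> 's \<times> nat \<times> nat \<Rightarrow> 's \<times> nat \<times> nat \<Rightarrow> complex" where
  "corner_factor K z x y = (case (cross K x, y) of ((_, _, a), (i, v, b)) \<Rightarrow>
     shape z i v (fourth v a b) powi (turn_sign K i v a b * eps K i))"

definition curve_holonomy ::
    "'s gluing_data \<Rightarrow> ('s \<Rightarrow> complex) \<Rightarrow> ('s \<times> nat \<times> nat) list \<Rightarrow> complex" where
  "curve_holonomy K z \<gamma> = (\<Prod>k<length \<gamma>. corner_factor K z (\<gamma> ! k) (\<gamma> ! (Suc k mod length \<gamma>)))"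

definition gluing_variety ::
    "'s gluing_data \<Rightarrow> ('s \<times> nat \<times> nat) list set \<Rightarrow> ('s \<Rightarrow> complex) set" where
  "gluing_variety K \<Gamma> = {z \<in> simplices K \<rightarrow>\<^sub>E - {0, 1}.
     (\<forall>E\<in>one_cells K. (\<Prod>(i, j, k)\<in>E. shape z i j k powi eps K i) = 1) \<and>
     (\<forall>\<gamma>\<in>\<Gamma>. curve_holonomy K z \<gamma> = 1)}"


section \<open>Cohomology with coefficients in \<open>{1, -1}\<close> and Ptolemy varieties\<close>

definition cochains1 :: "'s gluing_data \<Rightarrow> ('s \<times> nat \<times> nat \<Rightarrow> int) set" where
  "cochains1 K = {\<tau> \<in> edges K \<rightarrow>\<^sub>E {1, -1}. \<forall>(e, e')\<in>edge_glue K. \<tau> e = \<tau> e'}"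

definition cocycles2 :: "'s gluing_data \<Rightarrow> ('s \<times> nat \<Rightarrow> int) set" where
  "cocycles2 K = {\<sigma> \<in> faces K \<rightarrow>\<^sub>E {1, -1}.
     (\<forall>x\<in>faces K. \<sigma> (glue K x) = \<sigma> x) \<and> (\<forall>i\<in>simplices K. (\<Prod>f<4. \<sigma> (i, f)) = 1)}"

definition coboundary1 :: "('s \<times> nat \<times> nat \<Rightarrow> int) \<Rightarrow> 's \<times> nat \<Rightarrow> int" where
  "coboundary1 \<tau> = (\<lambda>(i, f). \<Prod>(j, k)\<in>{(j, k). j < k \<and> k < 4 \<and> j \<noteq> f \<and> k \<noteq> f}. \<tau> (i, j, k))"

definition H2 :: "'s gluing_data \<Rightarrow> ('s \<times> nat \<Rightarrow> int) set set" where
  "H2 K = cocycles2 K // {(\<sigma>, \<sigma>'). \<sigma> \<in> cocycles2 K \<and> \<sigma>' \<in> cocycles2 K \<and>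
     (\<exists>\<tau>\<in>cochains1 K. \<forall>x\<in>faces K. \<sigma>' x = \<sigma> x * coboundary1 \<tau> x)}"

definition ptolemy_variety ::
    "'s gluing_data \<Rightarrow> ('s \<times> nat \<Rightarrow> int) \<Rightarrow> ('s \<times> nat \<times> nat \<Rightarrow> complex) set" where
  "ptolemy_variety K \<sigma> = {c \<in> edges K \<rightarrow>\<^sub>E - {0}.
     (\<forall>(e, e')\<in>edge_glue K. c e = c e') \<and>
     (\<forall>i\<in>simplices K.
        of_int (\<sigma> (i, 2) * \<sigma> (i, 3)) * c (i, 0, 3) * c (i, 1, 2) +
        of_int (\<sigma> (i, 0) * \<sigma> (i, 3)) * c (i, 0, 1) * c (i, 2, 3) =
        c (i, 0, 2) * c (i, 1, 3))}"

text \<open>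
  The cross-ratio of a simplex.  For the trivial cocycle it is \<open>c03 c12 / (c02 c13)\<close>.  For a
  general cocycle \<open>\<sigma>\<close> it carries the sign of the corresponding term of the Ptolemy relation, so that
  \<open>1 - z = \<sigma>0 \<sigma>3 c01 c23 / (c02 c13)\<close>; this makes it invariant under the canonical isomorphisms
  between the Ptolemy varieties of cohomologous cocycles.  Without the sign the map would not
  take values in the gluing equation variety.
\<close>

definition cross_ratios ::
    "'s gluing_data \<Rightarrow> ('s \<times> nat \<Rightarrow> int) \<Rightarrow> ('s \<times> nat \<times> nat \<Rightarrow> complex) \<Rightarrow> 's \<Rightarrow> complex" where
  "cross_ratios K \<sigma> c = (\<lambda>i\<in>simplices K.
     of_int (\<sigma> (i, 2) * \<sigma> (i, 3)) * (c (i, 0, 3) * c (i, 1, 2) / (c (i, 0, 2) * c (i, 1, 3))))"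

text \<open>Disjoint union over \<open>H2 K\<close>, where \<open>rep\<close> picks a representing cocycle in each class.\<close>

definition ptolemy_coproduct ::
    "'s gluing_data \<Rightarrow> (('s \<times> nat \<Rightarrow> int) set \<Rightarrow> 's \<times> nat \<Rightarrow> int) \<Rightarrow>
     (('s \<times> nat \<Rightarrow> int) set \<times> ('s \<times> nat \<times> nat \<Rightarrow> complex)) set" where
  "ptolemy_coproduct K rep = (SIGMA C:H2 K. ptolemy_variety K (rep C))"

definition cross_ratio_map ::
    "'s gluing_data \<Rightarrow> (('s \<times> nat \<Rightarrow> int) set \<Rightarrow> 's \<times> nat \<Rightarrow> int) \<Rightarrow>
     ('s \<times> nat \<Rightarrow> int) set \<times> ('s \<times> nat \<times> nat \<Rightarrow> complex) \<Rightarrow> 's \<Rightarrow> complex" where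
  "cross_ratio_map K rep = (\<lambda>(C, c). cross_ratios K (rep C) c)"


section \<open>Regular maps between subsets of affine spaces\<close>

text \<open>
  Affine space is \<open>'i \<Rightarrow> complex\<close>.  Varieties with finitely many coordinates \<open>J\<close> are embedded as sets
  of functions that are \<open>undefined\<close> outside \<open>J\<close>; the remaining coordinates are constant there
  and do not affect the notions below.
\<close>

inductive polynomial_fun :: "(('i \<Rightarrow> complex) \<Rightarrow> complex) \<Rightarrow> bool" where
  const: "polynomial_fun (\<lambda>x. a)"
| coord: "polynomial_fun (\<lambda>x. x i)"
| add: "polynomial_fun p \<Longrightarrow> polynomial_fun q \<Longrightarrow> polynomial_fun (\<lambda>x. p x + q x)"
| mult: "polynomial_fun p \<Longrightarrow> polynomial_fun q \<Longrightarrow> polynomial_fun (\<lambda>x. p x * q x)"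

definition zariski_closed_in :: "('i \<Rightarrow> complex) set \<Rightarrow> ('i \<Rightarrow> complex) set \<Rightarrow> bool" where
  "zariski_closed_in X A \<longleftrightarrow>
     (\<exists>P. (\<forall>p\<in>P. polynomial_fun p) \<and> A = {x \<in> X. \<forall>p\<in>P. p x = 0})"

definition regular_fun :: "('i \<Rightarrow> complex) set \<Rightarrow> (('i \<Rightarrow> complex) \<Rightarrow> complex) \<Rightarrow> bool" where
  "regular_fun X f \<longleftrightarrow>
     (\<forall>x\<in>X. \<exists>U p q. x \<in> U \<and> U \<subseteq> X \<and> zariski_closed_in X (X - U) \<and>
        polynomial_fun p \<and> polynomial_fun q \<and> (\<forall>y\<in>U. q y \<noteq> 0 \<and> f y = p y / q y))"

definition regular_map ::
    "('i \<Rightarrow> complex) set \<Rightarrow> ('j \<Rightarrow> complex) set \<Rightarrow> (('i \<Rightarrow> complex) \<Rightarrow> 'j \<Rightarrow> complex) \<Rightarrow> bool" where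
  "regular_map X Y F \<longleftrightarrow> F ` X \<subseteq> Y \<and> (\<forall>j. regular_fun X (\<lambda>x. F x j))"

definition isomorphic_varieties :: "('i \<Rightarrow> complex) set \<Rightarrow> ('j \<Rightarrow> complex) set \<Rightarrow> bool" where
  "isomorphic_varieties X Y \<longleftrightarrow>
     (\<exists>F G. regular_map X Y F \<and> regular_map Y X G \<and>
        (\<forall>x\<in>X. G (F x) = x) \<and> (\<forall>y\<in>Y. F (G y) = y))"

text \<open>The torus \<open>(\<complex>\<^sup>*)\<^sup>h\<close>.\<close>

definition torus :: "nat \<Rightarrow> (nat \<Rightarrow> complex) set" where
  "torus h = {..<h} \<rightarrow>\<^sub>E - {0}"

definition regular_on_coproduct ::
    "'a set \<Rightarrow> ('a \<Rightarrow> ('i \<Rightarrow> complex) set) \<Rightarrow> ('j \<Rightarrow> complex) set \<Rightarrow>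
     ('a \<times> ('i \<Rightarrow> complex) \<Rightarrow> 'j \<Rightarrow> complex) \<Rightarrow> bool" where
  "regular_on_coproduct I X Y F \<longleftrightarrow> (\<forall>C\<in>I. regular_map (X C) Y (\<lambda>c. F (C, c)))"

text \<open>
  A subset \<open>S\<close> of the coproduct is a disjoint union of copies of \<open>(\<complex>\<^sup>*)\<^sup>h\<close> as a variety: it is a finite
  union of pairwise disjoint subsets, each contained and Zariski closed in one summand
  (hence each also open in \<open>S\<close>) and isomorphic to the torus.
\<close>

definition disjoint_tori ::
    "'a set \<Rightarrow> ('a \<Rightarrow> ('i \<Rightarrow> complex) set) \<Rightarrow> nat \<Rightarrow> ('a \<times> ('i \<Rightarrow> complex)) set \<Rightarrow> bool" where
  "disjoint_tori I X h S \<longleftrightarrow>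
     (\<exists>\<T>. finite \<T> \<and> disjoint \<T> \<and> S = \<Union>\<T> \<and>
        (\<forall>T\<in>\<T>. \<exists>C\<in>I. \<exists>A. T = {C} \<times> A \<and> zariski_closed_in (X C) A \<and>
           isomorphic_varieties (torus h) A))"

end

theory Submission
  imports Defs
begin

text \<open>
  The link between Ptolemy assignments and gluing equations is the Euclidean geometry of the
  truncation triangles.  Let \<open>c\<close> be a Ptolemy assignment with obstruction cocycle \<open>\<sigma>\<close>, and let
  \<open>v, w, b\<close> be the vertices of the face \<open>f\<close> of the simplex \<open>i\<close>.  Give the side of the triangle
  \<open>(i, v)\<close> in \<open>f\<close> the complex length \<open>eps i * (-1)^f * \<sigma> f * c wb / (c vw * c vb)\<close>
  (\<open>side_length\<close>).  The factor \<open>eps i * (-1)^f\<close> accounts for the direction of the side when one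
  leaves the triangle through it, so the two copies of a glued side get opposite lengths, and the
  Ptolemy relation together with the definition of the cross-ratios says precisely that the sides
  of one triangle are related by the shape parameters at its corners.  A function on the flags with
  these two properties is a \<open>side_lengths\<close> system for \<open>z\<close>.  Such systems connect the two
  varieties.

  Gluing equations.  Inside each triangle the shape parameters determine the side lengths up to
  a common factor, because \<open>z * z' * z'' = -1\<close>.  Comparing these factors along crossings gives a
  multiplicative holonomy for paths in the boundary.  Up to powers and inversion, the holonomy of a loop
  around a corner is the product in an edge equation (\<open>corner_loop_ratio\<close>); that of a normal curve is
  the product in its cusp equation (\<open>curve_holonomy_ratio\<close>).  So a \<open>side_lengths\<close> system forces all equations
  (\<open>gluing_equations_of_side_lengths\<close>), and conversely the equations make the holonomy trivial on
  the fundamental group of every boundary component, so that the factors can be chosen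
  consistently (\<open>side_lengths_exist\<close>).  Two systems for the same \<open>z\<close> differ by one factor for each
  0-cell (\<open>side_lengths_unique\<close>).

  Ptolemy assignments.  In a face with vertices \<open>v, w, b\<close> the lengths at \<open>v\<close> and \<open>w\<close> multiply to
  \<open>1 / (c vw)^2\<close>.  Hence a \<open>side_lengths\<close> system determines \<open>c\<close> up to a sign on each 1-cell, and once
  the signs are chosen it determines \<open>\<sigma>\<close>; another choice of signs changes \<open>\<sigma>\<close> by a coboundary
  (\<open>ptolemy_of_side_lengths\<close>, \<open>twist_ptolemy\<close>).  This gives surjectivity, and it shows that two
  assignments with the same cross-ratios have cohomologous obstruction cocycles and satisfy
  \<open>c' jk = \<tau> jk * y j * y k * c jk\<close> with a 1-cochain \<open>\<tau>\<close> and weights \<open>y\<close> on the 0-cells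
  (\<open>same_cross_ratios\<close>).

  Fibers.  A fiber therefore lies over one cohomology class and is a finite union of orbits
  \<open>{(jk \<mapsto> y j * y k * c jk)}\<close>, one for each class of 1-cocycles \<open>\<tau>\<close>.  The weights act with kernel
  \<open>{1, -1}\<close> on each connected component, but with a base 0-cell \<open>0\<close> in each component the orbit is
  parametrized bijectively by \<open>u x = y x * y 0\<close>, since \<open>y j * y k = u j * u k / u 0\<close>.  The \<open>u x\<close> are
  Laurent monomials in the edge values, because \<open>y v * y v\<close> can be read off from a triangle with
  vertex \<open>v\<close> and \<open>y 0 * y w = (y 0 * y v) * (y v * y w) / (y v * y v)\<close> continues along an edge.
  So the orbit is a torus of dimension \<open>h\<close>, and it is closed as the set fixed by the composite
  of the parametrization with its regular inverse (\<open>orbit_torus\<close>).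
\<close>

section \<open>Order-preserving gluing maps and the sign of a permutation\<close>

lemma glue_vertex_less: "f < 4 \<Longrightarrow> f' < 4 \<Longrightarrow> v < 4 \<Longrightarrow> v \<noteq> f \<Longrightarrow> glue_vertex f f' v < 4"
  by (auto simp: glue_vertex_def Let_def)

lemma glue_vertex_neq: "v \<noteq> f \<Longrightarrow> glue_vertex f f' v \<noteq> f'"
  by (auto simp: glue_vertex_def Let_def)

lemma glue_vertex_inverse: "v \<noteq> f \<Longrightarrow> glue_vertex f' f (glue_vertex f f' v) = v"
  by (auto simp: glue_vertex_def Let_def split: if_splits)

lemma glue_vertex_less_iff:
  "v \<noteq> f \<Longrightarrow> w \<noteq> f \<Longrightarrow> glue_vertex f f' v < glue_vertex f f' w \<longleftrightarrow> v < w"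
  by (auto simp: glue_vertex_def Let_def split: if_splits)

lemma glue_vertex_eq_iff:
  "v \<noteq> f \<Longrightarrow> w \<noteq> f \<Longrightarrow> glue_vertex f f' v = glue_vertex f f' w \<longleftrightarrow> v = w"
  by (metis glue_vertex_inverse)

lemma glue_vertex_min_max:
  assumes "v \<noteq> f" "w \<noteq> f"
  shows "glue_vertex f f' (min v w) = min (glue_vertex f f' v) (glue_vertex f f' w)"
    and "glue_vertex f f' (max v w) = max (glue_vertex f f' v) (glue_vertex f f' w)"
  using glue_vertex_less_iff[OF assms, of f'] by (auto simp: min_def max_def not_le split: if_splits)

definition tetrad :: "nat \<Rightarrow> nat \<Rightarrow> nat \<Rightarrow> nat \<Rightarrow> bool" where
  "tetrad v w a b \<longleftrightarrow> distinct [v, w, a, b] \<and> {v, w, a, b} \<subseteq> {..<4}"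

lemma less_4_cases: "(n::nat) < 4 \<Longrightarrow> n = 0 \<or> n = 1 \<or> n = 2 \<or> n = 3"
  by auto

lemma tetrad_cases:
  assumes "tetrad v w a b"
  shows "(v, w, a, b) \<in> {(0,1,2,3), (0,1,3,2), (0,2,1,3), (0,2,3,1), (0,3,1,2), (0,3,2,1),
    (1,0,2,3), (1,0,3,2), (1,2,0,3), (1,2,3,0), (1,3,0,2), (1,3,2,0),
    (2,0,1,3), (2,0,3,1), (2,1,0,3), (2,1,3,0), (2,3,0,1), (2,3,1,0),
    (3,0,1,2), (3,0,2,1), (3,1,0,2), (3,1,2,0), (3,2,0,1), (3,2,1,0)}"
proof -
  have "v < 4" "w < 4" "a < 4" "b < 4" "distinct [v, w, a, b]"
    using assms by (auto simp: tetrad_def)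
  then show ?thesis
    using less_4_cases[OF \<open>v < 4\<close>] less_4_cases[OF \<open>w < 4\<close>] less_4_cases[OF \<open>a < 4\<close>]
      less_4_cases[OF \<open>b < 4\<close>]
    by (elim disjE) simp_all
qed

lemma tetrad_swap:
  "tetrad v w a b \<Longrightarrow> tetrad w v a b"
  "tetrad v w a b \<Longrightarrow> tetrad v w b a"
  by (auto simp: tetrad_def)

lemma fourth_tetrad:
  assumes "tetrad v w a b"
  shows "fourth v w a = b" "fourth v w b = a"
  using tetrad_cases[OF assms] by (auto simp: fourth_def)

lemma tetrad_fourth:
  assumes "distinct [v, w, a]" "{v, w, a} \<subseteq> {..<4}"
  shows "tetrad v w a (fourth v w a)"
proof -
  have "v < 4" "w < 4" "a < 4" using assms by auto
  then show ?thesis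
    using less_4_cases[OF \<open>v < 4\<close>] less_4_cases[OF \<open>w < 4\<close>] less_4_cases[OF \<open>a < 4\<close>] assms(1)
    by (elim disjE) (simp_all add: tetrad_def fourth_def)
qed

text \<open>
  The sign of the permutation that sorts \<open>v, w, b\<close>.  The sign of \<open>(v, w, b, f)\<close> splits into it and
  a sign that depends on \<open>f\<close> alone; gluing maps preserve the first factor, and the orientation
  condition of a closed 3-cycle controls the second.
\<close>

definition order_sign :: "nat \<Rightarrow> nat \<Rightarrow> nat \<Rightarrow> int" where
  "order_sign v w b = sgn ((int w - int v) * (int b - int v) * (int b - int w))"

lemma perm_sign_face:
  assumes "tetrad v w b f"
  shows "perm_sign v w b f = - ((-1) ^ f) * order_sign v w b"
  using tetrad_cases[OF assms] by (elim insertE) (auto simp: perm_sign_def order_sign_def Let_def)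

lemma perm_sign_swap:
  assumes "tetrad v w a b"
  shows "perm_sign v w b a = - perm_sign v w a b" "perm_sign w v a b = - perm_sign v w a b"
    "perm_sign v w a b \<in> {1, -1}"
  using tetrad_cases[OF assms] by (elim insertE; simp add: perm_sign_def Let_def)+

lemma order_sign_glue:
  assumes "v \<noteq> f" "w \<noteq> f" "b \<noteq> f"
  shows "order_sign (glue_vertex f f' v) (glue_vertex f f' w) (glue_vertex f f' b) = order_sign v w b"
proof -
  let ?g = "glue_vertex f f'"
  have sg: "sgn (int (?g y) - int (?g x)) = sgn (int y - int x)" if "x \<noteq> f" "y \<noteq> f" for x y
    using glue_vertex_less_iff[OF that, of f'] glue_vertex_less_iff[OF that(2,1), of f']
      glue_vertex_eq_iff[OF that, of f']
    by (auto simp: sgn_if)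
  show ?thesis unfolding order_sign_def sgn_mult by (simp add: sg assms)
qed

lemma tetrad_glue:
  assumes "tetrad v w b f" "f' < 4"
  shows "tetrad (glue_vertex f f' v) (glue_vertex f f' w) (glue_vertex f f' b) f'"
  using assms by (auto simp: tetrad_def glue_vertex_less glue_vertex_neq glue_vertex_eq_iff)

section \<open>Rotation around a 1-cell\<close>

locale three_cycle =
  fixes K :: "'s gluing_data"
  assumes closed: "closed_3_cycle K"
begin

lemma glue_faces:
  assumes "i \<in> simplices K" "f < 4"
  obtains i' f' where "glue K (i, f) = (i', f')" "i' \<in> simplices K" "f' < 4"
    "glue K (i', f') = (i, f)" "eps K i * (-1) ^ f = - (eps K i' * (-1) ^ f')"
proof -
  obtain i' f' where g: "glue K (i, f) = (i', f')" by fastforce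
  have x: "(i, f) \<in> faces K" using assms by (simp add: faces_def)
  have "(i', f') \<in> faces K" "glue K (i', f') = (i, f)"
    using closed x g unfolding closed_3_cycle_def by (metis)+
  moreover have "eps K i * (-1) ^ f = - (eps K i' * (-1) ^ f')"
    using closed x g unfolding closed_3_cycle_def by blast
  ultimately show thesis using that g by (auto simp: faces_def)
qed

lemma eps_cases: "i \<in> simplices K \<Longrightarrow> eps K i = 1 \<or> eps K i = -1"
  using closed by (auto simp: closed_3_cycle_def)

lemma finite_simplices: "finite (simplices K)"
  using closed by (simp add: closed_3_cycle_def)

lemma cross_flags:
  assumes "x \<in> flags K"
  shows "cross K x \<in> flags K" "cross K (cross K x) = x"
proof -
  obtain i v f where x: "x = (i, v, f)" "i \<in> simplices K" "v < 4" "f < 4" "v \<noteq> f"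
    using assms by (auto simp: flags_def)
  obtain i' f' where g: "glue K (i, f) = (i', f')" "i' \<in> simplices K" "f' < 4"
    "glue K (i', f') = (i, f)" by (rule glue_faces[OF x(2,4)])
  show "cross K x \<in> flags K" "cross K (cross K x) = x"
    using x g by (auto simp: flags_def glue_vertex_less glue_vertex_neq glue_vertex_inverse)
qed

text \<open>
  A corner \<open>(i, v, w, f)\<close> is a state of the rotation around the edge \<open>vw\<close> of \<open>i\<close>: one stands in the
  triangle \<open>(i, v)\<close>, facing its side in \<open>f\<close>.  A pivot step is the composite of two fixed-point free
  involutions, moving through the face and turning from one face at the edge to the other.
  Each of them reverses \<open>orient\<close>, so pivoting preserves it.
\<close>

definition corners :: "('s \<times> nat \<times> nat \<times> nat) set" where
  "corners = {(i, v, w, f). i \<in> simplices K \<and> distinct [v, w, f] \<and> {v, w, f} \<subseteq> {..<4}}"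

fun turn :: "'s \<times> nat \<times> nat \<times> nat \<Rightarrow> 's \<times> nat \<times> nat \<times> nat" where
  "turn (i, v, w, f) = (i, v, w, fourth v w f)"

fun transport :: "'s \<times> nat \<times> nat \<times> nat \<Rightarrow> 's \<times> nat \<times> nat \<times> nat" where
  "transport (i, v, w, f) =
     (case glue K (i, f) of (i', f') \<Rightarrow> (i', glue_vertex f f' v, glue_vertex f f' w, f'))"

fun orient :: "'s \<times> nat \<times> nat \<times> nat \<Rightarrow> int" where
  "orient (i, v, w, f) = eps K i * perm_sign v w (fourth v w f) f"

fun cell_edge :: "'s \<times> nat \<times> nat \<times> nat \<Rightarrow> 's \<times> nat \<times> nat" where
  "cell_edge (i, v, w, f) = (i, min v w, max v w)"

fun ascending :: "'s \<times> nat \<times> nat \<times> nat \<Rightarrow> bool" where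
  "ascending (i, v, w, f) \<longleftrightarrow> v < w"

lemma pivot_eq: "pivot K s = turn (transport s)"
  by (cases s) (auto simp: Let_def split: prod.split)

lemma corners_tetrad: "(i, v, w, f) \<in> corners \<Longrightarrow> tetrad v w f (fourth v w f)"
  by (auto simp: corners_def intro!: tetrad_fourth)

lemma finite_corners: "finite corners"
proof (rule finite_subset)
  show "corners \<subseteq> simplices K \<times> {..<4} \<times> {..<4} \<times> {..<4}" by (auto simp: corners_def)
qed (simp add: finite_simplices)

lemma turn_props:
  assumes "s \<in> corners"
  shows "turn s \<in> corners" "turn (turn s) = s" "orient (turn s) = - orient s"
    "cell_edge (turn s) = cell_edge s" "ascending (turn s) = ascending s"
proof -
  obtain i v w f where s: "s = (i, v, w, f)" by (cases s)
  have t: "tetrad v w f (fourth v w f)" using corners_tetrad assms s by simp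
  show "turn s \<in> corners" using assms t unfolding s by (auto simp: corners_def tetrad_def)
  show "turn (turn s) = s" "orient (turn s) = - orient s"
    unfolding s using fourth_tetrad[OF t] perm_sign_swap(1)[OF t] by simp_all
  show "cell_edge (turn s) = cell_edge s" "ascending (turn s) = ascending s"
    by (simp_all add: s)
qed

lemma transport_props:
  assumes "s \<in> corners"
  shows "transport s \<in> corners" "transport (transport s) = s" "orient (transport s) = - orient s"
    "(cell_edge s, cell_edge (transport s)) \<in> edge_glue K" "ascending (transport s) = ascending s"
proof -
  obtain i v w f where s: "s = (i, v, w, f)" by (cases s)
  let ?b = "fourth v w f"
  have t: "tetrad v w f ?b" using corners_tetrad assms s by simp
  have d: "i \<in> simplices K" "f < 4" "v < 4" "w < 4" "v \<noteq> w" "v \<noteq> f" "w \<noteq> f" "?b \<noteq> f"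
    using t assms by (auto simp: s corners_def tetrad_def)
  obtain i' f' where g: "glue K (i, f) = (i', f')" "i' \<in> simplices K" "f' < 4"
    "glue K (i', f') = (i, f)" "eps K i * (-1) ^ f = - (eps K i' * (-1) ^ f')"
    by (rule glue_faces[OF d(1,2)])
  let ?g = "glue_vertex f f'"
  have tr: "transport s = (i', ?g v, ?g w, f')" by (simp add: s g)
  show "transport s \<in> corners"
    using d g by (auto simp: tr corners_def glue_vertex_less glue_vertex_neq glue_vertex_eq_iff)
  show "transport (transport s) = s" using d g by (simp add: s glue_vertex_inverse)
  show "ascending (transport s) = ascending s"
    unfolding tr using d by (simp add: s glue_vertex_less_iff)
  have e: "(i, min v w, max v w) \<in> edges K" using d by (auto simp: edges_def min_def max_def)
  have "((i, min v w, max v w), (i', ?g (min v w), ?g (max v w))) \<in> edge_glue K"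
    using e d g(1) unfolding edge_glue_def faces_def
    by (intro CollectI exI[of _ i] exI[of _ "min v w"] exI[of _ "max v w"] exI[of _ i'] exI[of _ f] exI[of _ f'])
      (auto simp: min_def max_def)
  then show "(cell_edge s, cell_edge (transport s)) \<in> edge_glue K"
    unfolding tr using d by (simp add: s glue_vertex_min_max)
  have t1: "tetrad v w ?b f" using t by (rule tetrad_swap)
  have t2: "tetrad (?g v) (?g w) (?g ?b) f'" using t1 g(3) by (rule tetrad_glue)
  have "fourth (?g v) (?g w) f' = ?g ?b" using fourth_tetrad[OF t2] by simp
  then have "orient (transport s) = - (eps K i' * (-1) ^ f') * order_sign v w ?b"
    unfolding tr using perm_sign_face[OF t2] order_sign_glue[of v f w ?b f'] d by simp
  also have "\<dots> = eps K i * (-1) ^ f * order_sign v w ?b" using g(5) by simp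
  also have "\<dots> = - orient s"
    using perm_sign_face[OF t1] by (simp add: s)
  finally show "orient (transport s) = - orient s" .
qed

lemma pivot_props:
  assumes "s \<in> corners"
  shows "pivot K s \<in> corners" "orient (pivot K s) = orient s"
    "(cell_edge s, cell_edge (pivot K s)) \<in> edge_glue K" "ascending (pivot K s) = ascending s"
    "transport (turn (pivot K s)) = s"
  using transport_props[OF assms] turn_props[OF transport_props(1)[OF assms]]
  by (simp_all add: pivot_eq)

lemma pivot_iterate:
  assumes "s \<in> corners"
  shows "(pivot K ^^ n) s \<in> corners" "orient ((pivot K ^^ n) s) = orient s"
    "(cell_edge s, cell_edge ((pivot K ^^ n) s)) \<in> (edge_glue K)\<^sup>*"
    "ascending ((pivot K ^^ n) s) = ascending s"
proof (induction n)
  case (Suc n)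
  { case 1 show ?case using pivot_props[OF Suc(1)] by simp }
  { case 2 show ?case using pivot_props[OF Suc(1)] Suc(2) by simp }
  { case 3 show ?case using pivot_props[OF Suc(1)] Suc(3) by (simp add: rtrancl_into_rtrancl) }
  { case 4 show ?case using pivot_props[OF Suc(1)] Suc(4) by simp }
qed (use assms in auto)

lemma inj_on_pivot: "inj_on (pivot K) corners"
  by (rule inj_on_inverseI[of _ "transport \<circ> turn"]) (simp add: pivot_props)

text \<open>
  Of the two faces that contain the edge, \<open>orient\<close> singles out one.
\<close>

lemma corner_determined:
  assumes "s \<in> corners" "s' \<in> corners" "cell_edge s = cell_edge s'" "ascending s = ascending s'"
    "orient s = orient s'"
  shows "s = s'"
proof -
  obtain i v w f where s: "s = (i, v, w, f)" by (cases s)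
  obtain i' v' w' f' where s': "s' = (i', v', w', f')" by (cases s')
  have eq: "i' = i" "v' = v" "w' = w"
    using assms(1-4) by (auto simp: s s' corners_def min_def max_def split: if_splits)
  have t: "tetrad v w f (fourth v w f)" using corners_tetrad assms s by simp
  have "f' = f \<or> f' = fourth v w f"
    using t assms(2) less_4_cases[of f'] tetrad_cases[OF t]
    by (auto simp: s' eq corners_def fourth_def)
  moreover have "f' \<noteq> fourth v w f"
  proof
    assume "f' = fourth v w f"
    then have "s' = turn s" by (simp add: s s' eq)
    then have "orient s = 0" using turn_props(3)[OF assms(1)] assms(5) by simp
    moreover have "orient s = eps K i * perm_sign v w (fourth v w f) f" by (simp add: s)
    moreover have "eps K i \<noteq> 0" using eps_cases[of i] assms(1) by (auto simp: s corners_def)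
    ultimately show False using perm_sign_swap(3)[OF tetrad_swap(2)[OF t]] by auto
  qed
  ultimately show ?thesis by (simp add: s s' eq)
qed

text \<open>
  An edge is glued to other edges through exactly two faces, and these are the faces of the two
  corners \<open>s\<close> and \<open>turn s\<close> on it.
\<close>

lemma edge_glue_neighbours:
  assumes "s \<in> corners" "(cell_edge s, e) \<in> edge_glue K"
  shows "e = cell_edge (transport s) \<or> e = cell_edge (transport (turn s))"
proof -
  obtain i v w f where s: "s = (i, v, w, f)" by (cases s)
  have t: "tetrad v w f (fourth v w f)" using corners_tetrad assms s by simp
  obtain i' g g' where e: "e = (i', glue_vertex g g' (min v w), glue_vertex g g' (max v w))"
    "g < 4" "g \<noteq> min v w" "g \<noteq> max v w" "glue K (i, g) = (i', g')"
    using assms(2) unfolding s cell_edge.simps edge_glue_def faces_def by auto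
  then have g: "g \<noteq> v" "g \<noteq> w" by (auto simp: min_def max_def split: if_splits)
  have "g = f \<or> g = fourth v w f"
    using g e(2) less_4_cases[OF e(2)] tetrad_cases[OF t] by (auto simp: fourth_def)
  then show ?thesis
    using e g by (auto simp: s glue_vertex_min_max)
qed

text \<open>
  One full rotation around an edge meets every edge of its 1-cell exactly once.  It meets all of them
  because the orbit is closed under both gluings of each edge, one being the next pivot step
  and the other the preceding one; it meets none twice because \<open>orient\<close> and the order of the two
  vertices are constant on the orbit and determine the corner on a given edge.
\<close>

lemma pivot_orbit:
  assumes s: "s \<in> corners"
  obtains N where "N > 0" "(pivot K ^^ N) s = s"
    "\<And>n. (pivot K ^^ n) s = s \<Longrightarrow> N dvd n"
    "bij_betw (\<lambda>k. cell_edge ((pivot K ^^ k) s)) {..<N} ((edge_glue K)\<^sup>* `` {cell_edge s})"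
proof -
  let ?P = "\<lambda>k. (pivot K ^^ k) s"
  have cancel: "?P (n - m) = s" if "?P m = ?P n" "m \<le> n" for m n
    using that
  proof (induction m arbitrary: n)
    case (Suc m)
    then obtain n' where n: "n = Suc n'" by (cases n) auto
    have "?P m = ?P n'"
      using inj_onD[OF inj_on_pivot, of "?P m" "?P n'"] Suc.prems(1) pivot_iterate(1)[OF s]
      by (simp add: n)
    then show ?case using Suc.IH[of n'] Suc.prems by (simp add: n)
  qed auto
  have "\<not> inj ?P"
    using finite_subset[OF _ finite_corners, of "range ?P"] pivot_iterate(1)[OF s] finite_imageD
    by blast
  then obtain m n where "m < n" "?P m = ?P n"
    unfolding inj_def by (metis nat_neq_iff)
  then have ex: "\<exists>n>0. ?P n = s" using cancel[of m n] by (intro exI[of _ "n - m"]) auto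
  define N where "N = (LEAST n. n > 0 \<and> ?P n = s)"
  have N: "N > 0" "?P N = s" using LeastI_ex[OF ex] by (auto simp: N_def)
  have min: "N \<le> n" if "n > 0" "?P n = s" for n using that by (auto simp: N_def intro: Least_le)
  have mod: "?P n = ?P (n mod N)" for n
  proof -
    have "?P (q * N + r) = ?P r" for q r
    proof (induction q)
      case (Suc q)
      have "?P (Suc q * N + r) = (pivot K ^^ (q * N + r)) (?P N)"
        by (metis (no_types, lifting) add.assoc add.commute comp_apply funpow_add mult_Suc)
      then show ?case using Suc N by simp
    qed simp
    from this[of "n div N" "n mod N"] show ?thesis by simp
  qed
  have dvd: "N dvd n" if "?P n = s" for n
    using min[of "n mod N"] that mod[of n] N(1) mod_less_divisor[OF N(1), of n]
    by (metis dvd_eq_mod_eq_0 leD neq0_conv)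
  have inj: "inj_on (\<lambda>k. cell_edge (?P k)) {..<N}"
  proof (rule inj_onI)
    have *: "False" if "m < n" "n < N" "cell_edge (?P m) = cell_edge (?P n)" for m n
    proof -
      have "?P m = ?P n"
        using corner_determined pivot_iterate[OF s] that(3) by metis
      then show False using cancel[of m n] min[of "n - m"] that by auto
    qed
    fix m n assume "m \<in> {..<N}" "n \<in> {..<N}" "cell_edge (?P m) = cell_edge (?P n)"
    then show "m = n" using *[of m n] *[of n m] by (metis lessThan_iff linorder_neqE_nat)
  qed
  have "\<exists>k. e = cell_edge (?P k)" if "(cell_edge s, e) \<in> (edge_glue K)\<^sup>*" for e
    using that
  proof (induction rule: rtrancl_induct)
    case base
    show ?case by (rule exI[of _ 0]) simp
  next
    case (step e e')
    then obtain k where k: "e = cell_edge (?P k)" by blast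
    have c: "?P n \<in> corners" for n by (rule pivot_iterate(1)[OF s])
    \<comment> \<open>Shifting by the period gives every state of the orbit a predecessor in the orbit.\<close>
    have "?P k = pivot K (?P (k + N - 1))"
      using mod[of k] mod[of "k + N"] N(1) by (metis Suc_diff_1 add_gr_0 comp_apply funpow.simps(2) mod_add_self2)
    then have "transport (turn (?P k)) = ?P (k + N - 1)" using pivot_props(5)[OF c] by metis
    moreover have "cell_edge (transport (?P k)) = cell_edge (?P (Suc k))"
      using turn_props(4)[OF transport_props(1)[OF c]] by (simp add: pivot_eq)
    ultimately show ?case
      using edge_glue_neighbours[OF c, of k e'] step.hyps(2) k by metis
  qed
  then have "(edge_glue K)\<^sup>* `` {cell_edge s} \<subseteq> (\<lambda>k. cell_edge (?P k)) ` {..<N}"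
    using mod N(1) by (metis (no_types, lifting) Image_singleton_iff image_eqI lessThan_iff mod_less_divisor subsetI)
  then have "bij_betw (\<lambda>k. cell_edge (?P k)) {..<N} ((edge_glue K)\<^sup>* `` {cell_edge s})"
    unfolding bij_betw_def using inj pivot_iterate(3)[OF s] by auto
  then show thesis using that N dvd by blast
qed

end

section \<open>Side lengths of the truncation triangles and the gluing equations\<close>

lemma prod_cyclic_shift:
  assumes "n > 0"
  shows "(\<Prod>k<n. g (Suc k mod n)) = (\<Prod>k<n. g k :: 'a :: comm_monoid_mult)"
proof -
  obtain m where n: "n = Suc m" using assms by (cases n) auto
  have "(\<Prod>k<m. g (Suc k mod n)) = (\<Prod>k<m. g (Suc k))" by (rule prod.cong) (auto simp: n)
  then show ?thesis unfolding n prod.lessThan_Suc[of _ m] 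
    by (subst prod.lessThan_Suc[symmetric], subst prod.lessThan_Suc_shift) (simp add: n mult.commute)
qed

lemma prod_periodic:
  assumes "\<And>k. g (k + N) = g k"
  shows "(\<Prod>k<q * N. g k) = (\<Prod>k<N. g k :: 'a :: comm_monoid_mult) ^ q"
proof -
  have per: "g (k + m * N) = g k" for k m
  proof (induction m)
    case (Suc m)
    show ?case using assms[of "k + m * N"] Suc by (simp add: algebra_simps)
  qed simp
  have "prod g {m * N..<m * N + N} = (\<Prod>k<N. g k)" for m
    using prod.shift_bounds_nat_ivl[of g 0 "m * N" N] per
    by (simp add: lessThan_atLeast0 add.commute)
  then show ?thesis by (simp flip: prod.nat_group)
qed

lemma shape_commute: "shape z i v w = shape z i w v"
  by (simp add: shape_def insert_commute)

lemma shape_nonzero: "z i \<noteq> 0 \<Longrightarrow> z i \<noteq> 1 \<Longrightarrow> shape z i v w \<noteq> 0"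
  by (auto simp: shape_def)

context three_cycle
begin

text \<open>
  The shape parameter at a corner of a triangle is the ratio of the two sides meeting there.  The
  minus sign is due to the convention that the value at \<open>(i, v, f)\<close> belongs to the side as it is
  passed when leaving the triangle.
\<close>

definition triangle_rule :: "('s \<Rightarrow> complex) \<Rightarrow> ('s \<times> nat \<times> nat \<Rightarrow> complex) \<Rightarrow> bool" where
  "triangle_rule z m \<longleftrightarrow> (\<forall>x\<in>flags K. m x \<noteq> 0) \<and>
     (\<forall>i\<in>simplices K. \<forall>v w a b. tetrad v w a b \<longrightarrow>
        m (i, v, b) = - (shape z i v w powi perm_sign v w a b) * m (i, v, a))"

lemma triangle_ruleD:
  assumes "triangle_rule z m"
  shows "x \<in> flags K \<Longrightarrow> m x \<noteq> 0"
    and "i \<in> simplices K \<Longrightarrow> tetrad v w a b \<Longrightarrow>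
      m (i, v, b) = - (shape z i v w powi perm_sign v w a b) * m (i, v, a)"
  using assms by (auto simp: triangle_rule_def)

lemma tetrad_flag: "i \<in> simplices K \<Longrightarrow> tetrad v w a b \<Longrightarrow> (i, v, b) \<in> flags K"
  by (auto simp: tetrad_def flags_def)

text \<open>
  Normalize one side of every triangle to \<open>1\<close>.  The three corners impose compatible conditions on the
  other two sides because the product of the three shape parameters is \<open>-1\<close>.
\<close>

lemma triangle_rule_exists:
  assumes z: "\<And>i. i \<in> simplices K \<Longrightarrow> z i \<noteq> 0 \<and> z i \<noteq> 1"
  shows "\<exists>m. triangle_rule z m"
proof -
  define base :: "nat \<Rightarrow> nat" where "base v = (if v = 0 then 1 else 0)" for v
  define m where "m = (\<lambda>(i, v, f). if f = base v then 1 else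
    - (shape z i v (fourth v (base v) f) powi perm_sign v (fourth v (base v) f) (base v) f))"
  have "triangle_rule z m"
    unfolding triangle_rule_def
  proof (intro conjI ballI allI impI)
    fix x assume "x \<in> flags K"
    then show "m x \<noteq> 0"
      using z shape_nonzero[of z] by (auto simp: m_def flags_def power_int_eq_0_iff split: if_splits)
  next
    fix i v w a b assume i: "i \<in> simplices K" and t: "tetrad v w a b"
    show "m (i, v, b) = - (shape z i v w powi perm_sign v w a b) * m (i, v, a)"
      using tetrad_cases[OF t] z[OF i]
      apply (elim insertE)
      apply (simp_all add: m_def base_def fourth_def perm_sign_def shape_def Let_def doubleton_eq_iff power_int_minus)
      apply (auto simp add: field_simps)
      done
  qed
  then show ?thesis by blast
qed

text \<open>
  The factor by which the triangle entered through \<open>x\<close> has to be rescaled, relative to the one that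
  is left, so that the two copies of the side become opposite.
\<close>

definition step_ratio :: "('s \<times> nat \<times> nat \<Rightarrow> complex) \<Rightarrow> 's \<times> nat \<times> nat \<Rightarrow> complex" where
  "step_ratio m x = - m x / m (cross K x)"

definition path_ratio :: "('s \<times> nat \<times> nat \<Rightarrow> complex) \<Rightarrow> ('s \<times> nat \<times> nat) list \<Rightarrow> complex" where
  "path_ratio m xs = (\<Prod>x\<leftarrow>xs. step_ratio m x)"

lemma path_ratio_simps [simp]:
  "path_ratio m [] = 1" "path_ratio m (x # xs) = step_ratio m x * path_ratio m xs"
  "path_ratio m (xs @ ys) = path_ratio m xs * path_ratio m ys"
  by (simp_all add: path_ratio_def)

lemma path_ratio_nth: "path_ratio m xs = (\<Prod>k<length xs. step_ratio m (xs ! k))"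
  by (simp add: path_ratio_def prod.list_conv_set_nth lessThan_atLeast0)

lemma step_ratio_cross:
  assumes "triangle_rule z m" "x \<in> flags K"
  shows "step_ratio m x * step_ratio m (cross K x) = 1"
  using triangle_ruleD(1)[OF assms(1)] assms(2) cross_flags[OF assms(2)]
  by (simp_all add: step_ratio_def)

lemma path_append: "path K s (xs @ ys) t \<longleftrightarrow> (\<exists>u. path K s xs u \<and> path K u ys t)"
  by (induction xs arbitrary: s) auto

lemma path_flags: "path K s xs t \<Longrightarrow> set xs \<subseteq> flags K"
proof (induction xs arbitrary: s)
  case (Cons x xs)
  then show ?case by (metis insert_subset list.simps(15) path.simps(2))
qed simp

lemma path_consecutive:
  "path K s xs t \<Longrightarrow> Suc k < length xs \<Longrightarrow> triangle (cross K (xs ! k)) = triangle (xs ! Suc k)"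
proof (induction xs arbitrary: s k)
  case (Cons x xs)
  then show ?case by (cases k; cases xs) auto
qed simp

lemma path_last: "path K s xs t \<Longrightarrow> xs \<noteq> [] \<Longrightarrow> triangle (cross K (xs ! (length xs - 1))) = t"
proof (induction xs arbitrary: s)
  case (Cons x xs)
  then show ?case by (cases xs) auto
qed simp

lemma path_reverse: "path K s xs t \<Longrightarrow> path K t (reverse_path K xs) s"
proof (induction xs arbitrary: s)
  case (Cons x xs)
  then have "path K t (reverse_path K xs) (triangle (cross K x))" by simp
  moreover have "path K (triangle (cross K x)) [cross K x] s"
    using Cons.prems cross_flags[of x] by simp
  ultimately show ?case
    unfolding reverse_path_def list.map rev.simps path_append by blast
qed (simp add: reverse_path_def)

lemma path_ratio_reverse:
  assumes "triangle_rule z m" "set xs \<subseteq> flags K"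
  shows "path_ratio m xs * path_ratio m (reverse_path K xs) = 1"
  using assms(2)
proof (induction xs)
  case (Cons x xs)
  have "path_ratio m (x # xs) * path_ratio m (reverse_path K (x # xs)) =
    (step_ratio m x * step_ratio m (cross K x)) * (path_ratio m xs * path_ratio m (reverse_path K xs))"
    by (simp add: reverse_path_def)
  also have "\<dots> = 1" using Cons step_ratio_cross[OF assms(1)] by simp
  finally show ?case .
qed (simp add: reverse_path_def)

text \<open>
  The factor \<open>eps\<close> in \<open>turn_sign\<close> cancels the one in the exponent, which leaves the sign of the permutation
  that occurs in \<open>triangle_rule\<close>.
\<close>

lemma corner_factor_ratio:
  assumes m: "triangle_rule z m" and "x \<in> flags K" "y \<in> flags K"
    and "triangle (cross K x) = triangle y" "cross K x \<noteq> y"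
  shows "corner_factor K z x y = - m y / m (cross K x)"
proof -
  obtain i v b where y: "y = (i, v, b)" by (cases y)
  obtain a where x: "cross K x = (i, v, a)" using assms(4) y by (cases "cross K x") auto
  have fl: "(i, v, a) \<in> flags K" "(i, v, b) \<in> flags K" "a \<noteq> b"
    using cross_flags(1)[OF assms(2)] assms x y by auto
  have i: "i \<in> simplices K" using fl by (auto simp: flags_def)
  have t: "tetrad v (fourth v a b) a b"
    using tetrad_fourth[of v a b] fl by (auto simp: flags_def tetrad_def)
  have "turn_sign K i v a b * eps K i = perm_sign v (fourth v a b) a b"
    using eps_cases[OF i] by (auto simp: turn_sign_def)
  then show ?thesis
    using triangle_ruleD(2)[OF m i t] triangle_ruleD(1)[OF m fl(1)]
    unfolding corner_factor_def x y by simp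
qed

text \<open>
  A corner factor compares the side left next with the side just entered, a step ratio compares the
  two copies of a single side.  Around a closed curve both products contain the same factors.
\<close>

lemma curve_holonomy_ratio:
  assumes m: "triangle_rule z m" and c: "closed_normal_curve K \<gamma>"
  shows "curve_holonomy K z \<gamma> = path_ratio m \<gamma>"
proof -
  let ?n = "length \<gamma>"
  have n: "?n > 0" and p: "path K (triangle (hd \<gamma>)) \<gamma> (triangle (hd \<gamma>))"
    and normal: "\<And>k. k < ?n \<Longrightarrow> cross K (\<gamma> ! k) \<noteq> \<gamma> ! (Suc k mod ?n)"
    using c by (auto simp: closed_normal_curve_def)
  have fl: "\<gamma> ! k \<in> flags K" if "k < ?n" for k using path_flags[OF p] that by auto
  have adj: "triangle (cross K (\<gamma> ! k)) = triangle (\<gamma> ! (Suc k mod ?n))" if "k < ?n" for k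
  proof (cases "Suc k < ?n")
    case True
    then show ?thesis using path_consecutive[OF p] by simp
  next
    case False
    then have "Suc k = ?n" using that by simp
    then show ?thesis using path_last[OF p] n by (metis One_nat_def diff_Suc_1 hd_conv_nth length_greater_0_conv mod_self)
  qed
  have "curve_holonomy K z \<gamma> = (\<Prod>k<?n. - m (\<gamma> ! (Suc k mod ?n)) / m (cross K (\<gamma> ! k)))"
    unfolding curve_holonomy_def
    using n by (intro prod.cong corner_factor_ratio[OF m] fl adj normal HOL.refl) auto
  also have "\<dots> = (\<Prod>k<?n. - m (\<gamma> ! k)) / (\<Prod>k<?n. m (cross K (\<gamma> ! k)))"
    unfolding prod_dividef using prod_cyclic_shift[OF n, of "\<lambda>k. - m (\<gamma> ! k)"] by simp
  also have "\<dots> = path_ratio m \<gamma>"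
    by (simp only: path_ratio_nth step_ratio_def prod_dividef)
  finally show ?thesis .
qed

fun corner_flag :: "'s \<times> nat \<times> nat \<times> nat \<Rightarrow> 's \<times> nat \<times> nat" where
  "corner_flag (i, v, w, f) = (i, v, f)"

definition edge_parameter :: "('s \<Rightarrow> complex) \<Rightarrow> 's \<times> nat \<times> nat \<Rightarrow> complex" where
  "edge_parameter z = (\<lambda>(i, j, k). shape z i j k powi eps K i)"

lemma orient_cases: "s \<in> corners \<Longrightarrow> orient s = 1 \<or> orient s = -1"
proof -
  assume s: "s \<in> corners"
  obtain i v w f where eq: "s = (i, v, w, f)" by (cases s)
  then show ?thesis
    using eps_cases[of i] perm_sign_swap(3)[OF tetrad_swap(2)[OF corners_tetrad[OF s[unfolded eq]]]] s
    by (auto simp: corners_def)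
qed

text \<open>
  Since \<open>orient\<close> is \<open>eps\<close> times the sign of the permutation, a ratio of sides is the factor of the
  edge equation or its inverse according to \<open>orient\<close>.
\<close>

lemma corner_step:
  assumes m: "triangle_rule z m" and s: "s \<in> corners"
  shows "- m (corner_flag (pivot K s)) / m (cross K (corner_flag s))
    = edge_parameter z (cell_edge (pivot K s)) powi orient (pivot K s)"
proof -
  obtain i v w f where t: "transport s = (i, v, w, f)" by (cases "transport s")
  let ?b = "fourth v w f"
  have c: "(i, v, w, f) \<in> corners" using transport_props(1)[OF s] t by simp
  then have i: "i \<in> simplices K" by (simp add: corners_def)
  have tt: "tetrad v w f ?b" using corners_tetrad[OF c] .
  have p: "pivot K s = (i, v, w, ?b)" by (simp add: pivot_eq t)
  have x: "cross K (corner_flag s) = (i, v, f)"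
    using t by (cases s) (auto split: prod.splits)
  have nz: "m (i, v, f) \<noteq> 0"
    using triangle_ruleD(1)[OF m tetrad_flag[OF i tetrad_swap(2)[OF tt]]] .
  have ratio: "- m (i, v, ?b) / m (i, v, f) = shape z i v w powi perm_sign v w f ?b"
    using triangle_ruleD(2)[OF m i tt] nz by simp
  have sym: "shape z i (min v w) (max v w) = shape z i v w"
    using shape_commute by (auto simp: min_def max_def)
  have sq: "eps K i * (eps K i * perm_sign v w f ?b) = perm_sign v w f ?b"
    using eps_cases[OF i] by auto
  show ?thesis
    unfolding p x corner_flag.simps cell_edge.simps edge_parameter_def orient.simps
      fourth_tetrad(2)[OF tt] ratio prod.case sym power_int_mult[symmetric] sq ..
qed

text \<open>
  The same regrouping of a cyclic product as for normal curves, now around a vertex of the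
  boundary triangulation.
\<close>

lemma corner_loop_ratio:
  assumes m: "triangle_rule z m" and s: "s \<in> corners" and n: "n > 0" and per: "(pivot K ^^ n) s = s"
  shows "(\<Prod>k<n. step_ratio m (corner_flag ((pivot K ^^ k) s)))
    = (\<Prod>k<n. edge_parameter z (cell_edge ((pivot K ^^ k) s))) powi orient s"
proof -
  let ?s = "\<lambda>k. (pivot K ^^ k) s"
  have shift: "?s (Suc k mod n) = ?s (Suc k)" if "k < n" for k
    using that per by (cases "Suc k = n") auto
  have shift_prod: "(\<Prod>k<n. g (?s (Suc k))) = (\<Prod>k<n. g (?s k))" for g :: "_ \<Rightarrow> complex"
    using prod_cyclic_shift[OF n, of "\<lambda>k. g (?s k)"] shift by simp
  have "(\<Prod>k<n. step_ratio m (corner_flag (?s k)))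
    = (\<Prod>k<n. - m (corner_flag (?s k))) / (\<Prod>k<n. m (cross K (corner_flag (?s k))))"
    by (simp only: step_ratio_def prod_dividef)
  also have "\<dots> = (\<Prod>k<n. - m (corner_flag (?s (Suc k))) / m (cross K (corner_flag (?s k))))"
    by (simp only: prod_dividef shift_prod[of "\<lambda>t. - m (corner_flag t)"])
  also have "\<dots> = (\<Prod>k<n. edge_parameter z (cell_edge (?s (Suc k))) powi orient s)"
  proof (rule prod.cong)
    fix k show "- m (corner_flag (?s (Suc k))) / m (cross K (corner_flag (?s k)))
      = edge_parameter z (cell_edge (?s (Suc k))) powi orient s"
      using corner_step[OF m pivot_iterate(1)[OF s, of k]] pivot_iterate(2)[OF s, of "Suc k"]
      by simp
  qed simp
  also have "\<dots> = (\<Prod>k<n. edge_parameter z (cell_edge (?s k)) powi orient s)"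
    by (rule shift_prod)
  also have "\<dots> = (\<Prod>k<n. edge_parameter z (cell_edge (?s k))) powi orient s"
    by (induction n) (simp_all add: power_int_mult_distrib)
  finally show ?thesis .
qed

definition side_lengths :: "('s \<Rightarrow> complex) \<Rightarrow> ('s \<times> nat \<times> nat \<Rightarrow> complex) \<Rightarrow> bool" where
  "side_lengths z m \<longleftrightarrow> triangle_rule z m \<and> (\<forall>x\<in>flags K. m (cross K x) = - m x)"

lemma side_lengths_step_ratio:
  "side_lengths z m \<Longrightarrow> x \<in> flags K \<Longrightarrow> step_ratio m x = 1"
  by (auto simp: side_lengths_def step_ratio_def triangle_rule_def)

lemma corner_flag_in_flags: "s \<in> corners \<Longrightarrow> corner_flag s \<in> flags K"
  by (auto simp: corners_def flags_def)

lemma one_cell_corner: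
  assumes "E \<in> one_cells K"
  obtains s where "s \<in> corners" "E = (edge_glue K)\<^sup>* `` {cell_edge s}"
proof -
  obtain i j k where e: "(i, j, k) \<in> edges K" "E = (edge_glue K)\<^sup>* `` {(i, j, k)}"
    using assms unfolding one_cells_def by (auto elim!: quotientE)
  have "j < k" "k < 4" using e(1) by (auto simp: edges_def)
  define f :: nat where "f = (if j \<noteq> 0 then 0 else if k \<noteq> 1 then 1 else 2)"
  have "(i, j, k, f) \<in> corners" "cell_edge (i, j, k, f) = (i, j, k)"
    using e(1) by (auto simp: corners_def edges_def f_def)
  then show thesis using that e(2) by metis
qed

text \<open>
  With opposite lengths on both copies of every side all step ratios are \<open>1\<close>.
\<close>

lemma gluing_equations_of_side_lengths:
  assumes m: "side_lengths z m"
    and z: "z \<in> simplices K \<rightarrow>\<^sub>E - {0, 1}"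
    and \<Gamma>: "\<And>\<gamma>. \<gamma> \<in> \<Gamma> \<Longrightarrow> closed_normal_curve K \<gamma>"
  shows "z \<in> gluing_variety K \<Gamma>"
  unfolding gluing_variety_def
proof (intro CollectI conjI ballI z)
  have tr: "triangle_rule z m" using m by (simp add: side_lengths_def)
  fix E assume "E \<in> one_cells K"
  then obtain s where s: "s \<in> corners" and E: "E = (edge_glue K)\<^sup>* `` {cell_edge s}"
    by (rule one_cell_corner)
  obtain N where N: "N > 0" "(pivot K ^^ N) s = s"
    "bij_betw (\<lambda>k. cell_edge ((pivot K ^^ k) s)) {..<N} E"
    using pivot_orbit[OF s] E by metis
  have "(\<Prod>e\<in>E. edge_parameter z e) powi orient s = 1"
    using corner_loop_ratio[OF tr s N(1,2)] prod.reindex_bij_betw[OF N(3), of "edge_parameter z"]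
      side_lengths_step_ratio[OF m corner_flag_in_flags[OF pivot_iterate(1)[OF s]]] by simp
  then show "(\<Prod>(i, j, k)\<in>E. shape z i j k powi eps K i) = 1"
    using orient_cases[OF s] by (auto simp: edge_parameter_def power_int_minus)
next
  have tr: "triangle_rule z m" using m by (simp add: side_lengths_def)
  fix \<gamma> assume "\<gamma> \<in> \<Gamma>"
  then have c: "closed_normal_curve K \<gamma>" by (rule \<Gamma>)
  then have "set \<gamma> \<subseteq> flags K" using path_flags unfolding closed_normal_curve_def by blast
  then have "\<And>k. k < length \<gamma> \<Longrightarrow> step_ratio m (\<gamma> ! k) = 1"
    using side_lengths_step_ratio[OF m] by (meson nth_mem subsetD)
  then show "curve_holonomy K z \<gamma> = 1"
    using curve_holonomy_ratio[OF tr c] by (simp add: path_ratio_nth)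
qed

text \<open>
  A corner loop may run around its vertex several times, so its holonomy is a power of the product in
  the edge equation.
\<close>

lemma corner_loop_trivial:
  assumes m: "triangle_rule z m"
    and edge: "\<And>E. E \<in> one_cells K \<Longrightarrow> (\<Prod>(i, j, k)\<in>E. shape z i j k powi eps K i) = 1"
    and l: "corner_loop K ls"
  shows "path_ratio m ls = 1"
proof -
  obtain i v w f n where s: "(i, v, w, f) \<in> corners" and n: "n > 0" "(pivot K ^^ n) (i, v, w, f) = (i, v, w, f)"
    and ls: "ls = map (\<lambda>k. case (pivot K ^^ k) (i, v, w, f) of (i', v', w', f') \<Rightarrow> (i', v', f')) [0..<n]"
    using l unfolding corner_loop_def corners_def by auto
  let ?s = "(i, v, w, f)"
  let ?E = "(edge_glue K)\<^sup>* `` {cell_edge ?s}"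
  let ?g = "\<lambda>k. edge_parameter z (cell_edge ((pivot K ^^ k) ?s))"
  have "?E \<in> one_cells K"
    using s unfolding one_cells_def
    by (intro quotientI) (auto simp: corners_def edges_def min_def max_def)
  then have E: "(\<Prod>e\<in>?E. edge_parameter z e) = 1"
    using edge unfolding edge_parameter_def by blast
  obtain N where N: "(pivot K ^^ N) ?s = ?s" "N dvd n"
    "bij_betw (\<lambda>k. cell_edge ((pivot K ^^ k) ?s)) {..<N} ?E"
    using pivot_orbit[OF s] n(2) by metis
  obtain q where q: "n = q * N" using N(2) by (metis dvd_def mult.commute)
  have per: "?g (k + N) = ?g k" for k by (simp add: funpow_add N(1))
  have "path_ratio m ls = (\<Prod>k<n. step_ratio m (corner_flag ((pivot K ^^ k) ?s)))"
    unfolding path_ratio_nth ls by (rule prod.cong) (auto split: prod.splits)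
  also have "\<dots> = (\<Prod>k<n. ?g k) powi orient ?s" by (rule corner_loop_ratio[OF m s n])
  also have "(\<Prod>k<n. ?g k) = 1"
    unfolding q prod_periodic[of ?g, OF per] using prod.reindex_bij_betw[OF N(3), of "edge_parameter z"] E
    by simp
  finally show ?thesis by simp
qed

lemma homotopic_paths_ratio:
  assumes m: "triangle_rule z m"
    and edge: "\<And>E. E \<in> one_cells K \<Longrightarrow> (\<Prod>(i, j, k)\<in>E. shape z i j k powi eps K i) = 1"
    and h: "homotopic_paths K s t xs ys"
  shows "path_ratio m xs = path_ratio m ys"
  using h
proof induction
  case (backtrack xs x ys)
  then have "x \<in> flags K" using path_flags[OF backtrack(1)] by simp
  then show ?case using step_ratio_cross[OF m] by simp
next
  case (corner xs ls ys)
  then show ?case using corner_loop_trivial[OF m edge] by simp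
qed auto

lemma generated_loops_ratio:
  assumes m: "triangle_rule z m"
    and edge: "\<And>E. E \<in> one_cells K \<Longrightarrow> (\<Prod>(i, j, k)\<in>E. shape z i j k powi eps K i) = 1"
    and L: "\<And>l. l \<in> L \<Longrightarrow> set l \<subseteq> flags K \<and> path_ratio m l = 1"
    and p: "p \<in> generated_loops K b L"
  shows "path_ratio m p = 1"
  using p
proof induction
  case (backward p l)
  then show ?case using path_ratio_reverse[OF m, of l] L[of l] by simp
next
  case (homotopic p q)
  then show ?case using homotopic_paths_ratio[OF m edge] by simp
qed (use L in auto)

lemma vertex_glue_eq: "vertex_glue K = {(triangle x, triangle (cross K x)) | x. x \<in> flags K}"
proof (intro equalityI subsetI)
  fix p assume "p \<in> vertex_glue K"
  then obtain i v i' f f' where *: "i \<in> simplices K" "v < 4" "f < 4" "f \<noteq> v"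
    "glue K (i, f) = (i', f')" "p = ((i, v), (i', glue_vertex f f' v))"
    unfolding vertex_glue_def faces_def by auto
  then have "(i, v, f) \<in> flags K" "p = (triangle (i, v, f), triangle (cross K (i, v, f)))"
    by (auto simp: flags_def)
  then show "p \<in> {(triangle x, triangle (cross K x)) | x. x \<in> flags K}" by blast
next
  fix p assume "p \<in> {(triangle x, triangle (cross K x)) | x. x \<in> flags K}"
  then obtain i v f where *: "(i, v, f) \<in> flags K"
    "p = (triangle (i, v, f), triangle (cross K (i, v, f)))" by auto
  obtain i' f' where "glue K (i, f) = (i', f')" by fastforce
  with * show "p \<in> vertex_glue K"
    unfolding vertex_glue_def flags_def faces_def by fastforce
qed

lemma cross_vertex_glue: "x \<in> flags K \<Longrightarrow> (triangle x, triangle (cross K x)) \<in> vertex_glue K"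
  unfolding vertex_glue_eq by blast

lemma vertex_glue_path:
  "(s, t) \<in> (vertex_glue K)\<^sup>* \<longleftrightarrow> (\<exists>xs. path K s xs t)"
proof
  show "\<exists>xs. path K s xs t" if "(s, t) \<in> (vertex_glue K)\<^sup>*"
    using that
  proof (induction rule: converse_rtrancl_induct)
    case base
    show ?case by (rule exI[of _ "[]"]) simp
  next
    case (step s u)
    then obtain x xs where "x \<in> flags K" "s = triangle x" "path K (triangle (cross K x)) xs t"
      by (auto simp: vertex_glue_eq)
    then have "path K s (x # xs) t" by simp
    then show ?case by blast
  qed
  show "(s, t) \<in> (vertex_glue K)\<^sup>*" if ex: "\<exists>xs. path K s xs t"
  proof -
    obtain xs where "path K s xs t" using ex by blast
    then show ?thesis
    proof (induction xs arbitrary: s)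
      case (Cons x xs)
      then have "(s, triangle (cross K x)) \<in> vertex_glue K" by (metis cross_vertex_glue path.simps(2))
      moreover have "(triangle (cross K x), t) \<in> (vertex_glue K)\<^sup>*" using Cons by simp
      ultimately show ?case by (rule converse_rtrancl_into_rtrancl)
    qed simp
  qed
qed

lemma equiv_vertex_glue: "equiv UNIV ((vertex_glue K)\<^sup>*)"
proof (rule equivI)
  show "sym ((vertex_glue K)\<^sup>*)"
    unfolding sym_def vertex_glue_path using path_reverse by blast
qed (auto simp: refl_rtrancl trans_rtrancl)

text \<open>
  Start from arbitrary solutions in the single triangles and rescale each triangle by the holonomy
  of a path from a base triangle of its boundary component.  The path does not matter, since every
  loop at the base is homotopic to a product of the generating curves and their inverses.
\<close>

lemma side_lengths_exist:
  assumes \<Gamma>: "pi1_generating_curves K \<Gamma>" and zV: "z \<in> gluing_variety K \<Gamma>"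
  shows "\<exists>l. side_lengths z l"
proof -
  have z: "\<And>i. i \<in> simplices K \<Longrightarrow> z i \<noteq> 0 \<and> z i \<noteq> 1"
    and edge: "\<And>E. E \<in> one_cells K \<Longrightarrow> (\<Prod>(i, j, k)\<in>E. shape z i j k powi eps K i) = 1"
    and cusp: "\<And>\<gamma>. \<gamma> \<in> \<Gamma> \<Longrightarrow> curve_holonomy K z \<gamma> = 1"
    using zV by (auto simp: gluing_variety_def)
  obtain m where m: "triangle_rule z m" using triangle_rule_exists[of z] z by blast
  let ?R = "(vertex_glue K)\<^sup>*"
  \<comment> \<open>On each boundary component pick a base triangle from which all loops have trivial holonomy.\<close>
  have "\<exists>b\<in>B. \<forall>p. path K b p b \<longrightarrow> path_ratio m p = 1" if B: "B \<in> boundary_components K" for B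
  proof -
    obtain b \<alpha> where b: "b \<in> B" "\<And>\<gamma>. \<gamma> \<in> \<Gamma> \<Longrightarrow> triangle (hd \<gamma>) \<in> B \<Longrightarrow> path K b (\<alpha> \<gamma>) (triangle (hd \<gamma>))"
      "{p. path K b p b} \<subseteq> generated_loops K b
         {\<alpha> \<gamma> @ \<gamma> @ reverse_path K (\<alpha> \<gamma>) | \<gamma>. \<gamma> \<in> \<Gamma> \<and> triangle (hd \<gamma>) \<in> B}"
      using \<Gamma> B unfolding pi1_generating_curves_def by meson
    have L: "set l \<subseteq> flags K \<and> path_ratio m l = 1"
      if "l \<in> {\<alpha> \<gamma> @ \<gamma> @ reverse_path K (\<alpha> \<gamma>) | \<gamma>. \<gamma> \<in> \<Gamma> \<and> triangle (hd \<gamma>) \<in> B}" for l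
    proof -
      obtain \<gamma> where l: "l = \<alpha> \<gamma> @ \<gamma> @ reverse_path K (\<alpha> \<gamma>)" and g: "\<gamma> \<in> \<Gamma>" "triangle (hd \<gamma>) \<in> B"
        using \<open>l \<in> _\<close> by blast
      have c: "closed_normal_curve K \<gamma>" using \<Gamma> g(1) by (auto simp: pi1_generating_curves_def)
      have p: "path K b (\<alpha> \<gamma>) (triangle (hd \<gamma>))" using b(2) g by blast
      have "path_ratio m \<gamma> = 1" using curve_holonomy_ratio[OF m c] cusp[OF g(1)] by simp
      moreover have "set \<gamma> \<subseteq> flags K" using c path_flags unfolding closed_normal_curve_def by blast
      ultimately show ?thesis
        using path_ratio_reverse[OF m path_flags[OF p]] path_flags[OF p] path_flags[OF path_reverse[OF p]]
        by (simp add: l)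
    qed
    show ?thesis
      using b(1,3) generated_loops_ratio[OF m edge L] by blast
  qed
  then obtain base where base: "\<And>B. B \<in> boundary_components K \<Longrightarrow> base B \<in> B"
    "\<And>B p. B \<in> boundary_components K \<Longrightarrow> path K (base B) p (base B) \<Longrightarrow> path_ratio m p = 1"
    by metis
  define org where "org t = base (?R `` {t})" for t
  define \<kappa> where "\<kappa> t = path_ratio m (SOME p. path K (org t) p t)" for t
  have org: "\<exists>p. path K (org t) p t" "\<And>p. path K (org t) p (org t) \<Longrightarrow> path_ratio m p = 1"
    if "t \<in> simplices K \<times> {..<4}" for t
  proof -
    have B: "?R `` {t} \<in> boundary_components K"
      using that unfolding boundary_components_eq_zero_cells zero_cells_def by (rule quotientI)
    have "(t, org t) \<in> ?R" using base(1)[OF B] by (simp add: org_def)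
    then show "\<exists>p. path K (org t) p t" by (meson vertex_glue_path path_reverse)
    show "path_ratio m p = 1" if "path K (org t) p (org t)" for p
      using base(2)[OF B] that by (simp add: org_def)
  qed
  have \<kappa>: "path_ratio m p = \<kappa> t" "\<kappa> t \<noteq> 0" if t: "t \<in> simplices K \<times> {..<4}" and p: "path K (org t) p t" for t p
  proof -
    let ?q = "SOME p. path K (org t) p t"
    have q: "path K (org t) ?q t" using org(1)[OF t] by (rule someI_ex)
    have "path K (org t) (p @ reverse_path K ?q) (org t)"
      using p path_reverse[OF q] unfolding path_append by blast
    then have "path_ratio m (p @ reverse_path K ?q) = 1" by (rule org(2)[OF t])
    then have "path_ratio m p * path_ratio m (reverse_path K ?q) = 1" by simp
    moreover have "path_ratio m ?q * path_ratio m (reverse_path K ?q) = 1"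
      by (rule path_ratio_reverse[OF m path_flags[OF q]])
    ultimately show "path_ratio m p = \<kappa> t" "\<kappa> t \<noteq> 0"
      unfolding \<kappa>_def by (metis mult_cancel_right mult_zero_right zero_neq_one, auto)
  qed
  define l where "l x = \<kappa> (triangle x) * m x" for x
  have tri: "triangle x \<in> simplices K \<times> {..<4}" if "x \<in> flags K" for x
    using that by (auto simp: flags_def)
  have \<kappa>0: "\<kappa> t \<noteq> 0" if "t \<in> simplices K \<times> {..<4}" for t
    using org(1)[OF that] \<kappa>(2)[OF that] by blast
  have "side_lengths z l"
    unfolding side_lengths_def triangle_rule_def
  proof (intro conjI ballI allI impI)
    fix x assume x: "x \<in> flags K"
    then show "l x \<noteq> 0" using \<kappa>0[OF tri] triangle_ruleD(1)[OF m] by (simp add: l_def)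
    let ?y = "cross K x"
    have y: "?y \<in> flags K" using x by (rule cross_flags)
    have "(triangle x, triangle ?y) \<in> ?R" using cross_vertex_glue[OF x] by blast
    then have oeq: "org (triangle ?y) = org (triangle x)"
      using equiv_class_eq[OF equiv_vertex_glue] by (metis org_def)
    obtain p where p: "path K (org (triangle x)) p (triangle x)" using org(1)[OF tri[OF x]] by blast
    then have "path K (org (triangle x)) (p @ [x]) (triangle ?y)" 
      using x p unfolding path_append path.simps by blast
    then have "path_ratio m (p @ [x]) = \<kappa> (triangle ?y)"
      using \<kappa>(1)[OF tri[OF y], of "p @ [x]"] oeq by metis
    then have "\<kappa> (triangle ?y) = \<kappa> (triangle x) * step_ratio m x"
      using \<kappa>(1)[OF tri[OF x] p] by simp
    then show "l (cross K x) = - l x"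
      using triangle_ruleD(1)[OF m y] by (simp add: l_def step_ratio_def)
  next
    fix i v w a b assume "i \<in> simplices K" "tetrad v w a b"
    then show "l (i, v, b) = - (shape z i v w powi perm_sign v w a b) * l (i, v, a)"
      using triangle_ruleD(2)[OF m] by (simp add: l_def)
  qed
  then show ?thesis by blast
qed

text \<open>
  The quotient of two systems is constant on the sides of a triangle and is preserved by crossings.
\<close>

lemma side_lengths_unique:
  assumes "side_lengths z l" "side_lengths z l'"
  obtains \<kappa> where "\<And>i v f. (i, v, f) \<in> flags K \<Longrightarrow> l' (i, v, f) = \<kappa> (i, v) * l (i, v, f)"
    "\<And>t. t \<in> simplices K \<times> {..<4} \<Longrightarrow> \<kappa> t \<noteq> 0"
    "\<And>s t. (s, t) \<in> vertex_glue K \<Longrightarrow> \<kappa> s = \<kappa> t"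
proof -
  have tr: "triangle_rule z l" "triangle_rule z l'" and cr: "\<And>x. x \<in> flags K \<Longrightarrow> l (cross K x) = - l x"
    "\<And>x. x \<in> flags K \<Longrightarrow> l' (cross K x) = - l' x"
    using assms by (auto simp: side_lengths_def)
  define f0 :: "nat \<Rightarrow> nat" where "f0 v = (if v = 0 then 1 else 0)" for v
  define \<kappa> where "\<kappa> = (\<lambda>(i, v). l' (i, v, f0 v) / l (i, v, f0 v))"
  have f0: "(i, v, f0 v) \<in> flags K" if "i \<in> simplices K" "v < 4" for i v
    using that by (auto simp: flags_def f0_def)
  have 1: "l' (i, v, f) = \<kappa> (i, v) * l (i, v, f)" if x: "(i, v, f) \<in> flags K" for i v f
  proof (cases "f = f0 v")
    case True
    then show ?thesis using triangle_ruleD(1)[OF tr(1)] x by (simp add: \<kappa>_def)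
  next
    case False
    have i: "i \<in> simplices K" "v < 4" using x by (auto simp: flags_def)
    have t: "tetrad v (fourth v (f0 v) f) (f0 v) f"
      using tetrad_fourth[of v "f0 v" f] f0[OF i] x False by (auto simp: flags_def tetrad_def)
    show ?thesis
      using triangle_ruleD(2)[OF tr(1) i(1) t] triangle_ruleD(2)[OF tr(2) i(1) t]
        triangle_ruleD(1)[OF tr(1) f0[OF i]] by (simp add: \<kappa>_def)
  qed
  have 2: "\<kappa> t \<noteq> 0" if "t \<in> simplices K \<times> {..<4}" for t
    using that triangle_ruleD(1)[OF tr(1) f0] triangle_ruleD(1)[OF tr(2) f0]
    by (auto simp: \<kappa>_def)
  have 3: "\<kappa> s = \<kappa> t" if "(s, t) \<in> vertex_glue K" for s t
  proof -
    obtain x where x: "x \<in> flags K" "s = triangle x" "t = triangle (cross K x)"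
      using \<open>(s, t) \<in> _\<close> by (auto simp: vertex_glue_eq)
    have *: "\<kappa> (triangle y) = l' y / l y" if "y \<in> flags K" for y
      using 1 triangle_ruleD(1)[OF tr(1)] that by (cases y) simp
    show ?thesis
      unfolding x(2,3) *[OF x(1)] *[OF cross_flags(1)[OF x(1)]] using cr[OF x(1)] by simp
  qed
  show thesis using that 1 2 3 by blast
qed

end

section \<open>Side lengths of a Ptolemy assignment\<close>

definition edge_val :: "('s \<times> nat \<times> nat \<Rightarrow> 'b) \<Rightarrow> 's \<Rightarrow> nat \<Rightarrow> nat \<Rightarrow> 'b" where
  "edge_val c i v w = c (i, min v w, max v w)"

lemma edge_val_commute: "edge_val c i v w = edge_val c i w v"
  by (simp add: edge_val_def min.commute max.commute)

lemma edge_val_less: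
  "v < w \<Longrightarrow> edge_val c i v w = c (i, v, w)" "w < v \<Longrightarrow> edge_val c i v w = c (i, w, v)"
  by (simp_all add: edge_val_def)

text \<open>
  All three shape parameters of a simplex are given by one expression in the edge values.  It is
  stated for even permutations; for odd ones both sides are inverted.
\<close>

lemma shape_ptolemy:
  fixes z :: "'s \<Rightarrow> complex" and c :: "'s \<times> nat \<times> nat \<Rightarrow> complex" and s :: "nat \<Rightarrow> complex"
  assumes s: "s 0 \<in> {1, -1}" "s 1 \<in> {1, -1}" "s 2 \<in> {1, -1}" "s 3 = s 0 * s 1 * s 2"
    and z: "z i = s 2 * s 3 * (c (i, 0, 3) * c (i, 1, 2) / (c (i, 0, 2) * c (i, 1, 3)))"
    "1 / (1 - z i) = s 0 * s 3 * (c (i, 0, 2) * c (i, 1, 3) / (c (i, 0, 1) * c (i, 2, 3)))"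
    "1 - 1 / z i = - (s 0 * s 2 * (c (i, 0, 1) * c (i, 2, 3) / (c (i, 0, 3) * c (i, 1, 2))))"
    and t: "tetrad v w a b" and p: "perm_sign v w a b = 1"
  shows "shape z i v w = - ((-1) ^ a * (-1) ^ b * s a * s b *
    (edge_val c i v b * edge_val c i w a / (edge_val c i v a * edge_val c i w b)))"
proof -
  have sh: "shape z i v w = (if {v, w} = {0, 1} \<or> {v, w} = {2, 3}
      then s 2 * s 3 * (c (i, 0, 3) * c (i, 1, 2) / (c (i, 0, 2) * c (i, 1, 3)))
      else if {v, w} = {1, 2} \<or> {v, w} = {0, 3}
      then s 0 * s 3 * (c (i, 0, 2) * c (i, 1, 3) / (c (i, 0, 1) * c (i, 2, 3)))
      else - (s 0 * s 2 * (c (i, 0, 1) * c (i, 2, 3) / (c (i, 0, 3) * c (i, 1, 2)))))"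
    unfolding shape_def z(2,3) unfolding z(1) ..
  have "(v, w, a, b) \<in> {(0,1,2,3), (0,2,3,1), (0,3,1,2), (1,0,3,2), (1,2,0,3), (1,3,2,0),
    (2,0,1,3), (2,1,3,0), (2,3,0,1), (3,0,2,1), (3,1,0,2), (3,2,1,0)}"
    using tetrad_cases[OF t] p by (elim insertE) (simp_all add: perm_sign_def)
  moreover have ev: "edge_val c i 0 1 = c (i, 0, 1)" "edge_val c i 1 0 = c (i, 0, 1)"
    "edge_val c i 0 2 = c (i, 0, 2)" "edge_val c i 2 0 = c (i, 0, 2)"
    "edge_val c i 0 3 = c (i, 0, 3)" "edge_val c i 3 0 = c (i, 0, 3)"
    "edge_val c i 1 2 = c (i, 1, 2)" "edge_val c i 2 1 = c (i, 1, 2)"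
    "edge_val c i 1 3 = c (i, 1, 3)" "edge_val c i 3 1 = c (i, 1, 3)"
    "edge_val c i 2 3 = c (i, 2, 3)" "edge_val c i 3 2 = c (i, 2, 3)"
    by (simp_all add: edge_val_def numeral_2_eq_2 numeral_3_eq_3)
  moreover have "s 0 * s 1 = s 2 * s 3" "s 1 * s 3 = s 0 * s 2" "s 1 * s 2 = s 0 * s 3"
    using s by auto
  ultimately show ?thesis
    unfolding sh
    apply (elim insertE emptyE)
    apply (simp_all add: doubleton_eq_iff mult.commute[of "s 1" "s 0"] mult.commute[of "s 2" "s 0"]
        mult.commute[of "s 3" "s 0"] mult.commute[of "s 2" "s 1"] mult.commute[of "s 3" "s 1"]
        mult.commute[of "s 3" "s 2"] del: One_nat_def)
    apply (simp_all add: mult.commute)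
    done
qed
definition third :: "nat \<Rightarrow> nat \<Rightarrow> nat" where
  "third v f = (if 0 \<notin> {v, f} then 0 else if 1 \<notin> {v, f} then 1 else 2)"

lemma third_tetrad: "v < 4 \<Longrightarrow> f < 4 \<Longrightarrow> v \<noteq> f \<Longrightarrow> tetrad v (third v f) f (fourth v (third v f) f)"
  by (rule tetrad_fourth) (auto simp: third_def)

lemma coboundary1_face:
  assumes "tetrad v w b f"
  shows "coboundary1 \<tau> (i, f) = edge_val \<tau> i v w * edge_val \<tau> i v b * edge_val \<tau> i w b"
proof -
  have pairs: "j < k \<and> k < 4 \<longleftrightarrow> (j, k) \<in> {(0, 1), (0, 2), (0, 3), (1, 2), (1, 3), (2, 3 :: nat)}" for j k
    by auto
  have S: "{(j, k). j < k \<and> k < 4 \<and> j \<noteq> f \<and> k \<noteq> f} = {(min v w, max v w), (min v b, max v b), (min w b, max w b)}"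
    using tetrad_cases[OF assms] unfolding conj_assoc[symmetric] pairs
    by (elim insertE) auto
  have "distinct [(min v w, max v w), (min v b, max v b), (min w b, max w b)]"
    using tetrad_cases[OF assms] by (elim insertE) auto
  then show ?thesis unfolding coboundary1_def prod.case S edge_val_def by (simp add: mult.assoc)
qed

context three_cycle
begin

text \<open>
  For positive real \<open>c\<close> and trivial \<open>\<sigma>\<close> the absolute value is the length of a horocyclic segment in an
  ideal triangle with lambda-lengths \<open>c\<close>.  The sign \<open>eps * (-1)^f\<close> is the induced orientation of the face,
  which changes under gluing.
\<close>

definition side_length :: "('s \<times> nat \<Rightarrow> int) \<Rightarrow> ('s \<times> nat \<times> nat \<Rightarrow> complex) \<Rightarrow> 's \<times> nat \<times> nat \<Rightarrow> complex"
  where "side_length \<sigma> c = (\<lambda>(i, v, f). of_int (eps K i * (-1) ^ f * \<sigma> (i, f)) *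
    (let w = third v f; b = fourth v w f
     in edge_val c i w b / (edge_val c i v w * edge_val c i v b)))"

lemma side_length_eq:
  assumes "tetrad v w b f"
  shows "side_length \<sigma> c (i, v, f) =
    of_int (eps K i * (-1) ^ f * \<sigma> (i, f)) * (edge_val c i w b / (edge_val c i v w * edge_val c i v b))"
proof -
  have "third v f = w \<or> third v f = b"
    using tetrad_cases[OF assms] by (elim insertE) (simp_all add: third_def)
  moreover have "fourth v w f = b" "fourth v b f = w"
    using fourth_tetrad[of v w f b] fourth_tetrad[of v b f w] assms by (auto simp: tetrad_def)
  ultimately show ?thesis
    by (elim disjE) (simp_all add: side_length_def Let_def edge_val_commute[of c i b w] mult.commute)
qed

lemma edge_edges: "i \<in> simplices K \<Longrightarrow> tetrad v w a b \<Longrightarrow> (i, min v w, max v w) \<in> edges K"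
  by (auto simp: tetrad_def edges_def min_def max_def)

lemma edge_glue_edge:
  assumes "i \<in> simplices K" "tetrad v w b f" "glue K (i, f) = (i', f')"
  shows "((i, min v w, max v w), (i', min (glue_vertex f f' v) (glue_vertex f f' w),
    max (glue_vertex f f' v) (glue_vertex f f' w))) \<in> edge_glue K"
  using transport_props(4)[of "(i, v, w, f)"] assms by (auto simp: corners_def tetrad_def)

lemma edge_glueE:
  assumes "(e, e') \<in> edge_glue K"
  obtains i j k b f i' f' where "e = (i, j, k)" "i \<in> simplices K" "j < k" "tetrad j k b f"
    "glue K (i, f) = (i', f')" "f' < 4" "i' \<in> simplices K"
    "e' = (i', glue_vertex f f' j, glue_vertex f f' k)" "glue_vertex f f' j < glue_vertex f f' k"
proof -
  obtain i j k f i' f' where e: "(i, j, k) \<in> edges K" "(i, f) \<in> faces K" "f \<noteq> j" "f \<noteq> k"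
    "glue K (i, f) = (i', f')" "e = (i, j, k)" "e' = (i', glue_vertex f f' j, glue_vertex f f' k)"
    using assms unfolding edge_glue_def by auto
  have d: "i \<in> simplices K" "f < 4" "j < k" "k < 4" using e by (auto simp: faces_def edges_def)
  have "tetrad j k (fourth j k f) f"
    using tetrad_fourth[of j k f] d e by (auto simp: tetrad_def)
  moreover have "i' \<in> simplices K" "f' < 4"
    using glue_faces[OF d(1,2)] e(5) by auto
  moreover have "glue_vertex f f' j < glue_vertex f f' k"
    using d e by (simp add: glue_vertex_less_iff)
  ultimately show thesis using that e d by blast
qed

definition edge_cochain :: "('s \<times> nat \<times> nat \<Rightarrow> 'b) \<Rightarrow> bool" where
  "edge_cochain c \<longleftrightarrow> (\<forall>(e, e')\<in>edge_glue K. c e = c e')"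

lemma edge_val_glue:
  assumes "edge_cochain c" "i \<in> simplices K" "tetrad v w b f" "glue K (i, f) = (i', f')"
  shows "edge_val c i' (glue_vertex f f' v) (glue_vertex f f' w) = edge_val c i v w"
  using edge_glue_edge[OF assms(2-4)] assms(1) by (auto simp: edge_cochain_def edge_val_def)

lemma side_length_cross:
  assumes c: "edge_cochain c" and \<sigma>: "\<And>x. x \<in> faces K \<Longrightarrow> \<sigma> (glue K x) = \<sigma> x" and x: "x \<in> flags K"
  shows "side_length \<sigma> c (cross K x) = - side_length \<sigma> c x"
proof -
  obtain i v f where xd: "x = (i, v, f)" "i \<in> simplices K" "v < 4" "f < 4" "v \<noteq> f"
    using x by (auto simp: flags_def)
  obtain i' f' where g: "glue K (i, f) = (i', f')" "i' \<in> simplices K" "f' < 4"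
    "glue K (i', f') = (i, f)" "eps K i * (-1) ^ f = - (eps K i' * (-1) ^ f')"
    by (rule glue_faces[OF xd(2,4)])
  let ?g = "glue_vertex f f'"
  define w where "w = third v f"
  define b where "b = fourth v w f"
  have t: "tetrad v w b f" using third_tetrad[OF xd(3-5)] by (auto simp: tetrad_def w_def b_def)
  have t': "tetrad (?g v) (?g w) (?g b) f'" by (rule tetrad_glue[OF t g(3)])
  have "\<sigma> (i', f') = \<sigma> (i, f)" using \<sigma>[of "(i, f)"] xd g(1) by (simp add: faces_def)
  moreover have t2: "tetrad v b w f" and t3: "tetrad w b v f" using t by (auto simp: tetrad_def)
  ultimately show ?thesis
    unfolding xd(1) side_length_eq[OF t] using g(5)
    by (simp add: g(1) side_length_eq[OF t'] edge_val_glue[OF c xd(2) t g(1)]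
        edge_val_glue[OF c xd(2) t2 g(1)] edge_val_glue[OF c xd(2) t3 g(1)])
qed

text \<open>
  The third vertex cancels, which makes the edge values recoverable from the side lengths up to sign.
\<close>

lemma side_length_product:
  assumes "i \<in> simplices K" "tetrad v w b f" "\<sigma> (i, f) \<in> {1, -1}"
    and "\<And>e. e \<in> edges K \<Longrightarrow> c e \<noteq> 0"
  shows "side_length \<sigma> c (i, v, f) * side_length \<sigma> c (i, w, f) = 1 / (edge_val c i v w)\<^sup>2"
proof -
  have t: "tetrad w v b f" "tetrad v b w f" "tetrad w b v f" using assms(2) by (auto simp: tetrad_def)
  have nz: "edge_val c i v b \<noteq> 0" "edge_val c i w b \<noteq> 0" "edge_val c i v w \<noteq> 0"
    using assms(4)[OF edge_edges[OF assms(1)]] t assms(2) by (auto simp: edge_val_def)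
  have sq: "(of_int (eps K i * (-1) ^ f * \<sigma> (i, f)) :: complex)\<^sup>2 = 1"
    using eps_cases[OF assms(1)] assms(3) by (auto simp: power_mult_distrib simp flip: power_mult)
  show ?thesis
    unfolding side_length_eq[OF assms(2)] side_length_eq[OF t(1)] edge_val_commute[of c i w v]
    using nz sq by (simp add: field_simps power2_eq_square)
qed

lemma cocycles2D:
  assumes "\<sigma> \<in> cocycles2 K"
  shows "x \<in> faces K \<Longrightarrow> \<sigma> x \<in> {1, -1}" "x \<in> faces K \<Longrightarrow> \<sigma> (glue K x) = \<sigma> x"
    "i \<in> simplices K \<Longrightarrow> \<sigma> (i, 0) * \<sigma> (i, 1) * \<sigma> (i, 2) * \<sigma> (i, 3) = 1"
proof -
  show "x \<in> faces K \<Longrightarrow> \<sigma> x \<in> {1, -1}" "x \<in> faces K \<Longrightarrow> \<sigma> (glue K x) = \<sigma> x"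
    using assms by (auto simp: cocycles2_def)
  have "{..<4} = {0, 1, 2, 3 :: nat}" by auto
  then show "i \<in> simplices K \<Longrightarrow> \<sigma> (i, 0) * \<sigma> (i, 1) * \<sigma> (i, 2) * \<sigma> (i, 3) = 1"
    using assms by (auto simp: cocycles2_def mult.assoc)
qed

lemma ptolemyD:
  assumes "c \<in> ptolemy_variety K \<sigma>"
  shows "e \<in> edges K \<Longrightarrow> c e \<noteq> 0" "edge_cochain c" "e \<notin> edges K \<Longrightarrow> c e = undefined"
    "i \<in> simplices K \<Longrightarrow>
      of_int (\<sigma> (i, 2) * \<sigma> (i, 3)) * c (i, 0, 3) * c (i, 1, 2) +
      of_int (\<sigma> (i, 0) * \<sigma> (i, 3)) * c (i, 0, 1) * c (i, 2, 3) = c (i, 0, 2) * c (i, 1, 3)"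
  using assms by (auto simp: ptolemy_variety_def edge_cochain_def)

text \<open>
  Divided by \<open>c02 * c13\<close>, the Ptolemy relation says that \<open>1 - z\<close> is, like \<open>z\<close>, a monomial in the edge values
  up to sign.  Hence so are all three shape parameters, and they can be compared directly with the
  ratios of sides.
\<close>

lemma ptolemy_side_lengths:
  assumes \<sigma>: "\<sigma> \<in> cocycles2 K" and c: "c \<in> ptolemy_variety K \<sigma>"
  shows "cross_ratios K \<sigma> c \<in> simplices K \<rightarrow>\<^sub>E - {0, 1}"
    and "side_lengths (cross_ratios K \<sigma> c) (side_length \<sigma> c)"
proof -
  let ?z = "cross_ratios K \<sigma> c"
  have nz: "c (i, 0, 1) \<noteq> 0" "c (i, 0, 2) \<noteq> 0" "c (i, 0, 3) \<noteq> 0" "c (i, 1, 2) \<noteq> 0"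
    "c (i, 1, 3) \<noteq> 0" "c (i, 2, 3) \<noteq> 0" if "i \<in> simplices K" for i
    using that ptolemyD(1)[OF c] by (auto simp: edges_def)
  have sg: "\<sigma> (i, 0) \<in> {1, -1}" "\<sigma> (i, 1) \<in> {1, -1}" "\<sigma> (i, 2) \<in> {1, -1}" "\<sigma> (i, 3) \<in> {1, -1}"
    "\<sigma> (i, 0) * \<sigma> (i, 1) * \<sigma> (i, 2) * \<sigma> (i, 3) = 1" if "i \<in> simplices K" for i
    using that cocycles2D(1,3)[OF \<sigma>] by (auto simp: faces_def)
  have z: "?z i = of_int (\<sigma> (i, 2) * \<sigma> (i, 3)) * (c (i, 0, 3) * c (i, 1, 2) / (c (i, 0, 2) * c (i, 1, 3)))"
    if "i \<in> simplices K" for i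
    using that by (simp add: cross_ratios_def)
  have z1: "1 - ?z i = of_int (\<sigma> (i, 0) * \<sigma> (i, 3)) * (c (i, 0, 1) * c (i, 2, 3) / (c (i, 0, 2) * c (i, 1, 3)))"
    if "i \<in> simplices K" for i
    using ptolemyD(4)[OF c that] nz[OF that] unfolding z[OF that] by (simp add: field_simps)
  have z0: "?z i \<noteq> 0" "1 - ?z i \<noteq> 0" if "i \<in> simplices K" for i
    using nz[OF that] sg[OF that] unfolding z1[OF that] unfolding z[OF that] by auto
  show "?z \<in> simplices K \<rightarrow>\<^sub>E - {0, 1}"
    using z0 by (auto simp: cross_ratios_def)
  have z2: "1 - 1 / ?z i = - of_int (\<sigma> (i, 0) * \<sigma> (i, 2)) * (c (i, 0, 1) * c (i, 2, 3) / (c (i, 0, 3) * c (i, 1, 2)))"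
    if i: "i \<in> simplices K" for i
  proof -
    have eq: "1 - 1 / ?z i = - ((1 - ?z i) / ?z i)" using z0[OF i] by (simp add: field_simps)
    show ?thesis
      unfolding eq unfolding z1[OF i] unfolding z[OF i] using nz[OF i] sg[OF i] by (auto simp: field_simps)
  qed
  show "side_lengths ?z (side_length \<sigma> c)"
    unfolding side_lengths_def triangle_rule_def
  proof (intro conjI ballI allI impI)
    fix x assume x: "x \<in> flags K"
    show "side_length \<sigma> c (cross K x) = - side_length \<sigma> c x"
      using side_length_cross[of c \<sigma> x] ptolemyD(2)[OF c] cocycles2D(2)[OF \<sigma>] x by blast
    obtain i v f where xd: "x = (i, v, f)" "i \<in> simplices K" "v < 4" "f < 4" "v \<noteq> f"
      using x by (auto simp: flags_def)
    have t: "tetrad v (fourth v (third v f) f) (third v f) f"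
      using third_tetrad[OF xd(3-5)] by (auto simp: tetrad_def)
    have "\<sigma> (i, f) \<in> {1, -1}" using cocycles2D(1)[OF \<sigma>, of "(i, f)"] xd by (simp add: faces_def)
    then have "side_length \<sigma> c x * side_length \<sigma> c (i, fourth v (third v f) f, f) =
      1 / (edge_val c i v (fourth v (third v f) f))\<^sup>2"
      unfolding xd(1) by (rule side_length_product[OF xd(2) t _ ptolemyD(1)[OF c]])
    moreover have "edge_val c i v (fourth v (third v f) f) \<noteq> 0"
      unfolding edge_val_def by (rule ptolemyD(1)[OF c edge_edges[OF xd(2) t]])
    ultimately show "side_length \<sigma> c x \<noteq> 0" by auto
  next
    fix i v w a b assume i: "i \<in> simplices K" and t: "tetrad v w a b"
    have ta: "tetrad v w b a" by (rule tetrad_swap(2)[OF t])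
    define s where "s f = (of_int (\<sigma> (i, f)) :: complex)" for f
    have s: "s 0 \<in> {1, -1}" "s 1 \<in> {1, -1}" "s 2 \<in> {1, -1}" "s 3 = s 0 * s 1 * s 2"
      using sg[OF i] by (auto simp: s_def)
    have s1: "s f \<in> {1, -1}" if "f < 4" for f
      using cocycles2D(1)[OF \<sigma>, of "(i, f)"] that i by (auto simp: s_def faces_def)
    have z3: "1 / (1 - ?z i) = s 0 * s 3 * (c (i, 0, 2) * c (i, 1, 3) / (c (i, 0, 1) * c (i, 2, 3)))"
      unfolding z1[OF i] using sg[OF i] by (auto simp: s_def)
    note formula = shape_ptolemy[where s = s and z = ?z and c = c and i = i, OF s z[OF i, unfolded of_int_mult, folded s_def]
        z3 z2[OF i, unfolded of_int_mult mult_minus_left, folded s_def]]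
    have key: "side_length \<sigma> c (i, v, b) = - shape ?z i v w * side_length \<sigma> c (i, v, a)"
      if t: "tetrad v w a b" and p: "perm_sign v w a b = 1" for a b
    proof -
      have ta: "tetrad v w b a" by (rule tetrad_swap(2)[OF t])
      have "tetrad v a w b" "tetrad v b w a" "tetrad w a v b" "tetrad w b v a"
        using t by (auto simp: tetrad_def)
      then have nzs: "edge_val c i v a \<noteq> 0" "edge_val c i v b \<noteq> 0" "edge_val c i w a \<noteq> 0"
        "edge_val c i w b \<noteq> 0"
        unfolding edge_val_def using ptolemyD(1)[OF c edge_edges[OF i]] by blast+
      have "s a \<in> {1, -1}" "s b \<in> {1, -1}" using s1 t by (auto simp: tetrad_def)
      moreover have "(- 1 :: complex) ^ a \<in> {1, -1}" by (cases "even a") auto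
      ultimately show ?thesis
        unfolding side_length_eq[OF t] side_length_eq[OF ta] formula[OF t p] of_int_mult s_def[symmetric]
        using nzs by (auto simp: field_simps)
    qed
    have nz_shape: "shape ?z i v w \<noteq> 0" using shape_nonzero[of ?z i] z0[OF i] by simp
    show "side_length \<sigma> c (i, v, b) = - (shape ?z i v w powi perm_sign v w a b) * side_length \<sigma> c (i, v, a)"
    proof (cases "perm_sign v w a b = 1")
      case True
      then show ?thesis using key[OF t] by simp
    next
      case False
      then have p: "perm_sign v w a b = -1" using perm_sign_swap(3)[OF t] by simp
      then have "perm_sign v w b a = 1" using perm_sign_swap(1)[OF t] by simp
      from key[OF tetrad_swap(2)[OF t] this] show ?thesis
        using nz_shape by (simp add: p power_int_minus field_simps)
    qed
  qed
qed

end

section \<open>From side lengths back to Ptolemy assignments\<close>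

lemma csqrt_power2: "(csqrt x)\<^sup>2 = x"
  by simp

context three_cycle
begin

text \<open>
  Three instances of the triangle rule suffice.  Reading \<open>z\<close> off the edges \<open>01\<close> and \<open>23\<close> gives the same
  monomial with signs \<open>\<sigma>2 * \<sigma>3\<close> and \<open>\<sigma>0 * \<sigma>1\<close>, whence the cocycle condition; the edge \<open>12\<close> gives \<open>1 - z\<close>,
  whence the Ptolemy relation.
\<close>

lemma side_lengths_imp_ptolemy:
  assumes l: "triangle_rule z l" and i: "i \<in> simplices K" and z: "z i \<noteq> 0" "z i \<noteq> 1"
    and c: "\<And>e. e \<in> edges K \<Longrightarrow> c e \<noteq> 0"
    and \<sigma>: "\<And>x. x \<in> faces K \<Longrightarrow> \<sigma> x \<in> {1, -1}"
    and eq: "\<And>x. x \<in> flags K \<Longrightarrow> side_length \<sigma> c x = l x"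
  shows "\<sigma> (i, 0) * \<sigma> (i, 1) * \<sigma> (i, 2) * \<sigma> (i, 3) = 1"
    and "of_int (\<sigma> (i, 2) * \<sigma> (i, 3)) * c (i, 0, 3) * c (i, 1, 2) +
      of_int (\<sigma> (i, 0) * \<sigma> (i, 3)) * c (i, 0, 1) * c (i, 2, 3) = c (i, 0, 2) * c (i, 1, 3)"
    and "z i = of_int (\<sigma> (i, 2) * \<sigma> (i, 3)) * (c (i, 0, 3) * c (i, 1, 2) / (c (i, 0, 2) * c (i, 1, 3)))"
proof -
  have nz: "c (i, 0, 1) \<noteq> 0" "c (i, 0, 2) \<noteq> 0" "c (i, 0, 3) \<noteq> 0" "c (i, 1, 2) \<noteq> 0"
    "c (i, 1, 3) \<noteq> 0" "c (i, 2, 3) \<noteq> 0"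
    using i c by (auto simp: edges_def)
  have s: "\<sigma> (i, 0) \<in> {1, -1}" "\<sigma> (i, 1) \<in> {1, -1}" "\<sigma> (i, 2) \<in> {1, -1}" "\<sigma> (i, 3) \<in> {1, -1}"
    using i \<sigma> by (auto simp: faces_def)
  have rule: "side_length \<sigma> c (i, v, b) = - (shape z i v w powi perm_sign v w a b) * side_length \<sigma> c (i, v, a)"
    if "tetrad v w a b" for v w a b
    using triangle_ruleD(2)[OF l i that] eq tetrad_flag[OF i that] tetrad_flag[OF i tetrad_swap(2)[OF that]]
    by simp
  have t: "tetrad 0 1 2 3" "tetrad 0 1 3 2" "tetrad 2 3 0 1" "tetrad 2 3 1 0" "tetrad 1 2 0 3" "tetrad 1 2 3 0"
    by (auto simp: tetrad_def)
  note expand = shape_def perm_sign_def Let_def edge_val_less doubleton_eq_iff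
  have A: "of_int (\<sigma> (i, 3)) * c (i, 1, 2) * c (i, 0, 3) = z i * of_int (\<sigma> (i, 2)) * c (i, 1, 3) * c (i, 0, 2)"
    using rule[OF t(1)] eps_cases[OF i] nz unfolding side_length_eq[OF t(1)] side_length_eq[OF t(2)]
    by (elim disjE) (simp_all add: expand field_simps)
  have B: "of_int (\<sigma> (i, 1)) * c (i, 0, 3) * c (i, 1, 2) = z i * of_int (\<sigma> (i, 0)) * c (i, 1, 3) * c (i, 0, 2)"
    using rule[OF t(3)] eps_cases[OF i] nz unfolding side_length_eq[OF t(3)] side_length_eq[OF t(4)]
    by (elim disjE) (simp_all add: expand field_simps)
  have "of_int (\<sigma> (i, 3)) * (c (i, 0, 2) * (c (i, 1, 2) * c (i, 1, 3))) =
    of_int (\<sigma> (i, 0)) * (c (i, 0, 1) * (c (i, 1, 2) * c (i, 2, 3))) +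
    z i * (of_int (\<sigma> (i, 3)) * (c (i, 0, 2) * (c (i, 1, 2) * c (i, 1, 3))))"
    using rule[OF t(5)] eps_cases[OF i] nz z unfolding side_length_eq[OF t(5)] side_length_eq[OF t(6)]
    by (elim disjE) (simp_all add: expand field_simps)
  then have "c (i, 1, 2) * (of_int (\<sigma> (i, 3)) * c (i, 0, 2) * c (i, 1, 3) * (1 - z i) -
    of_int (\<sigma> (i, 0)) * c (i, 2, 3) * c (i, 0, 1)) = 0"
    by (simp only: algebra_simps mult_1 add_0)
  then have C: "of_int (\<sigma> (i, 3)) * c (i, 0, 2) * c (i, 1, 3) * (1 - z i) =
    of_int (\<sigma> (i, 0)) * c (i, 2, 3) * c (i, 0, 1)"
    using nz by simp
  have z_eq: "z i = of_int (\<sigma> (i, 2) * \<sigma> (i, 3)) * (c (i, 0, 3) * c (i, 1, 2) / (c (i, 0, 2) * c (i, 1, 3)))"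
    using A nz s by (auto simp: field_simps)
  then show "z i = of_int (\<sigma> (i, 2) * \<sigma> (i, 3)) * (c (i, 0, 3) * c (i, 1, 2) / (c (i, 0, 2) * c (i, 1, 3)))" .
  have "of_int (\<sigma> (i, 0) * \<sigma> (i, 3)) * (c (i, 1, 2) * c (i, 0, 3) * z i * c (i, 1, 3) * c (i, 0, 2)) =
    (of_int (\<sigma> (i, 1) * \<sigma> (i, 2)) * (c (i, 1, 2) * c (i, 0, 3) * z i * c (i, 1, 3) * c (i, 0, 2)) :: complex)"
    using arg_cong2[of _ _ _ _ "(*)", OF A B[symmetric]] by (simp only: of_int_mult mult_ac)
  then have "(of_int (\<sigma> (i, 0) * \<sigma> (i, 3)) :: complex) = of_int (\<sigma> (i, 1) * \<sigma> (i, 2))"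
    using nz z by (simp only: mult_cancel_right) simp
  then have "\<sigma> (i, 0) * \<sigma> (i, 3) = \<sigma> (i, 1) * \<sigma> (i, 2)" by (simp only: of_int_eq_iff)
  then show "\<sigma> (i, 0) * \<sigma> (i, 1) * \<sigma> (i, 2) * \<sigma> (i, 3) = 1"
    using s by auto
  have "of_int (\<sigma> (i, 0) * \<sigma> (i, 3)) * c (i, 0, 1) * c (i, 2, 3) = c (i, 0, 2) * c (i, 1, 3) * (1 - z i)"
    using C s by (auto simp: algebra_simps)
  moreover have "of_int (\<sigma> (i, 2) * \<sigma> (i, 3)) * c (i, 0, 3) * c (i, 1, 2) = z i * (c (i, 0, 2) * c (i, 1, 3))"
    using A s by (auto simp: algebra_simps)
  ultimately show "of_int (\<sigma> (i, 2) * \<sigma> (i, 3)) * c (i, 0, 3) * c (i, 1, 2) +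
      of_int (\<sigma> (i, 0) * \<sigma> (i, 3)) * c (i, 0, 1) * c (i, 2, 3) = c (i, 0, 2) * c (i, 1, 3)"
    by (simp add: algebra_simps)
qed

text \<open>
  Choosing the square roots by \<open>csqrt\<close> makes them automatically agree on glued edges, since the
  quantity under the root does.  The square of a side length is then the square of the monomial
  \<open>c wb / (c vw * c vb)\<close>, and \<open>\<sigma>\<close> records the remaining sign.
\<close>

lemma ptolemy_of_side_lengths:
  assumes l: "side_lengths z l" and z: "z \<in> simplices K \<rightarrow>\<^sub>E - {0, 1}"
  obtains \<sigma> c where "\<sigma> \<in> cocycles2 K" "c \<in> ptolemy_variety K \<sigma>" "cross_ratios K \<sigma> c = z"
proof -
  have tr: "triangle_rule z l" and cr: "\<And>x. x \<in> flags K \<Longrightarrow> l (cross K x) = - l x"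
    using l by (auto simp: side_lengths_def)
  have z0: "z i \<noteq> 0" "z i \<noteq> 1" if "i \<in> simplices K" for i
    using z that by auto
  define c where "c = restrict (\<lambda>(i, j, k). csqrt (1 / (l (i, j, third j k) * l (i, k, third j k)))) (edges K)"
  have l0: "l (i, v, b) \<noteq> 0" if "i \<in> simplices K" "tetrad v w a b" for i v w a b
    using triangle_ruleD(1)[OF tr tetrad_flag[OF that]] .
  \<comment> \<open>Both faces at an edge give the same product of the lengths at its two ends, because the
    corners at the ends have the same shape parameter and opposite turning directions.\<close>
  have ll: "l (i, v, b) * l (i, w, b) = l (i, v, a) * l (i, w, a)"
    if i: "i \<in> simplices K" and t: "tetrad v w a b" for i v w a b
  proof -
    have nz: "shape z i v w \<noteq> 0" using shape_nonzero z0[OF i] by metis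
    have "shape z i w v powi perm_sign w v a b = inverse (shape z i v w powi perm_sign v w a b)"
      unfolding perm_sign_swap(2)[OF t] shape_commute[of z i w v] by (rule power_int_minus)
    then show ?thesis
      using triangle_ruleD(2)[OF tr i t] triangle_ruleD(2)[OF tr i tetrad_swap(1)[OF t]] nz
      by (simp add: field_simps)
  qed
  have cv: "edge_val c i v w = csqrt (1 / (l (i, v, f) * l (i, w, f)))"
    if i: "i \<in> simplices K" and t: "tetrad v w b f" for i v w b f
  proof -
    let ?m = "min v w" and ?M = "max v w"
    have t': "tetrad ?m ?M b f" using t by (auto simp: tetrad_def min_def max_def)
    have "third ?m ?M = f \<or> third ?m ?M = b"
      using tetrad_cases[OF t] by (elim insertE) (simp_all add: third_def)
    then have "l (i, ?m, third ?m ?M) * l (i, ?M, third ?m ?M) = l (i, ?m, f) * l (i, ?M, f)"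
      using ll[OF i t'] by auto
    also have "\<dots> = l (i, v, f) * l (i, w, f)" by (simp add: min_def max_def mult.commute)
    finally show ?thesis using edge_edges[OF i t] by (simp add: edge_val_def c_def)
  qed
  have cv2: "(edge_val c i v w)\<^sup>2 = 1 / (l (i, v, f) * l (i, w, f))"
    if "i \<in> simplices K" "tetrad v w b f" for i v w b f
    unfolding cv[OF that] by (rule csqrt_power2)
  have cv0: "edge_val c i v w \<noteq> 0" if "i \<in> simplices K" "tetrad v w b f" for i v w b f
    using cv2[OF that] l0[of i v w b f] l0[of i w v b f] that tetrad_swap(1)[OF that(2)] by auto
  have c0: "c e \<noteq> 0" if e: "e \<in> edges K" for e
  proof -
    obtain i j k where e': "e = (i, j, k)" "i \<in> simplices K" "j < k" "k < 4" using e by (auto simp: edges_def)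
    have "tetrad j k (third j k) (fourth j k (third j k))"
      by (rule tetrad_fourth) (use e' in \<open>auto simp: third_def\<close>)
    then show ?thesis using cv0[OF e'(2)] e' by (metis edge_val_less)
  qed
  have cinv: "edge_cochain c"
    unfolding edge_cochain_def
  proof clarify
    fix i j k i' j' k' assume "((i, j, k), (i', j', k')) \<in> edge_glue K"
    then obtain b f f' where e: "i \<in> simplices K" "j < k" "tetrad j k b f"
      "glue K (i, f) = (i', f')" "f' < 4" "i' \<in> simplices K"
      "j' = glue_vertex f f' j" "k' = glue_vertex f f' k" "j' < k'"
      by (rule edge_glueE) auto
    have t': "tetrad j' k' (glue_vertex f f' b) f'" using tetrad_glue[OF e(3,5)] e by simp
    have fl: "(i, j, f) \<in> flags K" "(i, k, f) \<in> flags K"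
      using e(1,3) by (auto simp: flags_def tetrad_def)
    have "l (i', j', f') = - l (i, j, f)" "l (i', k', f') = - l (i, k, f)"
      using cr[OF fl(1)] cr[OF fl(2)] e by simp_all
    then show "c (i, j, k) = c (i', j', k')"
      using cv[OF e(1,3)] cv[OF e(6) t'] e(2,9) by (simp add: edge_val_less)
  qed
  \<comment> \<open>The sign by which a side length differs from the monomial in the edge values; it depends
    on the face only, not on the vertex.\<close>
  define \<rho> where "\<rho> i v w b f = l (i, v, f) * edge_val c i v w * edge_val c i v b / edge_val c i w b" for i v w b f
  have \<rho>2: "(\<rho> i v w b f)\<^sup>2 = 1" and \<rho>_prod: "\<rho> i v w b f * \<rho> i w v b f = 1"
    if i: "i \<in> simplices K" and t: "tetrad v w b f" for i v w b f
  proof -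
    have t2: "tetrad v b w f" and t3: "tetrad w b v f" and t4: "tetrad w v b f"
      and t5: "tetrad b v w f" using t by (auto simp: tetrad_def)
    have nz: "l (i, v, f) \<noteq> 0" "l (i, w, f) \<noteq> 0" "l (i, b, f) \<noteq> 0"
      using l0[OF i t] l0[OF i t4] l0[OF i t5] by simp_all
    show "(\<rho> i v w b f)\<^sup>2 = 1"
      unfolding \<rho>_def power_divide power_mult_distrib cv2[OF i t] cv2[OF i t2] cv2[OF i t3]
      using nz by (simp add: field_simps power2_eq_square)
    have "\<rho> i v w b f * \<rho> i w v b f = l (i, v, f) * l (i, w, f) * (edge_val c i v w)\<^sup>2"
      unfolding \<rho>_def edge_val_commute[of c i w v] edge_val_commute[of c i w b] edge_val_commute[of c i v b]
      using cv0[OF i t2] cv0[OF i t3]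
      by (simp add: power2_eq_square edge_val_commute[of c i w b] edge_val_commute[of c i v b])
    then show "\<rho> i v w b f * \<rho> i w v b f = 1" unfolding cv2[OF i t] using nz by simp
  qed
  have \<rho>_sym: "\<rho> i w v b f = \<rho> i v w b f" "\<rho> i v b w f = \<rho> i v w b f"
    if i: "i \<in> simplices K" and t: "tetrad v w b f" for i v w b f
  proof -
    have "\<rho> i v w b f = 1 \<or> \<rho> i v w b f = -1" "\<rho> i w v b f = 1 \<or> \<rho> i w v b f = -1"
      using \<rho>2[OF i t] \<rho>2[OF i tetrad_swap(1)[OF t]] by (simp_all add: power2_eq_1_iff)
    then show "\<rho> i w v b f = \<rho> i v w b f" using \<rho>_prod[OF i t] by auto
    show "\<rho> i v b w f = \<rho> i v w b f" by (simp add: \<rho>_def edge_val_commute[of c i b w])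
  qed
  define \<sigma> :: "'s \<times> nat \<Rightarrow> int" where "\<sigma> = restrict (\<lambda>(i, f). let v = (if f = 0 then 1 else 0); w = third v f
    in if \<rho> i v w (fourth v w f) f = of_int (eps K i * (-1) ^ f) then 1 else -1) (faces K)"
  have \<sigma>: "of_int (eps K i * (-1) ^ f * \<sigma> (i, f)) = \<rho> i v w b f"
    if i: "i \<in> simplices K" and t: "tetrad v w b f" for i v w b f
  proof -
    define v0 :: nat where "v0 = (if f = 0 then 1 else 0)"
    define w0 where "w0 = third v0 f"
    define b0 where "b0 = fourth v0 w0 f"
    have f: "(i, f) \<in> faces K" "f < 4" using i t by (auto simp: faces_def tetrad_def)
    have "v0 < 4" "v0 \<noteq> f" by (auto simp: v0_def)
    then have t0: "tetrad v0 w0 b0 f"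
      using third_tetrad[of v0 f] f unfolding b0_def w0_def by (auto simp: tetrad_def)
    have "(v0, w0, b0) \<in> {(v, w, b), (v, b, w), (w, v, b), (w, b, v), (b, v, w), (b, w, v)}"
      using t t0 tetrad_cases[OF t] tetrad_cases[OF t0] by (elim insertE) auto
    then have eq: "\<rho> i v0 w0 b0 f = \<rho> i v w b f"
      using \<rho>_sym[OF i] t by (auto simp: tetrad_def)
    have "\<rho> i v0 w0 b0 f = 1 \<or> \<rho> i v0 w0 b0 f = -1"
      using \<rho>2[OF i t0] by (simp add: power2_eq_1_iff)
    moreover have "(of_int (eps K i * (-1) ^ f) :: complex) \<in> {1, -1}"
      using eps_cases[OF i] by (cases "even f") auto
    moreover have "\<sigma> (i, f) = (if \<rho> i v0 w0 b0 f = of_int (eps K i * (-1) ^ f) then 1 else -1)"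
      unfolding \<sigma>_def v0_def w0_def b0_def Let_def using f by simp
    ultimately show ?thesis unfolding eq[symmetric] by (auto simp: of_int_mult)
  qed
  have \<sigma>1: "\<sigma> x \<in> {1, -1}" if "x \<in> faces K" for x
    using that by (cases x) (auto simp: \<sigma>_def Let_def)
  have sl: "side_length \<sigma> c x = l x" if x: "x \<in> flags K" for x
  proof -
    obtain i v f where xd: "x = (i, v, f)" "i \<in> simplices K" "v < 4" "f < 4" "v \<noteq> f"
      using x by (auto simp: flags_def)
    define w where "w = third v f"
    define b where "b = fourth v w f"
    have t: "tetrad v w b f" using third_tetrad[OF xd(3-5)] by (auto simp: tetrad_def w_def b_def)
    then have "tetrad v b w f" "tetrad w b v f" by (auto simp: tetrad_def)
    then show ?thesis
      unfolding xd(1) side_length_eq[OF t] \<sigma>[OF xd(2) t]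
      using cv0[OF xd(2)] t by (simp add: \<rho>_def)
  qed
  have \<sigma>glue: "\<sigma> (glue K x) = \<sigma> x" if x: "x \<in> faces K" for x
  proof -
    obtain i f where xd: "x = (i, f)" "i \<in> simplices K" "f < 4" using x by (auto simp: faces_def)
    obtain i' f' where g: "glue K (i, f) = (i', f')" "i' \<in> simplices K" "f' < 4"
      "glue K (i', f') = (i, f)" "eps K i * (-1) ^ f = - (eps K i' * (-1) ^ f')"
      by (rule glue_faces[OF xd(2,3)])
    define v :: nat where "v = (if f = 0 then 1 else 0)"
    define w where "w = third v f"
    define b where "b = fourth v w f"
    have v: "v < 4" "v \<noteq> f" by (auto simp: v_def)
    then have t: "tetrad v w b f" using third_tetrad[of v f] xd(3) by (auto simp: tetrad_def w_def b_def)
    then have t2: "tetrad v b w f" and t3: "tetrad w b v f" by (auto simp: tetrad_def)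
    let ?g = "glue_vertex f f'"
    have t': "tetrad (?g v) (?g w) (?g b) f'" by (rule tetrad_glue[OF t g(3)])
    have "(i, v, f) \<in> flags K" using xd v by (simp add: flags_def)
    from cr[OF this] have "l (i', ?g v, f') = - l (i, v, f)" using g(1) by simp
    then have "\<rho> i' (?g v) (?g w) (?g b) f' = - \<rho> i v w b f"
      by (simp add: \<rho>_def edge_val_glue[OF cinv xd(2) t g(1)] edge_val_glue[OF cinv xd(2) t2 g(1)]
          edge_val_glue[OF cinv xd(2) t3 g(1)])
    then have "(of_int (eps K i' * (-1) ^ f' * \<sigma> (i', f')) :: complex) = of_int (- (eps K i * (-1) ^ f * \<sigma> (i, f)))"
      using \<sigma>[OF xd(2) t] \<sigma>[OF g(2) t'] by simp
    then have "eps K i' * (-1) ^ f' * \<sigma> (i', f') = - (eps K i * (-1) ^ f * \<sigma> (i, f))"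
      by (simp only: of_int_eq_iff)
    then have "eps K i' * (-1) ^ f' * \<sigma> (i', f') = eps K i' * (-1) ^ f' * \<sigma> (i, f)"
      using g(5) by simp
    moreover have "eps K i' * (-1) ^ f' \<noteq> 0" using eps_cases[OF g(2)] by auto
    ultimately show ?thesis by (simp add: xd(1) g(1))
  qed
  note rel = side_lengths_imp_ptolemy[OF tr _ z0 c0 \<sigma>1 sl]
  have four: "{..<4} = {0, 1, 2, 3 :: nat}" by auto
  have "\<sigma> \<in> cocycles2 K"
    unfolding cocycles2_def
  proof (intro CollectI conjI ballI)
    show "\<sigma> \<in> faces K \<rightarrow>\<^sub>E {1, - 1}" using \<sigma>1 by (auto simp: \<sigma>_def)
    show "(\<Prod>f<4. \<sigma> (i, f)) = 1" if "i \<in> simplices K" for i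
      using rel(1)[OF that] that by (simp add: four mult.assoc)
  qed (rule \<sigma>glue)
  moreover have "c \<in> ptolemy_variety K \<sigma>"
    unfolding ptolemy_variety_def
  proof (intro CollectI conjI ballI)
    show "c \<in> edges K \<rightarrow>\<^sub>E - {0}" using c0 by (auto simp: c_def)
    show "case p of (e, e') \<Rightarrow> c e = c e'" if "p \<in> edge_glue K" for p
      using cinv that by (auto simp: edge_cochain_def)
  qed (use rel(2) in blast)
  moreover have "cross_ratios K \<sigma> c = z"
  proof
    fix i show "cross_ratios K \<sigma> c i = z i"
      using rel(3)[of i] z by (cases "i \<in> simplices K") (auto simp: cross_ratios_def PiE_def extensional_def)
  qed
  ultimately show thesis by (rule that)
qed

section \<open>Ptolemy assignments with equal cross-ratios\<close>

lemma vertex_glueI: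
  assumes "i \<in> simplices K" "v < 4" "f < 4" "v \<noteq> f" "glue K (i, f) = (i', f')"
  shows "((i, v), (i', glue_vertex f f' v)) \<in> vertex_glue K"
  using cross_vertex_glue[of "(i, v, f)"] assms by (simp add: flags_def)

definition twist :: "('s \<times> nat \<times> nat \<Rightarrow> int) \<Rightarrow> ('s \<times> nat \<Rightarrow> complex) \<Rightarrow>
    ('s \<times> nat \<times> nat \<Rightarrow> complex) \<Rightarrow> 's \<times> nat \<times> nat \<Rightarrow> complex" where
  "twist \<tau> y c = restrict (\<lambda>(i, j, k). of_int (\<tau> (i, j, k)) * y (i, j) * y (i, k) * c (i, j, k)) (edges K)"

definition vertex_weights :: "('s \<times> nat \<Rightarrow> complex) \<Rightarrow> bool" where
  "vertex_weights y \<longleftrightarrow> (\<forall>t\<in>simplices K \<times> {..<4}. y t \<noteq> 0) \<and> (\<forall>(s, t)\<in>vertex_glue K. y s = y t)"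

lemma cochains1D:
  assumes "\<tau> \<in> cochains1 K"
  shows "e \<in> edges K \<Longrightarrow> \<tau> e \<in> {1, -1}" "edge_cochain \<tau>"
  using assms by (auto simp: cochains1_def edge_cochain_def)

lemma edge_cochain_twist:
  assumes \<tau>: "edge_cochain \<tau>" and y: "vertex_weights y" and c: "edge_cochain c"
  shows "edge_cochain (twist \<tau> y c)"
  unfolding edge_cochain_def
proof clarify
  fix i j k i' j' k' assume eg: "((i, j, k), (i', j', k')) \<in> edge_glue K"
  then obtain b f f' where e: "i \<in> simplices K" "j < k" "tetrad j k b f"
    "glue K (i, f) = (i', f')" "f' < 4" "i' \<in> simplices K"
    "j' = glue_vertex f f' j" "k' = glue_vertex f f' k" "j' < k'"
    by (rule edge_glueE) auto
  have d: "j < 4" "k < 4" "f < 4" "j \<noteq> f" "k \<noteq> f" using e(3) by (auto simp: tetrad_def)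
  have "y (i', j') = y (i, j)" "y (i', k') = y (i, k)"
    using y vertex_glueI[OF e(1) d(1,3,4) e(4)] vertex_glueI[OF e(1) d(2,3,5) e(4)]
    unfolding vertex_weights_def e(7,8) by fastforce+
  moreover have "(i, j, k) \<in> edges K" "(i', j', k') \<in> edges K"
    using e d by (auto simp: edges_def glue_vertex_less)
  moreover have "\<tau> (i', j', k') = \<tau> (i, j, k)" "c (i', j', k') = c (i, j, k)"
    using \<tau> c eg by (auto simp: edge_cochain_def)
  ultimately show "twist \<tau> y c (i, j, k) = twist \<tau> y c (i', j', k')"
    by (simp add: twist_def)
qed

text \<open>
  All three terms of the Ptolemy relation are multiplied by the same number
  \<open>\<tau>02 * \<tau>13 * y0 * y1 * y2 * y3\<close>: the coboundary of \<open>\<tau>\<close> supplies exactly the signs that are missing in two of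
  the terms.
\<close>

lemma twist_ptolemy:
  assumes c: "c \<in> ptolemy_variety K \<sigma>" and \<tau>: "\<tau> \<in> cochains1 K" and y: "vertex_weights y"
    and \<sigma>': "\<And>x. x \<in> faces K \<Longrightarrow> \<sigma>' x = \<sigma> x * coboundary1 \<tau> x"
  shows "twist \<tau> y c \<in> ptolemy_variety K \<sigma>'" "cross_ratios K \<sigma>' (twist \<tau> y c) = cross_ratios K \<sigma> c"
proof -
  have e: "(i, 0, 1) \<in> edges K" "(i, 0, 2) \<in> edges K" "(i, 0, 3) \<in> edges K" "(i, 1, 2) \<in> edges K"
    "(i, 1, 3) \<in> edges K" "(i, 2, 3) \<in> edges K" if "i \<in> simplices K" for i
    using that by (auto simp: edges_def)
  have rel: "of_int (\<sigma>' (i, 2) * \<sigma>' (i, 3)) * twist \<tau> y c (i, 0, 3) * twist \<tau> y c (i, 1, 2) =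
      of_int (\<tau> (i, 0, 2) * \<tau> (i, 1, 3)) * y (i, 0) * y (i, 1) * y (i, 2) * y (i, 3) *
        (of_int (\<sigma> (i, 2) * \<sigma> (i, 3)) * c (i, 0, 3) * c (i, 1, 2))"
    "of_int (\<sigma>' (i, 0) * \<sigma>' (i, 3)) * twist \<tau> y c (i, 0, 1) * twist \<tau> y c (i, 2, 3) =
      of_int (\<tau> (i, 0, 2) * \<tau> (i, 1, 3)) * y (i, 0) * y (i, 1) * y (i, 2) * y (i, 3) *
        (of_int (\<sigma> (i, 0) * \<sigma> (i, 3)) * c (i, 0, 1) * c (i, 2, 3))"
    "twist \<tau> y c (i, 0, 2) * twist \<tau> y c (i, 1, 3) =
      of_int (\<tau> (i, 0, 2) * \<tau> (i, 1, 3)) * y (i, 0) * y (i, 1) * y (i, 2) * y (i, 3) * (c (i, 0, 2) * c (i, 1, 3))"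
    if i: "i \<in> simplices K" for i
  proof -
    have t: "tetrad 1 2 3 0" "tetrad 0 1 3 2" "tetrad 0 1 2 3" by (auto simp: tetrad_def)
    have \<sigma>'': "\<sigma>' (i, 0) = \<sigma> (i, 0) * (\<tau> (i, 1, 2) * \<tau> (i, 1, 3) * \<tau> (i, 2, 3))"
      "\<sigma>' (i, 2) = \<sigma> (i, 2) * (\<tau> (i, 0, 1) * \<tau> (i, 0, 3) * \<tau> (i, 1, 3))"
      "\<sigma>' (i, 3) = \<sigma> (i, 3) * (\<tau> (i, 0, 1) * \<tau> (i, 0, 2) * \<tau> (i, 1, 2))"
      using \<sigma>'[of "(i, 0)"] \<sigma>'[of "(i, 2)"] \<sigma>'[of "(i, 3)"] i
      unfolding coboundary1_face[OF t(1)] coboundary1_face[OF t(2)] coboundary1_face[OF t(3)]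
      by (simp_all add: faces_def edge_val_less)
    have sq: "\<tau> e * \<tau> e = 1" if "e \<in> edges K" for e
      using cochains1D(1)[OF \<tau> that] by auto
    have "\<sigma>' (i, 2) * \<sigma>' (i, 3) * (\<tau> (i, 0, 3) * \<tau> (i, 1, 2)) =
      (\<tau> (i, 0, 1) * \<tau> (i, 0, 1)) * (\<tau> (i, 0, 3) * \<tau> (i, 0, 3)) * (\<tau> (i, 1, 2) * \<tau> (i, 1, 2)) *
      (\<tau> (i, 0, 2) * \<tau> (i, 1, 3) * (\<sigma> (i, 2) * \<sigma> (i, 3)))"
      unfolding \<sigma>'' by (simp only: mult_ac)
    then have p: "\<sigma>' (i, 2) * \<sigma>' (i, 3) * (\<tau> (i, 0, 3) * \<tau> (i, 1, 2)) =
      \<tau> (i, 0, 2) * \<tau> (i, 1, 3) * (\<sigma> (i, 2) * \<sigma> (i, 3))"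
      by (simp only: sq[OF e(1)[OF i]] sq[OF e(3)[OF i]] sq[OF e(4)[OF i]] mult_1_left)
    have "\<sigma>' (i, 0) * \<sigma>' (i, 3) * (\<tau> (i, 0, 1) * \<tau> (i, 2, 3)) =
      (\<tau> (i, 0, 1) * \<tau> (i, 0, 1)) * (\<tau> (i, 2, 3) * \<tau> (i, 2, 3)) * (\<tau> (i, 1, 2) * \<tau> (i, 1, 2)) *
      (\<tau> (i, 0, 2) * \<tau> (i, 1, 3) * (\<sigma> (i, 0) * \<sigma> (i, 3)))"
      unfolding \<sigma>'' by (simp only: mult_ac)
    then have q: "\<sigma>' (i, 0) * \<sigma>' (i, 3) * (\<tau> (i, 0, 1) * \<tau> (i, 2, 3)) =
      \<tau> (i, 0, 2) * \<tau> (i, 1, 3) * (\<sigma> (i, 0) * \<sigma> (i, 3))"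
      by (simp only: sq[OF e(1)[OF i]] sq[OF e(6)[OF i]] sq[OF e(4)[OF i]] mult_1_left)
    note p' = arg_cong[OF p, of "of_int :: int \<Rightarrow> complex"]
    note q' = arg_cong[OF q, of "of_int :: int \<Rightarrow> complex"]
    have tw: "twist \<tau> y c (i, j, k) = of_int (\<tau> (i, j, k)) * y (i, j) * y (i, k) * c (i, j, k)"
      if "(i, j, k) \<in> edges K" for j k
      using that by (simp add: twist_def)
    have "of_int (\<sigma>' (i, 2) * \<sigma>' (i, 3)) * twist \<tau> y c (i, 0, 3) * twist \<tau> y c (i, 1, 2) =
      of_int (\<sigma>' (i, 2) * \<sigma>' (i, 3) * (\<tau> (i, 0, 3) * \<tau> (i, 1, 2))) *
        (y (i, 0) * y (i, 1) * y (i, 2) * y (i, 3) * c (i, 0, 3) * c (i, 1, 2))"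
      unfolding tw[OF e(3)[OF i]] tw[OF e(4)[OF i]] of_int_mult by (simp only: mult_ac)
    also have "\<dots> = of_int (\<tau> (i, 0, 2) * \<tau> (i, 1, 3)) * y (i, 0) * y (i, 1) * y (i, 2) * y (i, 3) *
        (of_int (\<sigma> (i, 2) * \<sigma> (i, 3)) * c (i, 0, 3) * c (i, 1, 2))"
      unfolding p' unfolding of_int_mult by (simp only: mult_ac)
    finally show "of_int (\<sigma>' (i, 2) * \<sigma>' (i, 3)) * twist \<tau> y c (i, 0, 3) * twist \<tau> y c (i, 1, 2) =
      of_int (\<tau> (i, 0, 2) * \<tau> (i, 1, 3)) * y (i, 0) * y (i, 1) * y (i, 2) * y (i, 3) *
        (of_int (\<sigma> (i, 2) * \<sigma> (i, 3)) * c (i, 0, 3) * c (i, 1, 2))" .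
    have "of_int (\<sigma>' (i, 0) * \<sigma>' (i, 3)) * twist \<tau> y c (i, 0, 1) * twist \<tau> y c (i, 2, 3) =
      of_int (\<sigma>' (i, 0) * \<sigma>' (i, 3) * (\<tau> (i, 0, 1) * \<tau> (i, 2, 3))) *
        (y (i, 0) * y (i, 1) * y (i, 2) * y (i, 3) * c (i, 0, 1) * c (i, 2, 3))"
      unfolding tw[OF e(1)[OF i]] tw[OF e(6)[OF i]] of_int_mult by (simp only: mult_ac)
    also have "\<dots> = of_int (\<tau> (i, 0, 2) * \<tau> (i, 1, 3)) * y (i, 0) * y (i, 1) * y (i, 2) * y (i, 3) *
        (of_int (\<sigma> (i, 0) * \<sigma> (i, 3)) * c (i, 0, 1) * c (i, 2, 3))"
      unfolding q' unfolding of_int_mult by (simp only: mult_ac)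
    finally show "of_int (\<sigma>' (i, 0) * \<sigma>' (i, 3)) * twist \<tau> y c (i, 0, 1) * twist \<tau> y c (i, 2, 3) =
      of_int (\<tau> (i, 0, 2) * \<tau> (i, 1, 3)) * y (i, 0) * y (i, 1) * y (i, 2) * y (i, 3) *
        (of_int (\<sigma> (i, 0) * \<sigma> (i, 3)) * c (i, 0, 1) * c (i, 2, 3))" .
    show "twist \<tau> y c (i, 0, 2) * twist \<tau> y c (i, 1, 3) =
      of_int (\<tau> (i, 0, 2) * \<tau> (i, 1, 3)) * y (i, 0) * y (i, 1) * y (i, 2) * y (i, 3) * (c (i, 0, 2) * c (i, 1, 3))"
      unfolding tw[OF e(2)[OF i]] tw[OF e(5)[OF i]] of_int_mult by (simp only: mult_ac)
  qed
  have y0: "y (i, v) \<noteq> 0" if "i \<in> simplices K" "v < 4" for i v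
    using y that by (auto simp: vertex_weights_def)
  have \<tau>0: "\<tau> x \<noteq> 0" if "x \<in> edges K" for x using cochains1D(1)[OF \<tau> that] by auto
  have nz: "of_int (\<tau> (i, 0, 2) * \<tau> (i, 1, 3)) * y (i, 0) * y (i, 1) * y (i, 2) * y (i, 3) \<noteq> 0"
    if "i \<in> simplices K" for i
    using y0[OF that] \<tau>0[OF e(2)[OF that]] \<tau>0[OF e(5)[OF that]] by simp
  show "twist \<tau> y c \<in> ptolemy_variety K \<sigma>'"
    unfolding ptolemy_variety_def
  proof (intro CollectI conjI ballI)
    show "twist \<tau> y c \<in> edges K \<rightarrow>\<^sub>E - {0}"
      using ptolemyD(1)[OF c] y0 \<tau>0 by (auto simp: twist_def edges_def)
    show "case p of (e, e') \<Rightarrow> twist \<tau> y c e = twist \<tau> y c e'" if "p \<in> edge_glue K" for p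
      using edge_cochain_twist[OF cochains1D(2)[OF \<tau>] y ptolemyD(2)[OF c]] that
      by (auto simp: edge_cochain_def)
    fix i assume i: "i \<in> simplices K"
    show "of_int (\<sigma>' (i, 2) * \<sigma>' (i, 3)) * twist \<tau> y c (i, 0, 3) * twist \<tau> y c (i, 1, 2) +
        of_int (\<sigma>' (i, 0) * \<sigma>' (i, 3)) * twist \<tau> y c (i, 0, 1) * twist \<tau> y c (i, 2, 3) =
        twist \<tau> y c (i, 0, 2) * twist \<tau> y c (i, 1, 3)"
      unfolding rel[OF i] ptolemyD(4)[OF c i, symmetric] by (rule distrib_left[symmetric])
  qed
  show "cross_ratios K \<sigma>' (twist \<tau> y c) = cross_ratios K \<sigma> c"
  proof
    fix i
    show "cross_ratios K \<sigma>' (twist \<tau> y c) i = cross_ratios K \<sigma> c i"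
    proof (cases "i \<in> simplices K")
      case True
      have "cross_ratios K \<sigma>' (twist \<tau> y c) i =
        (of_int (\<sigma>' (i, 2) * \<sigma>' (i, 3)) * twist \<tau> y c (i, 0, 3) * twist \<tau> y c (i, 1, 2)) /
        (twist \<tau> y c (i, 0, 2) * twist \<tau> y c (i, 1, 3))"
        using True by (simp add: cross_ratios_def)
      also have "\<dots> = (of_int (\<sigma> (i, 2) * \<sigma> (i, 3)) * c (i, 0, 3) * c (i, 1, 2)) / (c (i, 0, 2) * c (i, 1, 3))"
        unfolding rel[OF True] by (rule mult_divide_mult_cancel_left[OF nz[OF True]])
      also have "\<dots> = cross_ratios K \<sigma> c i" using True by (simp add: cross_ratios_def)
      finally show ?thesis .
    qed (simp add: cross_ratios_def)
  qed
qed

text \<open>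
  The two systems of side lengths differ by factors \<open>\<kappa>\<close> on the 0-cells.  Since side lengths have degree
  \<open>-1\<close> in the edge values, the weights are \<open>y = 1 / csqrt \<kappa>\<close>.  They account for the squares of the edge
  values, and \<open>\<tau>\<close> is the sign left over; comparing the lengths themselves and not only their squares
  yields the relation between the cocycles.
\<close>

lemma same_cross_ratios:
  assumes \<sigma>: "\<sigma> \<in> cocycles2 K" "c \<in> ptolemy_variety K \<sigma>"
    and \<sigma>': "\<sigma>' \<in> cocycles2 K" "c' \<in> ptolemy_variety K \<sigma>'"
    and eq: "cross_ratios K \<sigma>' c' = cross_ratios K \<sigma> c"
  obtains y \<tau> where "vertex_weights y" "\<tau> \<in> cochains1 K" "c' = twist \<tau> y c"
    "\<And>x. x \<in> faces K \<Longrightarrow> \<sigma>' x = \<sigma> x * coboundary1 \<tau> x"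
proof -
  note c = ptolemyD[OF \<sigma>(2)] and c' = ptolemyD[OF \<sigma>'(2)]
  obtain \<kappa> where \<kappa>: "\<And>i v f. (i, v, f) \<in> flags K \<Longrightarrow>
      side_length \<sigma>' c' (i, v, f) = \<kappa> (i, v) * side_length \<sigma> c (i, v, f)"
    "\<And>t. t \<in> simplices K \<times> {..<4} \<Longrightarrow> \<kappa> t \<noteq> 0"
    "\<And>s t. (s, t) \<in> vertex_glue K \<Longrightarrow> \<kappa> s = \<kappa> t"
    using side_lengths_unique[OF ptolemy_side_lengths(2)[OF \<sigma>]
        ptolemy_side_lengths(2)[OF \<sigma>', unfolded eq]] by blast
  define y where "y t = 1 / csqrt (\<kappa> t)" for t
  have y2: "(y t)\<^sup>2 = 1 / \<kappa> t" for t by (simp add: y_def power_divide)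
  have yw: "vertex_weights y"
    using \<kappa>(2,3) unfolding vertex_weights_def y_def by auto
  define \<tau> :: "'s \<times> nat \<times> nat \<Rightarrow> int" where
    "\<tau> = restrict (\<lambda>(i, j, k). if c' (i, j, k) = y (i, j) * y (i, k) * c (i, j, k) then 1 else -1) (edges K)"
  have \<tau>1: "\<tau> e \<in> {1, -1}" if "e \<in> edges K" for e
    using that by (cases e) (auto simp: \<tau>_def)
  have cc: "edge_val c' i v w = of_int (edge_val \<tau> i v w) * y (i, v) * y (i, w) * edge_val c i v w"
    if i: "i \<in> simplices K" and t: "tetrad v w b f" for i v w b f
  proof -
    have s: "\<sigma> (i, f) \<in> {1, -1}" "\<sigma>' (i, f) \<in> {1, -1}"
      using cocycles2D(1)[OF \<sigma>(1), of "(i, f)"] cocycles2D(1)[OF \<sigma>'(1), of "(i, f)"] i t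
      by (auto simp: faces_def tetrad_def)
    have fl: "(i, v, f) \<in> flags K" "(i, w, f) \<in> flags K" using i t by (auto simp: flags_def tetrad_def)
    have p: "side_length \<sigma> c (i, v, f) * side_length \<sigma> c (i, w, f) = 1 / (edge_val c i v w)\<^sup>2"
      using side_length_product[OF i t, of \<sigma> c] s(1) c(1) by blast
    have p': "side_length \<sigma>' c' (i, v, f) * side_length \<sigma>' c' (i, w, f) = 1 / (edge_val c' i v w)\<^sup>2"
      using side_length_product[OF i t, of \<sigma>' c'] s(2) c'(1) by blast
    have "1 / (edge_val c' i v w)\<^sup>2 = (\<kappa> (i, v) * \<kappa> (i, w)) * (1 / (edge_val c i v w)\<^sup>2)"
      unfolding p[symmetric] p'[symmetric] \<kappa>(1)[OF fl(1)] \<kappa>(1)[OF fl(2)] by (simp only: mult_ac)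
    then have "inverse (1 / (edge_val c' i v w)\<^sup>2) = inverse ((\<kappa> (i, v) * \<kappa> (i, w)) * (1 / (edge_val c i v w)\<^sup>2))"
      by (rule arg_cong)
    then have "(edge_val c' i v w)\<^sup>2 = 1 / (\<kappa> (i, v) * \<kappa> (i, w)) * (edge_val c i v w)\<^sup>2"
      by (simp add: divide_inverse)
    also have "\<dots> = (y (i, v) * y (i, w) * edge_val c i v w)\<^sup>2"
      by (simp add: power_mult_distrib y2)
    finally have "edge_val c' i v w = y (i, v) * y (i, w) * edge_val c i v w \<or>
      edge_val c' i v w = - (y (i, v) * y (i, w) * edge_val c i v w)"
      by (simp only: power2_eq_iff)
    moreover have "edge_val \<tau> i v w = (if edge_val c' i v w = y (i, v) * y (i, w) * edge_val c i v w then 1 else -1)"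
      using edge_edges[OF i t] by (auto simp: edge_val_def \<tau>_def min_def max_def mult_ac)
    ultimately show ?thesis by auto
  qed
  have tw: "c' = twist \<tau> y c"
  proof
    fix e show "c' e = twist \<tau> y c e"
    proof (cases "e \<in> edges K")
      case True
      then obtain i j k where e: "e = (i, j, k)" "i \<in> simplices K" "j < k" "k < 4" by (auto simp: edges_def)
      have "tetrad j k (third j k) (fourth j k (third j k))"
        by (rule tetrad_fourth) (use e in \<open>auto simp: third_def\<close>)
      from cc[OF e(2) this] show ?thesis
        using True e by (simp add: edge_val_less twist_def)
    next
      case False
      then show ?thesis using c'(3)[OF False] by (simp add: twist_def)
    qed
  qed
  have \<tau>co: "\<tau> \<in> cochains1 K"
    unfolding cochains1_def
  proof (intro CollectI conjI ballI)
    show "\<tau> \<in> edges K \<rightarrow>\<^sub>E {1, -1}" using \<tau>1 by (auto simp: \<tau>_def)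
    fix p assume p: "p \<in> edge_glue K"
    obtain i j k i' j' k' where pd: "p = ((i, j, k), (i', j', k'))" by (metis prod_cases3 surj_pair)
    obtain b f f' where e: "i \<in> simplices K" "j < k" "tetrad j k b f"
      "glue K (i, f) = (i', f')" "f' < 4" "i' \<in> simplices K"
      "j' = glue_vertex f f' j" "k' = glue_vertex f f' k" "j' < k'"
      using p unfolding pd by (rule edge_glueE) auto
    have d: "j < 4" "k < 4" "f < 4" "j \<noteq> f" "k \<noteq> f" using e(3) by (auto simp: tetrad_def)
    have "(i, j, k) \<in> edges K" "(i', j', k') \<in> edges K"
      using e d by (auto simp: edges_def glue_vertex_less)
    moreover have "y (i', j') = y (i, j)" "y (i', k') = y (i, k)"
      using yw vertex_glueI[OF e(1) d(1,3,4) e(4)] vertex_glueI[OF e(1) d(2,3,5) e(4)]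
      unfolding vertex_weights_def e(7,8) by fastforce+
    moreover have "c (i', j', k') = c (i, j, k)" "c' (i', j', k') = c' (i, j, k)"
      using c(2) c'(2) p unfolding pd edge_cochain_def by auto
    ultimately show "case p of (e, e') \<Rightarrow> \<tau> e = \<tau> e'" unfolding pd by (simp add: \<tau>_def)
  qed
  have co: "\<sigma>' x = \<sigma> x * coboundary1 \<tau> x" if x: "x \<in> faces K" for x
  proof -
    obtain i f where xd: "x = (i, f)" "i \<in> simplices K" "f < 4" using x by (auto simp: faces_def)
    define v :: nat where "v = (if f = 0 then 1 else 0)"
    define w where "w = third v f"
    define b where "b = fourth v w f"
    have v: "v < 4" "v \<noteq> f" by (auto simp: v_def)
    then have t: "tetrad v w b f" using third_tetrad[of v f] xd(3) by (auto simp: tetrad_def w_def b_def)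
    then have t2: "tetrad v b w f" and t3: "tetrad w b v f" by (auto simp: tetrad_def)
    have ev0: "edge_val c i v w \<noteq> 0" "edge_val c i v b \<noteq> 0" "edge_val c i w b \<noteq> 0"
      unfolding edge_val_def using c(1)[OF edge_edges[OF xd(2)]] t t2 t3 by blast+
    have y0: "y (i, v) \<noteq> 0" "y (i, w) \<noteq> 0" "y (i, b) \<noteq> 0"
      using yw xd(2) t by (auto simp: vertex_weights_def tetrad_def)
    have \<tau>s: "edge_val \<tau> i v w \<in> {1, -1}" "edge_val \<tau> i v b \<in> {1, -1}" "edge_val \<tau> i w b \<in> {1, -1}"
      unfolding edge_val_def using \<tau>1[OF edge_edges[OF xd(2)]] t t2 t3 by blast+
    have ky: "\<kappa> (i, v) = 1 / (y (i, v) * y (i, v))" using y2[of "(i, v)"] by (simp add: power2_eq_square)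
    let ?T = "of_int (edge_val \<tau> i v w * edge_val \<tau> i v b * edge_val \<tau> i w b) :: complex"
    let ?X = "edge_val c i w b / (edge_val c i v w * edge_val c i v b)"
    let ?E = "of_int (eps K i * (-1) ^ f) :: complex"
    have nz: "?E \<noteq> 0" "?X \<noteq> 0" "\<kappa> (i, v) \<noteq> 0"
      using eps_cases[OF xd(2)] ev0 \<kappa>(2)[of "(i, v)"] xd(2) v by auto
    have T: "?T * ?T = 1" using \<tau>s by auto
    have X': "edge_val c' i w b / (edge_val c' i v w * edge_val c' i v b) = \<kappa> (i, v) * ?X * ?T"
      unfolding cc[OF xd(2) t] cc[OF xd(2) t2] cc[OF xd(2) t3] ky
      using ev0 y0 \<tau>s by (auto simp: field_simps)
    have "(i, v, f) \<in> flags K" using xd v by (simp add: flags_def)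
    from \<kappa>(1)[OF this] have "?E * of_int (\<sigma>' (i, f)) * (\<kappa> (i, v) * ?X * ?T) = \<kappa> (i, v) * (?E * of_int (\<sigma> (i, f)) * ?X)"
      unfolding side_length_eq[OF t] of_int_mult[of "eps K i * (-1) ^ f"] X' .
    then have "of_int (\<sigma>' (i, f)) * ?T = of_int (\<sigma> (i, f))"
      using nz by (simp only: mult.assoc mult.left_commute mult_cancel_left mult.commute) auto
    then have "of_int (\<sigma>' (i, f)) * (?T * ?T) = of_int (\<sigma> (i, f)) * ?T"
      by (simp only: mult.assoc[symmetric])
    then have "(of_int (\<sigma>' (i, f)) :: complex) =
      of_int (\<sigma> (i, f) * (edge_val \<tau> i v w * edge_val \<tau> i v b * edge_val \<tau> i w b))"
      unfolding T by (simp only: of_int_mult mult_1_right)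
    then have "\<sigma>' (i, f) = \<sigma> (i, f) * (edge_val \<tau> i v w * edge_val \<tau> i v b * edge_val \<tau> i w b)"
      by (simp only: of_int_eq_iff)
    then show ?thesis unfolding xd(1) coboundary1_face[OF t] .
  qed
  show thesis by (rule that[OF yw \<tau>co tw co])
qed

end

section \<open>Global quotients of polynomials\<close>

definition global_fraction :: "('i \<Rightarrow> complex) set \<Rightarrow> (('i \<Rightarrow> complex) \<Rightarrow> complex) \<Rightarrow> bool" where
  "global_fraction X g \<longleftrightarrow>
     (\<exists>p q. polynomial_fun p \<and> polynomial_fun q \<and> (\<forall>x\<in>X. q x \<noteq> 0 \<and> g x = p x / q x))"

lemma global_fractionI:
  "polynomial_fun p \<Longrightarrow> polynomial_fun q \<Longrightarrow> (\<And>x. x \<in> X \<Longrightarrow> q x \<noteq> 0 \<and> g x = p x / q x) \<Longrightarrow>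
    global_fraction X g"
  unfolding global_fraction_def by blast

lemma global_fraction_const: "global_fraction X (\<lambda>x. a)"
  by (rule global_fractionI[OF polynomial_fun.const[of a] polynomial_fun.const[of 1]]) auto

lemma global_fraction_coord: "global_fraction X (\<lambda>x. x i)"
  by (rule global_fractionI[OF polynomial_fun.coord[of i] polynomial_fun.const[of 1]]) auto

lemma global_fraction_mult:
  assumes "global_fraction X f" "global_fraction X g"
  shows "global_fraction X (\<lambda>x. f x * g x)"
proof -
  obtain p q where pq: "polynomial_fun p" "polynomial_fun q" "\<And>x. x \<in> X \<Longrightarrow> q x \<noteq> 0 \<and> f x = p x / q x"
    using assms(1) unfolding global_fraction_def by blast
  obtain p' q' where pq': "polynomial_fun p'" "polynomial_fun q'" "\<And>x. x \<in> X \<Longrightarrow> q' x \<noteq> 0 \<and> g x = p' x / q' x"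
    using assms(2) unfolding global_fraction_def by blast
  show ?thesis
    by (rule global_fractionI[OF polynomial_fun.mult[OF pq(1) pq'(1)] polynomial_fun.mult[OF pq(2) pq'(2)]])
      (use pq(3) pq'(3) in simp)
qed

lemma global_fraction_divide:
  assumes "global_fraction X f" "global_fraction X g" and nz: "\<And>x. x \<in> X \<Longrightarrow> g x \<noteq> 0"
  shows "global_fraction X (\<lambda>x. f x / g x)"
proof -
  obtain p q where pq: "polynomial_fun p" "polynomial_fun q" "\<And>x. x \<in> X \<Longrightarrow> q x \<noteq> 0 \<and> f x = p x / q x"
    using assms(1) unfolding global_fraction_def by blast
  obtain p' q' where pq': "polynomial_fun p'" "polynomial_fun q'" "\<And>x. x \<in> X \<Longrightarrow> q' x \<noteq> 0 \<and> g x = p' x / q' x"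
    using assms(2) unfolding global_fraction_def by blast
  show ?thesis
  proof (rule global_fractionI[OF polynomial_fun.mult[OF pq(1) pq'(2)] polynomial_fun.mult[OF pq(2) pq'(1)]])
    fix x assume x: "x \<in> X"
    then have "p' x \<noteq> 0" using nz[OF x] pq'(3)[OF x] by auto
    then show "q x * p' x \<noteq> 0 \<and> f x / g x = p x * q' x / (q x * p' x)"
      using pq(3)[OF x] pq'(3)[OF x] by simp
  qed
qed

lemma regular_fun_global_fraction: "global_fraction X g \<Longrightarrow> regular_fun X g"
proof -
  assume "global_fraction X g"
  then obtain p q where pq: "polynomial_fun p" "polynomial_fun q" "\<forall>x\<in>X. q x \<noteq> 0 \<and> g x = p x / q x"
    unfolding global_fraction_def by blast
  have "zariski_closed_in X (X - X)"
    unfolding zariski_closed_in_def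
    by (rule exI[of _ "{\<lambda>x. 1}"]) (auto intro: polynomial_fun.const)
  then show ?thesis unfolding regular_fun_def using pq by blast
qed

text \<open>
  Clearing denominators turns each equation into a polynomial one.
\<close>

lemma zariski_closed_equalizer:
  assumes "\<And>e. e \<in> J \<Longrightarrow> global_fraction X (f e)" "\<And>e. e \<in> J \<Longrightarrow> global_fraction X (g e)"
  shows "zariski_closed_in X {x \<in> X. \<forall>e\<in>J. f e x = g e x}"
proof -
  have "\<exists>r. polynomial_fun r \<and> (\<forall>x\<in>X. r x = 0 \<longleftrightarrow> f e x = g e x)" if e: "e \<in> J" for e
  proof -
    obtain p q where pq: "polynomial_fun p" "polynomial_fun q" "\<And>x. x \<in> X \<Longrightarrow> q x \<noteq> 0 \<and> f e x = p x / q x"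
      using assms(1)[OF e] unfolding global_fraction_def by blast
    obtain p' q' where pq': "polynomial_fun p'" "polynomial_fun q'" "\<And>x. x \<in> X \<Longrightarrow> q' x \<noteq> 0 \<and> g e x = p' x / q' x"
      using assms(2)[OF e] unfolding global_fraction_def by blast
    have "polynomial_fun (\<lambda>x. p x * q' x + (-1) * (p' x * q x))"
      by (intro polynomial_fun.add polynomial_fun.mult polynomial_fun.const pq pq')
    moreover have "p x * q' x + (-1) * (p' x * q x) = 0 \<longleftrightarrow> f e x = g e x" if "x \<in> X" for x
      using pq(3)[OF that] pq'(3)[OF that] by (simp add: field_simps)
    ultimately show ?thesis by blast
  qed
  then obtain r where r: "\<And>e. e \<in> J \<Longrightarrow> polynomial_fun (r e)"
    "\<And>e x. e \<in> J \<Longrightarrow> x \<in> X \<Longrightarrow> r e x = 0 \<longleftrightarrow> f e x = g e x" by metis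
  show ?thesis
    unfolding zariski_closed_in_def using r by (intro exI[of _ "r ` J"]) auto
qed

context three_cycle
begin

section \<open>Cohomologous cocycles\<close>

definition H2_rel :: "(('s \<times> nat \<Rightarrow> int) \<times> ('s \<times> nat \<Rightarrow> int)) set" where
  "H2_rel = {(\<sigma>, \<sigma>'). \<sigma> \<in> cocycles2 K \<and> \<sigma>' \<in> cocycles2 K \<and>
     (\<exists>\<tau>\<in>cochains1 K. \<forall>x\<in>faces K. \<sigma>' x = \<sigma> x * coboundary1 \<tau> x)}"

lemma edge_glue_edges:
  assumes "(e, e') \<in> edge_glue K" shows "e \<in> edges K" "e' \<in> edges K"
proof -
  obtain i j k b f i' f' where "e = (i, j, k)" "i \<in> simplices K" "j < k" "tetrad j k b f"
    "glue K (i, f) = (i', f')" "f' < 4" "i' \<in> simplices K"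
    "e' = (i', glue_vertex f f' j, glue_vertex f f' k)" "glue_vertex f f' j < glue_vertex f f' k"
    using assms by (rule edge_glueE)
  then show "e \<in> edges K" "e' \<in> edges K"
    by (auto simp: edges_def tetrad_def glue_vertex_less)
qed

lemma face_tetrad:
  assumes "x \<in> faces K"
  obtains i v w b f where "x = (i, f)" "i \<in> simplices K" "tetrad v w b f"
proof -
  obtain i f where x: "x = (i, f)" "i \<in> simplices K" "f < 4" using assms by (auto simp: faces_def)
  define v :: nat where "v = (if f = 0 then 1 else 0)"
  have "v < 4" "v \<noteq> f" by (auto simp: v_def)
  then have "tetrad v (third v f) (fourth v (third v f) f) f"
    using third_tetrad[of v f] x(3) by (auto simp: tetrad_def)
  then show thesis using that x by blast
qed

lemma face_edges:
  assumes "i \<in> simplices K" "tetrad v w b f"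
  shows "(i, min v w, max v w) \<in> edges K" "(i, min v b, max v b) \<in> edges K" "(i, min w b, max w b) \<in> edges K"
  using assms by (auto simp: tetrad_def edges_def min_def max_def)

lemma coboundary1_mult:
  assumes "x \<in> faces K"
  shows "coboundary1 (restrict (\<lambda>e. \<tau> e * \<tau>' e) (edges K)) x = coboundary1 \<tau> x * coboundary1 \<tau>' x"
  using assms
proof (rule face_tetrad)
  fix i v w b f assume x: "x = (i, f)" and i: "i \<in> simplices K" and t: "tetrad v w b f"
  show ?thesis
    unfolding x coboundary1_face[OF t] by (simp add: edge_val_def face_edges[OF i t])
qed

lemma coboundary1_square:
  assumes "x \<in> faces K" "\<tau> \<in> cochains1 K"
  shows "coboundary1 \<tau> x * coboundary1 \<tau> x = 1"
  using assms(1)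
proof (rule face_tetrad)
  fix i v w b f assume x: "x = (i, f)" and i: "i \<in> simplices K" and t: "tetrad v w b f"
  show ?thesis
    using cochains1D(1)[OF assms(2) face_edges(1)[OF i t]] cochains1D(1)[OF assms(2) face_edges(2)[OF i t]]
      cochains1D(1)[OF assms(2) face_edges(3)[OF i t]]
    unfolding x coboundary1_face[OF t] edge_val_def by auto
qed

definition trivial_cochain :: "'s \<times> nat \<times> nat \<Rightarrow> int" where
  "trivial_cochain = restrict (\<lambda>e. 1) (edges K)"

lemma trivial_cochain: "trivial_cochain \<in> cochains1 K"
  using edge_glue_edges by (auto simp: trivial_cochain_def cochains1_def)

lemma coboundary1_trivial: "x \<in> faces K \<Longrightarrow> coboundary1 trivial_cochain x = 1"
proof (erule face_tetrad)
  fix i v w b f assume x: "x = (i, f)" and i: "i \<in> simplices K" and t: "tetrad v w b f"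
  show ?thesis
    unfolding x coboundary1_face[OF t] by (simp add: edge_val_def face_edges[OF i t] trivial_cochain_def)
qed

lemma cochains1_mult:
  assumes "\<tau> \<in> cochains1 K" "\<tau>' \<in> cochains1 K"
  shows "restrict (\<lambda>e. \<tau> e * \<tau>' e) (edges K) \<in> cochains1 K"
  unfolding cochains1_def
proof (intro CollectI conjI ballI)
  show "restrict (\<lambda>e. \<tau> e * \<tau>' e) (edges K) \<in> edges K \<rightarrow>\<^sub>E {1, - 1}"
    using cochains1D(1)[OF assms(1)] cochains1D(1)[OF assms(2)] by fastforce
  show "case p of (e, e') \<Rightarrow> restrict (\<lambda>e. \<tau> e * \<tau>' e) (edges K) e = restrict (\<lambda>e. \<tau> e * \<tau>' e) (edges K) e'"
    if p: "p \<in> edge_glue K" for p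
  proof -
    obtain e e' where pd: "p = (e, e')" by (cases p) blast
    have "\<tau> e = \<tau> e'" "\<tau>' e = \<tau>' e'"
      using cochains1D(2)[OF assms(1)] cochains1D(2)[OF assms(2)] p
      unfolding edge_cochain_def pd by blast+
    then show ?thesis using edge_glue_edges[OF p[unfolded pd]] by (simp add: pd)
  qed
qed

lemma equiv_H2_rel: "equiv (cocycles2 K) H2_rel"
proof (rule equivI)
  show "H2_rel \<subseteq> cocycles2 K \<times> cocycles2 K" by (auto simp: H2_rel_def)
  show "refl_on (cocycles2 K) H2_rel"
  proof (rule refl_onI)
    fix \<sigma> assume "\<sigma> \<in> cocycles2 K"
    moreover have "\<sigma> x = \<sigma> x * coboundary1 trivial_cochain x" if "x \<in> faces K" for x
      by (simp add: coboundary1_trivial[OF that])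
    ultimately show "(\<sigma>, \<sigma>) \<in> H2_rel" unfolding H2_rel_def using trivial_cochain by blast
  qed
  show "sym H2_rel"
  proof (rule symI)
    fix \<sigma> \<sigma>' assume "(\<sigma>, \<sigma>') \<in> H2_rel"
    then obtain \<tau> where t: "\<sigma> \<in> cocycles2 K" "\<sigma>' \<in> cocycles2 K" "\<tau> \<in> cochains1 K"
      "\<And>x. x \<in> faces K \<Longrightarrow> \<sigma>' x = \<sigma> x * coboundary1 \<tau> x" by (auto simp: H2_rel_def)
    then have "\<sigma> x = \<sigma>' x * coboundary1 \<tau> x" if "x \<in> faces K" for x
      using coboundary1_square[OF that t(3)] that by (simp add: mult.assoc)
    then show "(\<sigma>', \<sigma>) \<in> H2_rel" using t(1-3) unfolding H2_rel_def by blast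
  qed
  show "trans H2_rel"
  proof (rule transI)
    fix \<sigma> \<sigma>' \<sigma>'' assume "(\<sigma>, \<sigma>') \<in> H2_rel" "(\<sigma>', \<sigma>'') \<in> H2_rel"
    then obtain \<tau> \<tau>' where t: "\<sigma> \<in> cocycles2 K" "\<sigma>'' \<in> cocycles2 K" "\<tau> \<in> cochains1 K" "\<tau>' \<in> cochains1 K"
      "\<And>x. x \<in> faces K \<Longrightarrow> \<sigma>' x = \<sigma> x * coboundary1 \<tau> x"
      "\<And>x. x \<in> faces K \<Longrightarrow> \<sigma>'' x = \<sigma>' x * coboundary1 \<tau>' x" by (auto simp: H2_rel_def)
    have "\<sigma>'' x = \<sigma> x * coboundary1 (restrict (\<lambda>e. \<tau> e * \<tau>' e) (edges K)) x" if "x \<in> faces K" for x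
      unfolding coboundary1_mult[OF that] t(6)[OF that] t(5)[OF that] by (rule mult.assoc)
    then show "(\<sigma>, \<sigma>'') \<in> H2_rel"
      unfolding H2_rel_def using t(1,2) cochains1_mult[OF t(3,4)] by blast
  qed
qed

lemma H2_eq: "H2 K = cocycles2 K // H2_rel"
  by (simp add: H2_def H2_rel_def)

lemma finite_cochains1: "finite (cochains1 K)"
proof (rule finite_subset)
  have "edges K \<subseteq> simplices K \<times> {..<4} \<times> {..<4}" by (auto simp: edges_def)
  then have "finite (edges K)" by (rule finite_subset) (simp add: finite_simplices)
  then show "finite (edges K \<rightarrow>\<^sub>E {1, -1 :: int})" by (rule finite_PiE) simp
qed (auto simp: cochains1_def)

section \<open>Orbits of the vertex weights are tori\<close>

definition scale :: "('s \<times> nat \<Rightarrow> complex) \<Rightarrow> ('s \<times> nat \<times> nat \<Rightarrow> complex) \<Rightarrow> 's \<times> nat \<times> nat \<Rightarrow> complex" where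
  "scale y = twist trivial_cochain y"

definition orbit :: "('s \<times> nat \<times> nat \<Rightarrow> complex) \<Rightarrow> ('s \<times> nat \<times> nat \<Rightarrow> complex) set" where
  "orbit c = {scale y c | y. vertex_weights y}"

lemma scale_apply: "(i, j, k) \<in> edges K \<Longrightarrow> scale y c (i, j, k) = y (i, j) * y (i, k) * c (i, j, k)"
  by (simp add: scale_def twist_def trivial_cochain_def)

lemma twist_undefined: "e \<notin> edges K \<Longrightarrow> twist \<tau> y c e = undefined"
  by (simp add: twist_def)

lemma scale_eqI:
  assumes "\<And>i j k. (i, j, k) \<in> edges K \<Longrightarrow> d (i, j, k) = y (i, j) * y (i, k) * c (i, j, k)"
    "\<And>e. e \<notin> edges K \<Longrightarrow> d e = undefined"
  shows "d = scale y c"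
proof
  fix e show "d e = scale y c e"
    using assms(1)[of "fst e" "fst (snd e)" "snd (snd e)"] assms(2)[of e]
      scale_apply[of "fst e" "fst (snd e)" "snd (snd e)" y c] twist_undefined[of e]
    by (cases "e \<in> edges K") (auto simp: scale_def)
qed

lemma twist_eq_scale: "twist \<tau> y c = scale y (twist \<tau> (\<lambda>_. 1) c)"
  by (rule scale_eqI) (simp_all add: twist_def)

lemma scale_scale: "scale y (scale y' c) = scale (\<lambda>t. y t * y' t) c"
  by (rule scale_eqI) (simp_all add: scale_apply, simp add: scale_def twist_undefined)

lemma vertex_weights_mult: "vertex_weights y \<Longrightarrow> vertex_weights y' \<Longrightarrow> vertex_weights (\<lambda>t. y t * y' t)"
  by (fastforce simp: vertex_weights_def)

lemma vertex_weights_inverse: "vertex_weights y \<Longrightarrow> vertex_weights (\<lambda>t. inverse (y t))"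
  by (fastforce simp: vertex_weights_def)

lemma vertex_weights_one: "vertex_weights (\<lambda>_. 1)"
  by (auto simp: vertex_weights_def)

lemma orbit_eq:
  assumes "d \<in> orbit c" and c: "\<And>e. e \<notin> edges K \<Longrightarrow> c e = undefined"
  shows "orbit d = orbit c"
proof -
  obtain y where y: "vertex_weights y" "d = scale y c" using assms(1) by (auto simp: orbit_def)
  have nz: "y (i, j) \<noteq> 0" if "i \<in> simplices K" "j < 4" for i j
    using y(1) that by (auto simp: vertex_weights_def)
  have c_eq: "c = scale (\<lambda>t. inverse (y t)) d"
  proof (rule scale_eqI)
    fix i j k assume e: "(i, j, k) \<in> edges K"
    then have "y (i, j) \<noteq> 0" "y (i, k) \<noteq> 0" using nz by (auto simp: edges_def)
    then show "c (i, j, k) = inverse (y (i, j)) * inverse (y (i, k)) * d (i, j, k)"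
      by (simp add: y(2) scale_apply[OF e] field_simps)
  qed (rule c)
  have "scale y' c \<in> orbit d" if "vertex_weights y'" for y'
  proof -
    have "scale y' c = scale (\<lambda>t. y' t * inverse (y t)) d"
      by (subst c_eq) (rule scale_scale)
    then show ?thesis
      unfolding orbit_def using vertex_weights_mult[OF that vertex_weights_inverse[OF y(1)]] by blast
  qed
  moreover have "scale y' d \<in> orbit c" if "vertex_weights y'" for y'
    unfolding orbit_def y(2) scale_scale using vertex_weights_mult[OF that y(1)] by blast
  ultimately show ?thesis by (auto simp: orbit_def)
qed

lemma orbit_ptolemy:
  assumes "c \<in> ptolemy_variety K \<sigma>"
  shows "orbit c \<subseteq> ptolemy_variety K \<sigma>"
  using twist_ptolemy(1)[OF assms trivial_cochain] coboundary1_trivial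
  by (auto simp: orbit_def scale_def)

abbreviation vertices :: "('s \<times> nat) set" where
  "vertices \<equiv> simplices K \<times> {..<4}"

text \<open>
  The classes of the generated equivalence relation are the vertex sets of the connected components
  of the complex.
\<close>

definition link_rel :: "(('s \<times> nat) \<times> ('s \<times> nat)) set" where
  "link_rel = vertex_glue K \<union> {((i, v), (i, w)) | i v w. i \<in> simplices K \<and> v < 4 \<and> w < 4}"

lemma vertex_glue_sym: "(s, t) \<in> vertex_glue K \<Longrightarrow> (t, s) \<in> vertex_glue K"
proof -
  assume "(s, t) \<in> vertex_glue K"
  then obtain x where x: "x \<in> flags K" "s = triangle x" "t = triangle (cross K x)"
    by (auto simp: vertex_glue_eq)
  then show ?thesis using cross_vertex_glue[OF cross_flags(1)[OF x(1)]] cross_flags(2)[OF x(1)] by simp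
qed

lemma triangle_vertices: "x \<in> flags K \<Longrightarrow> triangle x \<in> vertices"
  by (auto simp: flags_def)

lemma vertex_glue_vertices: "(s, t) \<in> vertex_glue K \<Longrightarrow> t \<in> vertices"
  using triangle_vertices cross_flags(1) unfolding vertex_glue_eq by blast

lemma equiv_link: "equiv UNIV (link_rel\<^sup>*)"
proof (rule equivI)
  have "sym link_rel" using vertex_glue_sym by (auto simp: link_rel_def sym_def)
  then show "sym (link_rel\<^sup>*)" by (rule sym_rtrancl)
qed (auto simp: refl_rtrancl trans_rtrancl)

lemma link_vertices: "(s, t) \<in> link_rel\<^sup>* \<Longrightarrow> s \<in> vertices \<Longrightarrow> t \<in> vertices"
proof (induction rule: rtrancl_induct)
  case (step t u)
  then have t: "t \<in> vertices" by simp
  from step.hyps(2) show ?case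
    unfolding link_rel_def using vertex_glue_vertices[of t u] by (auto simp: mem_Times_iff)
qed

lemma vertex_weights_glue:
  assumes "vertex_weights y" "(s, t) \<in> (vertex_glue K)\<^sup>*"
  shows "y s = y t"
  using assms(2)
proof (induction rule: rtrancl_induct)
  case (step t u)
  then show ?case using assms(1) by (auto simp: vertex_weights_def)
qed simp

lemma edge_ratio_scale:
  assumes c: "c \<in> ptolemy_variety K \<sigma>" and i: "i \<in> simplices K" and t: "tetrad v w a b"
  shows "edge_val (scale y c) i v w / edge_val c i v w = y (i, v) * y (i, w)"
  using ptolemyD(1)[OF c edge_edges[OF i t]] scale_apply[OF edge_edges[OF i t], of y c]
  by (simp add: edge_val_def min_def max_def mult.commute)

text \<open>
  The function \<open>g\<close> recovers \<open>y s * y t\<close> from the point \<open>scale y c\<close> of the orbit.  It is required on the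
  whole Ptolemy variety, since the closedness of the orbit is a statement about points outside it.
\<close>

definition weight_monomial :: "('s \<times> nat \<Rightarrow> int) \<Rightarrow> ('s \<times> nat \<times> nat \<Rightarrow> complex) \<Rightarrow> 's \<times> nat \<Rightarrow> 's \<times> nat \<Rightarrow>
    (('s \<times> nat \<times> nat \<Rightarrow> complex) \<Rightarrow> complex) \<Rightarrow> bool" where
  "weight_monomial \<sigma> c s t g \<longleftrightarrow> global_fraction (ptolemy_variety K \<sigma>) g \<and>
     (\<forall>d\<in>ptolemy_variety K \<sigma>. g d \<noteq> 0) \<and> (\<forall>y. vertex_weights y \<longrightarrow> g (scale y c) = y s * y t)"

lemma weight_monomial_edge:
  assumes c: "c \<in> ptolemy_variety K \<sigma>" and i: "i \<in> simplices K" and t: "tetrad v w a b"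
  shows "weight_monomial \<sigma> c (i, v) (i, w) (\<lambda>d. edge_val d i v w / edge_val c i v w)"
  unfolding weight_monomial_def
proof (intro conjI ballI allI impI)
  have nz: "edge_val d i v w \<noteq> 0" if "d \<in> ptolemy_variety K \<sigma>" for d
    unfolding edge_val_def by (rule ptolemyD(1)[OF that edge_edges[OF i t]])
  show "global_fraction (ptolemy_variety K \<sigma>) (\<lambda>d. edge_val d i v w / edge_val c i v w)"
    using nz[OF c] unfolding edge_val_def
    by (intro global_fraction_divide global_fraction_coord global_fraction_const) auto
  show "edge_val d i v w / edge_val c i v w \<noteq> 0" if "d \<in> ptolemy_variety K \<sigma>" for d
    using nz[OF that] nz[OF c] by simp
  show "edge_val (scale y c) i v w / edge_val c i v w = y (i, v) * y (i, w)" for y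
    by (rule edge_ratio_scale[OF c i t])
qed

lemma weight_monomial_divide:
  assumes "weight_monomial \<sigma> c s t f" "weight_monomial \<sigma> c u v g" "weight_monomial \<sigma> c t u h"
    and t: "t \<in> vertices" "u \<in> vertices"
  shows "weight_monomial \<sigma> c s v (\<lambda>d. f d * g d / h d)"
  unfolding weight_monomial_def
proof (intro conjI ballI allI impI)
  show "global_fraction (ptolemy_variety K \<sigma>) (\<lambda>d. f d * g d / h d)"
    using assms by (intro global_fraction_divide global_fraction_mult) (auto simp: weight_monomial_def)
  show "f d * g d / h d \<noteq> 0" if "d \<in> ptolemy_variety K \<sigma>" for d
    using assms that by (auto simp: weight_monomial_def)
  show "f (scale y c) * g (scale y c) / h (scale y c) = y s * y v" if y: "vertex_weights y" for y
  proof -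
    have "y t \<noteq> 0" "y u \<noteq> 0" using y t by (auto simp: vertex_weights_def)
    then show ?thesis using assms y by (simp add: weight_monomial_def)
  qed
qed

text \<open>
  The square \<open>y v * y v\<close> comes from a triangle \<open>v, w, b\<close> as \<open>(y v * y w) * (y b * y v) / (y w * y b)\<close>.  With
  squares available one can pass from any vertex to a neighbouring one.
\<close>

lemma weight_monomial_exists:
  assumes c: "c \<in> ptolemy_variety K \<sigma>" and s: "s \<in> vertices" and "(s, t) \<in> link_rel\<^sup>*"
  shows "\<exists>g. weight_monomial \<sigma> c s t g"
proof -
  have square: "\<exists>g. weight_monomial \<sigma> c (i, v) (i, v) g" if i: "i \<in> simplices K" and v: "v < 4" for i v
  proof -
    define f :: nat where "f = (if v = 0 then 1 else 0)"
    define w where "w = third v f"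
    define b where "b = fourth v w f"
    have f: "f < 4" "v \<noteq> f" by (auto simp: f_def)
    then have t: "tetrad v w b f" using third_tetrad[OF v f] by (auto simp: tetrad_def w_def b_def)
    then have t2: "tetrad b v w f" and t3: "tetrad w b v f" by (auto simp: tetrad_def)
    have "(i, w) \<in> vertices" "(i, b) \<in> vertices" using i t by (auto simp: tetrad_def)
    then show ?thesis
      using weight_monomial_divide[OF weight_monomial_edge[OF c i t] weight_monomial_edge[OF c i t2]
          weight_monomial_edge[OF c i t3]] by blast
  qed
  show ?thesis
    using assms(3)
  proof (induction rule: rtrancl_induct)
    case base
    show ?case using square s by auto
  next
    case (step t u)
    obtain g where g: "weight_monomial \<sigma> c s t g" using step.IH by blast
    have tv: "t \<in> vertices" using link_vertices[OF step.hyps(1) s] .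
    from step.hyps(2) consider "(t, u) \<in> vertex_glue K"
      | i v w where "t = (i, v)" "u = (i, w)" "i \<in> simplices K" "v < 4" "w < 4"
      by (auto simp: link_rel_def)
    then show ?case
    proof cases
      case 1
      then have "y t = y u" if "vertex_weights y" for y
        using vertex_weights_glue[OF that] by blast
      then have "weight_monomial \<sigma> c s u g" using g by (simp add: weight_monomial_def)
      then show ?thesis by blast
    next
      case 2
      obtain h where h: "weight_monomial \<sigma> c (i, v) (i, v) h" using square[OF 2(3,4)] by blast
      show ?thesis
      proof (cases "v = w")
        case True
        then show ?thesis using g 2 by blast
      next
        case False
        have t: "tetrad v w (third v w) (fourth v w (third v w))"
          by (rule tetrad_fourth) (use 2 False in \<open>auto simp: third_def\<close>)
        show ?thesis
          using weight_monomial_divide[OF g[unfolded 2(1)] weight_monomial_edge[OF c 2(3) t] h] tv 2 by blast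
      qed
    qed
  qed
qed


text \<open>
  The coordinates on the orbit are \<open>u x = y x * y 0\<close> for the 0-cells \<open>x\<close>, where \<open>0\<close> is a base vertex in the component of
  \<open>x\<close>; in particular \<open>u 0 = y 0 * y 0\<close>.  The parametrization \<open>F\<close> uses \<open>y j * y k = u j * u k / u 0\<close> and needs no
  square roots; they are only used to see that its values lie in the orbit.  Its inverse \<open>G\<close>
  consists of the monomials from \<open>weight_monomial_exists\<close> and is defined on the whole variety,
  where the orbit is the set of solutions of \<open>F (G d) = d\<close>.
\<close>

lemma orbit_torus:
  assumes c: "c \<in> ptolemy_variety K \<sigma>" and h: "h = card (zero_cells K)"
  shows "zariski_closed_in (ptolemy_variety K \<sigma>) (orbit c) \<and> isomorphic_varieties (torus h) (orbit c)"
proof -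
  let ?X = "ptolemy_variety K \<sigma>"
  let ?R = "(vertex_glue K)\<^sup>*"
  have "zero_cells K = (\<lambda>x. ?R `` {x}) ` vertices"
    by (auto simp: zero_cells_def quotient_def)
  then have "finite (zero_cells K)" using finite_simplices by simp
  then obtain \<zeta> where \<zeta>: "bij_betw \<zeta> {..<h} (zero_cells K)"
    using ex_bij_betw_nat_finite[of "zero_cells K"] unfolding h lessThan_atLeast0 by blast
  define idx where "idx t = inv_into {..<h} \<zeta> (?R `` {t})" for t
  have cell: "?R `` {t} \<in> zero_cells K" if "t \<in> vertices" for t
    unfolding zero_cells_def using that by (rule quotientI)
  have idx: "idx t < h" "\<zeta> (idx t) = ?R `` {t}" if "t \<in> vertices" for t
    using bij_betw_inv_into_right[OF \<zeta> cell[OF that]] bij_betw_apply[OF bij_betw_inv_into[OF \<zeta>] cell[OF that]]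
    by (auto simp: idx_def)
  have idx_glue: "idx s = idx t" if "(s, t) \<in> ?R" for s t
    using equiv_class_eq[OF equiv_vertex_glue that] by (simp add: idx_def)
  have "\<exists>t. t \<in> vertices \<and> \<zeta> n = ?R `` {t}" if "n < h" for n
    using bij_betw_apply[OF \<zeta>, of n] that by (auto simp: zero_cells_def quotient_def)
  then obtain rp where rp: "\<And>n. n < h \<Longrightarrow> rp n \<in> vertices" "\<And>n. n < h \<Longrightarrow> \<zeta> n = ?R `` {rp n}"
    by metis
  have idx_rp: "idx (rp n) = n" if "n < h" for n
    using bij_betw_inv_into_left[OF \<zeta>, of n] that rp(2)[OF that] by (simp add: idx_def)
  have rp_idx: "(t, rp (idx t)) \<in> ?R" if "t \<in> vertices" for t
  proof -
    have "?R `` {t} = ?R `` {rp (idx t)}" using idx[OF that] rp(2) by simp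
    moreover have "rp (idx t) \<in> ?R `` {rp (idx t)}" by simp
    ultimately show ?thesis by blast
  qed
  define base where "base t = (SOME b. b \<in> link_rel\<^sup>* `` {t})" for t
  have base: "(t, base t) \<in> link_rel\<^sup>*" for t
    using someI[of "\<lambda>b. b \<in> link_rel\<^sup>* `` {t}" t] by (auto simp: base_def)
  have base_eq: "base s = base t" if "(s, t) \<in> link_rel\<^sup>*" for s t
    using equiv_class_eq[OF equiv_link that] by (simp add: base_def)
  have base_base: "base (base t) = base t" for t using base_eq[OF base[of t]] by simp
  have base_vertices: "base t \<in> vertices" if "t \<in> vertices" for t
    by (rule link_vertices[OF base that])
  have glue_link: "?R \<subseteq> link_rel\<^sup>*" by (rule rtrancl_mono) (auto simp: link_rel_def)
  have base_simplex: "base (i, v) = base (i, w)" if "i \<in> simplices K" "v < 4" "w < 4" for i v w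
    by (rule base_eq, rule r_into_rtrancl) (use that in \<open>auto simp: link_rel_def\<close>)
  have edge_vertices: "(i, j) \<in> vertices" "(i, k) \<in> vertices" "base (i, k) = base (i, j)"
    if "(i, j, k) \<in> edges K" for i j k
    using that base_simplex[of i k j] by (auto simp: edges_def)
  define g where "g t = (SOME f. weight_monomial \<sigma> c t (base t) f)" for t
  have g: "weight_monomial \<sigma> c t (base t) (g t)" if "t \<in> vertices" for t
    unfolding g_def by (rule someI_ex[OF weight_monomial_exists[OF c that base]])
  define F where "F u = restrict (\<lambda>(i, j, k). c (i, j, k) * u (idx (i, j)) * u (idx (i, k)) / u (idx (base (i, j))))
    (edges K)" for u :: "nat \<Rightarrow> complex"
  define G where "G d = restrict (\<lambda>n. g (rp n) d) {..<h}" for d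
  have torus: "u n \<noteq> 0" if "u \<in> torus h" "n < h" for u n
    using that by (auto simp: torus_def)
  have F: "\<exists>y. vertex_weights y \<and> F u = scale y c \<and> (\<forall>n<h. y (rp n) * y (base (rp n)) = u n)"
    if u: "u \<in> torus h" for u
  proof -
    define y where "y t = u (idx t) / csqrt (u (idx (base t)))" for t
    have nz: "u (idx t) \<noteq> 0" "u (idx (base t)) \<noteq> 0" if "t \<in> vertices" for t
      by (rule torus[OF u idx(1)[OF that]], rule torus[OF u idx(1)[OF base_vertices[OF that]]])
    have y: "vertex_weights y"
      unfolding vertex_weights_def
    proof (intro conjI ballI)
      show "y t \<noteq> 0" if "t \<in> vertices" for t using nz[OF that] by (simp add: y_def)
      show "case p of (s, t) \<Rightarrow> y s = y t" if p: "p \<in> vertex_glue K" for p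
      proof -
        obtain s t where st: "p = (s, t)" "(s, t) \<in> vertex_glue K" using p by (cases p) auto
        have R: "(s, t) \<in> ?R" using st(2) by (rule r_into_rtrancl)
        have "idx s = idx t" using R by (rule idx_glue)
        moreover have "base s = base t" by (rule base_eq[OF subsetD[OF glue_link R]])
        ultimately show ?thesis by (simp add: st(1) y_def)
      qed
    qed
    have csq: "csqrt x * csqrt x = x" for x by (simp flip: power2_eq_square)
    have "F u = scale y c"
    proof (rule scale_eqI)
      fix i j k assume e: "(i, j, k) \<in> edges K"
      have "y (i, j) * y (i, k) * c (i, j, k) =
        u (idx (i, j)) * u (idx (i, k)) * c (i, j, k) / (csqrt (u (idx (base (i, j)))) * csqrt (u (idx (base (i, j)))))"
        unfolding y_def edge_vertices(3)[OF e] by simp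
      then show "F u (i, j, k) = y (i, j) * y (i, k) * c (i, j, k)"
        unfolding csq using e by (simp add: F_def mult_ac)
    qed (simp add: F_def)
    moreover have "y (rp n) * y (base (rp n)) = u n" if n: "n < h" for n
    proof -
      let ?s = "csqrt (u (idx (base (rp n))))"
      have s: "?s \<noteq> 0" using nz(2)[OF rp(1)[OF n]] by simp
      have "y (rp n) * y (base (rp n)) = u n * (u (idx (base (rp n))) / (?s * ?s))"
        unfolding y_def base_base idx_rp[OF n] by simp
      then show ?thesis unfolding csq using nz(2)[OF rp(1)[OF n]] by simp
    qed
    ultimately show ?thesis using y by blast
  qed
  have G_scale: "G (scale y c) n = y (rp n) * y (base (rp n))" if "vertex_weights y" "n < h" for y n
    using g[OF rp(1)[OF that(2)]] that by (simp add: G_def weight_monomial_def)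
  have G_torus: "G d \<in> torus h" if "d \<in> ?X" for d
    using g rp(1) that by (auto simp: G_def torus_def weight_monomial_def)
  have FG: "F (G (scale y c)) = scale y c" if y: "vertex_weights y" for y
  proof (rule scale_eqI)
    have val: "G (scale y c) (idx t) = y t * y (base t)" if t: "t \<in> vertices" for t
    proof -
      have "(t, rp (idx t)) \<in> link_rel\<^sup>*" using rp_idx[OF t] glue_link by blast
      then have "base t = base (rp (idx t))" by (rule base_eq)
      moreover have "y t = y (rp (idx t))" by (rule vertex_weights_glue[OF y rp_idx[OF t]])
      ultimately show ?thesis using G_scale[OF y idx(1)[OF t]] by simp
    qed
    fix i j k assume e: "(i, j, k) \<in> edges K"
    have nz: "y (base (i, j)) \<noteq> 0"
      using y base_vertices[OF edge_vertices(1)[OF e]] by (auto simp: vertex_weights_def)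
    show "F (G (scale y c)) (i, j, k) = y (i, j) * y (i, k) * c (i, j, k)"
      using e nz val[OF edge_vertices(1)[OF e]] val[OF edge_vertices(2)[OF e]]
        val[OF base_vertices[OF edge_vertices(1)[OF e]]] edge_vertices(3)[OF e]
      by (simp add: F_def base_base)
  qed (simp add: F_def)
  have GF: "G (F u) = u" if u: "u \<in> torus h" for u
  proof -
    obtain y where y: "vertex_weights y" "F u = scale y c" "\<forall>n<h. y (rp n) * y (base (rp n)) = u n"
      using F[OF u] by blast
    show ?thesis
    proof
      fix n show "G (F u) n = u n"
      proof (cases "n < h")
        case True
        then show ?thesis using y G_scale[OF y(1) True] by simp
      next
        case False
        then show ?thesis using u by (auto simp: G_def torus_def PiE_def extensional_def)
      qed
    qed
  qed
  have F_orbit: "F u \<in> orbit c" if "u \<in> torus h" for u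
    using F[OF that] unfolding orbit_def by blast
  have orbit_X: "orbit c \<subseteq> ?X" by (rule orbit_ptolemy[OF c])
  have G_frac: "global_fraction Y (\<lambda>d. G d n)" if "Y \<subseteq> ?X" for Y n
  proof (cases "n < h")
    case True
    then have "global_fraction ?X (g (rp n))" using g rp(1) by (auto simp: weight_monomial_def)
    then have "global_fraction Y (g (rp n))" using that unfolding global_fraction_def by blast
    then show ?thesis using True by (simp add: G_def)
  next
    case False
    then show ?thesis by (simp add: G_def global_fraction_const)
  qed
  have FG_frac: "global_fraction ?X (\<lambda>d. F (G d) e)" if e: "e \<in> edges K" for e
  proof -
    obtain i j k where ed: "e = (i, j, k)" by (cases e)
    note v = edge_vertices[OF e[unfolded ed]]
    have nz: "G d (idx (base (i, j))) \<noteq> 0" if "d \<in> ?X" for d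
      by (rule torus[OF G_torus[OF that] idx(1)[OF base_vertices[OF v(1)]]])
    have "global_fraction ?X (\<lambda>d. c (i, j, k) * G d (idx (i, j)) * G d (idx (i, k)) / G d (idx (base (i, j))))"
      by (intro global_fraction_divide global_fraction_mult global_fraction_const G_frac nz) auto
    then show ?thesis using e by (simp add: F_def ed)
  qed
  have F_frac: "global_fraction (torus h) (\<lambda>u. F u e)" for e
  proof (cases "e \<in> edges K")
    case True
    obtain i j k where ed: "e = (i, j, k)" by (cases e)
    note v = edge_vertices[OF True[unfolded ed]]
    have nz: "u (idx (base (i, j))) \<noteq> 0" if "u \<in> torus h" for u
      by (rule torus[OF that idx(1)[OF base_vertices[OF v(1)]]])
    have "global_fraction (torus h) (\<lambda>u. c (i, j, k) * u (idx (i, j)) * u (idx (i, k)) / u (idx (base (i, j))))"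
      by (intro global_fraction_divide global_fraction_mult global_fraction_const global_fraction_coord nz)
    then show ?thesis using True by (simp add: F_def ed)
  next
    case False
    then show ?thesis by (simp add: F_def global_fraction_const)
  qed
  have orbit_fixed: "orbit c = {d \<in> ?X. \<forall>e\<in>edges K. F (G d) e = d e}"
  proof (intro equalityI subsetI)
    fix d assume "d \<in> orbit c"
    then show "d \<in> {d \<in> ?X. \<forall>e\<in>edges K. F (G d) e = d e}"
      using FG orbit_X by (auto simp: orbit_def)
  next
    fix d assume d: "d \<in> {d \<in> ?X. \<forall>e\<in>edges K. F (G d) e = d e}"
    have "F (G d) e = d e" for e
    proof (cases "e \<in> edges K")
      case True
      then show ?thesis using d by blast
    next
      case False
      then show ?thesis using ptolemyD(3)[of d \<sigma> e] d by (simp add: F_def)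
    qed
    then have "F (G d) = d" by blast
    moreover have "F (G d) \<in> orbit c" using F_orbit[OF G_torus] d by blast
    ultimately show "d \<in> orbit c" by simp
  qed
  have "zariski_closed_in ?X (orbit c)"
    unfolding orbit_fixed
    by (rule zariski_closed_equalizer) (auto intro: FG_frac global_fraction_coord)
  moreover have "isomorphic_varieties (torus h) (orbit c)"
    unfolding isomorphic_varieties_def regular_map_def
  proof (intro exI[of _ F] exI[of _ G] conjI allI ballI)
    show "F ` torus h \<subseteq> orbit c" using F_orbit by blast
    show "G ` orbit c \<subseteq> torus h" using G_torus orbit_X by blast
    show "F (G d) = d" if "d \<in> orbit c" for d using that FG by (auto simp: orbit_def)
  qed (auto intro: GF regular_fun_global_fraction F_frac G_frac[OF orbit_X])
  ultimately show ?thesis ..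
qed

section \<open>The cross-ratio map\<close>

lemma cross_ratios_fraction: "global_fraction (ptolemy_variety K \<sigma>) (\<lambda>c. cross_ratios K \<sigma> c i)"
proof (cases "i \<in> simplices K")
  case True
  then have "(i, 0, 2) \<in> edges K" "(i, 1, 3) \<in> edges K" by (auto simp: edges_def)
  then have "global_fraction (ptolemy_variety K \<sigma>)
    (\<lambda>c. of_int (\<sigma> (i, 2) * \<sigma> (i, 3)) * (c (i, 0, 3) * c (i, 1, 2) / (c (i, 0, 2) * c (i, 1, 3))))"
    by (intro global_fraction_mult global_fraction_divide global_fraction_const global_fraction_coord)
      (simp add: ptolemyD(1))
  then show ?thesis using True by (simp add: cross_ratios_def)
qed (simp add: cross_ratios_def global_fraction_const)

end

theorem theorem1p12:
  fixes K :: "'s gluing_data"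
    and \<Gamma> :: "('s \<times> nat \<times> nat) list set"
    and rep :: "('s \<times> nat \<Rightarrow> int) set \<Rightarrow> 's \<times> nat \<Rightarrow> int"
    and h :: nat
  assumes "closed_3_cycle K"
    and "h = card (boundary_components K)"
    and "pi1_generating_curves K \<Gamma>"
    and "\<And>C. C \<in> H2 K \<Longrightarrow> rep C \<in> C"
  shows "regular_on_coproduct (H2 K) (\<lambda>C. ptolemy_variety K (rep C)) (gluing_variety K \<Gamma>)
           (cross_ratio_map K rep)
       \<and> cross_ratio_map K rep ` ptolemy_coproduct K rep = gluing_variety K \<Gamma>
       \<and> (\<forall>z \<in> gluing_variety K \<Gamma>.
            disjoint_tori (H2 K) (\<lambda>C. ptolemy_variety K (rep C)) h
              {x \<in> ptolemy_coproduct K rep. cross_ratio_map K rep x = z})"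
proof -
  interpret three_cycle K by unfold_locales (rule assms(1))
  have h: "h = card (zero_cells K)" using assms(2) boundary_components_eq_zero_cells by metis
  have rep: "rep C \<in> cocycles2 K" if "C \<in> H2 K" for C
    using assms(4)[OF that] that in_quotient_imp_subset[OF equiv_H2_rel] unfolding H2_eq by blast
  have curves: "closed_normal_curve K \<gamma>" if "\<gamma> \<in> \<Gamma>" for \<gamma>
    using assms(3) that by (auto simp: pi1_generating_curves_def)
  have into: "cross_ratios K (rep C) c \<in> gluing_variety K \<Gamma>"
    if "C \<in> H2 K" "c \<in> ptolemy_variety K (rep C)" for C c
    using gluing_equations_of_side_lengths[OF ptolemy_side_lengths(2,1)[OF rep[OF that(1)] that(2)] curves] .
  have onto: "\<exists>C c. C \<in> H2 K \<and> c \<in> ptolemy_variety K (rep C) \<and> cross_ratios K (rep C) c = z"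
    if z: "z \<in> gluing_variety K \<Gamma>" for z
  proof -
    obtain l where l: "side_lengths z l" using side_lengths_exist[OF assms(3) z] by blast
    have "z \<in> simplices K \<rightarrow>\<^sub>E - {0, 1}" using z by (simp add: gluing_variety_def)
    then obtain \<sigma> c where c: "\<sigma> \<in> cocycles2 K" "c \<in> ptolemy_variety K \<sigma>" "cross_ratios K \<sigma> c = z"
      using ptolemy_of_side_lengths[OF l] by blast
    let ?C = "H2_rel `` {\<sigma>}"
    have C: "?C \<in> H2 K" unfolding H2_eq using c(1) by (rule quotientI)
    have "(\<sigma>, rep ?C) \<in> H2_rel" using assms(4)[OF C] by simp
    then obtain \<tau> where \<tau>: "\<tau> \<in> cochains1 K" "\<And>x. x \<in> faces K \<Longrightarrow> rep ?C x = \<sigma> x * coboundary1 \<tau> x"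
      by (auto simp: H2_rel_def)
    show ?thesis
      using twist_ptolemy[OF c(2) \<tau>(1) vertex_weights_one \<tau>(2)] C c(3) by blast
  qed
  have "regular_on_coproduct (H2 K) (\<lambda>C. ptolemy_variety K (rep C)) (gluing_variety K \<Gamma>) (cross_ratio_map K rep)"
    unfolding regular_on_coproduct_def regular_map_def cross_ratio_map_def
    using into cross_ratios_fraction by (auto intro: regular_fun_global_fraction)
  moreover have "cross_ratio_map K rep ` ptolemy_coproduct K rep = gluing_variety K \<Gamma>"
    unfolding cross_ratio_map_def ptolemy_coproduct_def
  proof (intro equalityI subsetI)
    fix z assume "z \<in> gluing_variety K \<Gamma>"
    then obtain C c where "C \<in> H2 K" "c \<in> ptolemy_variety K (rep C)" "cross_ratios K (rep C) c = z"
      using onto by blast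
    then show "z \<in> (\<lambda>(C, c). cross_ratios K (rep C) c) ` (SIGMA C:H2 K. ptolemy_variety K (rep C))"
      by (intro image_eqI[of _ _ "(C, c)"]) auto
  qed (use into in auto)
  moreover have "disjoint_tori (H2 K) (\<lambda>C. ptolemy_variety K (rep C)) h
      {x \<in> ptolemy_coproduct K rep. cross_ratio_map K rep x = z}" (is "disjoint_tori _ _ _ ?S")
    if z: "z \<in> gluing_variety K \<Gamma>" for z
  proof -
    obtain C c where C: "C \<in> H2 K" and c: "c \<in> ptolemy_variety K (rep C)" "cross_ratios K (rep C) c = z"
      using onto[OF z] by blast
    \<comment> \<open>The sign changes that keep the obstruction cocycle fixed are the 1-cocycles; each of them
      contributes one torus, and cohomologous ones contribute the same.\<close>
    define Z where "Z = {\<tau> \<in> cochains1 K. \<forall>x\<in>faces K. coboundary1 \<tau> x = 1}"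
    define p where "p \<tau> = twist \<tau> (\<lambda>_. 1) c" for \<tau>
    define \<T> where "\<T> = (\<lambda>\<tau>. {C} \<times> orbit (p \<tau>)) ` Z"
    have tw: "twist \<tau> y c \<in> ptolemy_variety K (rep C)" "cross_ratios K (rep C) (twist \<tau> y c) = z"
      if "\<tau> \<in> Z" "vertex_weights y" for \<tau> y
      using twist_ptolemy[OF c(1) _ that(2), of \<tau> "rep C"] that(1) c(2) by (auto simp: Z_def)
    have p: "p \<tau> \<in> ptolemy_variety K (rep C)" if "\<tau> \<in> Z" for \<tau>
      unfolding p_def by (rule tw(1)[OF that vertex_weights_one])
    have "?S = \<Union>\<T>"
    proof (intro equalityI subsetI)
      fix x assume "x \<in> ?S"
      then obtain C' c' where x: "x = (C', c')" "C' \<in> H2 K" "c' \<in> ptolemy_variety K (rep C')"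
        "cross_ratios K (rep C') c' = z"
        by (auto simp: ptolemy_coproduct_def cross_ratio_map_def)
      obtain y \<tau> where y: "vertex_weights y" "\<tau> \<in> cochains1 K" "c' = twist \<tau> y c"
        "\<And>x. x \<in> faces K \<Longrightarrow> rep C' x = rep C x * coboundary1 \<tau> x"
        using same_cross_ratios[OF rep[OF C] c(1) rep[OF x(2)] x(3)] c(2) x(4) by metis
      have "(rep C, rep C') \<in> H2_rel" using rep[OF C] rep[OF x(2)] y by (auto simp: H2_rel_def)
      then have "C' = C"
        using quotient_eqI[OF equiv_H2_rel C[unfolded H2_eq] x(2)[unfolded H2_eq] assms(4)[OF C] assms(4)[OF x(2)]]
        by simp
      then have "coboundary1 \<tau> x = 1" if "x \<in> faces K" for x
        using y(4)[OF that] cocycles2D(1)[OF rep[OF C] that] by auto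
      then have "\<tau> \<in> Z" using y(2) by (simp add: Z_def)
      moreover have "c' \<in> orbit (p \<tau>)"
        unfolding y(3) twist_eq_scale[of \<tau> y c] p_def orbit_def using y(1) by blast
      ultimately show "x \<in> \<Union>\<T>" unfolding \<T>_def x(1) \<open>C' = C\<close> by blast
    next
      fix x assume "x \<in> \<Union>\<T>"
      then obtain \<tau> y where x: "x = (C, scale y (p \<tau>))" "\<tau> \<in> Z" "vertex_weights y"
        by (auto simp: \<T>_def orbit_def)
      then show "x \<in> ?S"
        using tw[OF x(2,3)] C unfolding p_def twist_eq_scale[of \<tau> y c]
        by (auto simp: ptolemy_coproduct_def cross_ratio_map_def)
    qed
    moreover have "finite \<T>"
      unfolding \<T>_def Z_def using finite_cochains1 by simp
    moreover have "disjoint \<T>"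
    proof (rule disjointI)
      fix A B assume AB: "A \<in> \<T>" "B \<in> \<T>" "A \<noteq> B"
      then obtain \<tau> \<tau>' where t: "\<tau> \<in> Z" "\<tau>' \<in> Z" "A = {C} \<times> orbit (p \<tau>)" "B = {C} \<times> orbit (p \<tau>')"
        by (auto simp: \<T>_def)
      have "orbit (p \<tau>) = orbit (p \<tau>')" if "d \<in> orbit (p \<tau>)" "d \<in> orbit (p \<tau>')" for d
        using orbit_eq[OF that(1)] orbit_eq[OF that(2)] by (simp add: p_def twist_undefined)
      then show "A \<inter> B = {}" using AB(3) t(3,4) by blast
    qed
    moreover have "\<exists>C\<in>H2 K. \<exists>A. T = {C} \<times> A \<and> zariski_closed_in (ptolemy_variety K (rep C)) A \<and>
        isomorphic_varieties (torus h) A" if T: "T \<in> \<T>" for T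
      using T C orbit_torus[OF p h] by (auto simp: \<T>_def)
    ultimately show ?thesis unfolding disjoint_tori_def by blast
  qed
  ultimately show ?thesis by blast
qed

end
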